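(* Let $T$ be a complete first-order theory in a language $\mathcal{L}$ with big (monster) model $\mathbb{U}$. The following are equivalent: (1) $T$ is NTP2. (2) For every countable model $\mathcal{A}\models T_{\mathrm{ceq}}^*$, every indiscernible picture $I:\mathcal{A}\to\mathbb{U}$, and every formula $\phi(x;y)\in\mathcal{L}(\mathbb{U})$: if $\phi(x;y)$ does not divide vertically across $I$, then $\phi(x;y)$ does not divide across $I$.
   Context: TP2. For $2\le k<\omega$, a formula $\phi(x;y)$ of $\mathcal{L}$ has $k$-TP2 in $T$ if there is a family $(b^i_j)_{i,j\in\omega}$ in $\mathbb{U}$ such that for every $f:\omega\to\omega$ the set $\{\phi(x,b^i_{f(i)})\}_{i<\omega}$ is consistent, and for every $i<\omega$ the set $\{\phi(x,b^i_j)\}_{j<\omega}$ is $k$-inconsistent. $T$ has TP2 if some formula has $k$-TP2 in $T$ for some $k\geq 2$; otherwise $T$ is NTP2. $T_{\mathrm{ceq}}$. $\mathcal{L}_{\mathrm{ceq}}=\{E,<\}$ has two binary relation symbols; $T_{\mathrm{ceq}}$ asserts that $E$ is an equivalence relation, $<$ is a linear order, and $E$-classes are $<$-convex ($a<b<c\wedge E(a,c)\Rightarrow E(a,b)\wedge E(b,c)$). $T_{\mathrm{ceq}}^*$ is its model completion, i.e. the theory of the Fraïssé limit of the finite models of $T_{\mathrm{ceq}}$. Pictures. For $\mathcal{A}\models T_{\mathrm{ceq}}^*$ with universe $A$, an indiscernible picture $I:\mathcal{A}\to\mathbb{U}$ (also called an indiscernible $T_{\mathrm{ceq}}$-picture)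 is an injection $I$ from $A$ to $\mathbb{U}$ (more generally to $\mathbb{U}^y$, the tuples of the sort of the variable $y$) such that for all $0<n<\omega$ and $\bar a,\bar b\in A^n$ with the same quantifier-free type in $\mathcal{A}$, $I\bar a$ and $I\bar b$ have the same complete type over $\emptyset$ in $\mathbb{U}$. When $\phi(x;y)$ is considered together with $I$, the values of $I$ are in the sort of $y$. Dividing. $\mathcal{L}(\mathbb{U})$ denotes formulas with parameters from $\mathbb{U}$. $\phi(x;y)$ divides across $I$ if there is an indiscernible sequence $\langle a_i\rangle_{i<\omega}$ in $\mathcal{A}$ such that $\{\phi(x;Ia_i)\}_{i<\omega}$ is inconsistent. $\phi(x;y)$ divides vertically across $I$ if there is an indiscernible sequence $\langle a_i\rangle_{i<\omega}$ in $\mathcal{A}$ with $\neg E^{\mathcal{A}}(a_0,a_1)$ such that $\{\phi(x;Ia_i)\}_{i<\omega}$ is inconsistent.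
   Formalization: In (2), for a formula φ(x;y) with parameters c from 𝕌, the picture I is required to be indiscernible over c rather than only over ∅; with pictures indiscernible only over ∅ and arbitrary parameters, (1)⇒(2) fails, e.g. for the theory of an infinite pure set. *)

theory Defs
  imports "HOL-Library.Countable_Set"
begin

section \<open>First-order logic\<close>

record ('f, 'r) language =
  funs :: "'f set"
  rels :: "'r set"
  fun_arity :: "'f \<Rightarrow> nat"
  rel_arity :: "'r \<Rightarrow> nat"

text \<open>Variables are de Bruijn indices into an environment list; \<open>FEx\<close> binds index 0.\<close>

datatype 'f tm = Var nat | Fun 'f "'f tm list"

datatype ('f, 'r) fm =
    FEq "'f tm" "'f tm"
  | FRel 'r "'f tm list"
  | FNeg "('f, 'r) fm"
  | FConj "('f, 'r) fm" "('f, 'r) fm"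
  | FEx "('f, 'r) fm"

abbreviation FAll :: "('f, 'r) fm \<Rightarrow> ('f, 'r) fm" where
  "FAll \<phi> \<equiv> FNeg (FEx (FNeg \<phi>))"
abbreviation FDisj :: "('f, 'r) fm \<Rightarrow> ('f, 'r) fm \<Rightarrow> ('f, 'r) fm" where
  "FDisj \<phi> \<psi> \<equiv> FNeg (FConj (FNeg \<phi>) (FNeg \<psi>))"
abbreviation FImp :: "('f, 'r) fm \<Rightarrow> ('f, 'r) fm \<Rightarrow> ('f, 'r) fm" where
  "FImp \<phi> \<psi> \<equiv> FNeg (FConj \<phi> (FNeg \<psi>))"

text \<open>\<open>wf_fm L n \<phi>\<close>: \<open>\<phi>\<close> is an \<open>L\<close>-formula whose free variables are among the indices
  \<open>0, \<dots>, n - 1\<close>.\<close>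

primrec wf_tm :: "('f, 'r) language \<Rightarrow> nat \<Rightarrow> 'f tm \<Rightarrow> bool" where
  "wf_tm L n (Var i) \<longleftrightarrow> i < n"
| "wf_tm L n (Fun f ts) \<longleftrightarrow>
     f \<in> funs L \<and> length ts = fun_arity L f \<and> list_all (wf_tm L n) ts"

primrec wf_fm :: "('f, 'r) language \<Rightarrow> nat \<Rightarrow> ('f, 'r) fm \<Rightarrow> bool" where
  "wf_fm L n (FEq s t) \<longleftrightarrow> wf_tm L n s \<and> wf_tm L n t"
| "wf_fm L n (FRel R ts) \<longleftrightarrow>
     R \<in> rels L \<and> length ts = rel_arity L R \<and> list_all (wf_tm L n) ts"
| "wf_fm L n (FNeg \<phi>) \<longleftrightarrow> wf_fm L n \<phi>"
| "wf_fm L n (FConj \<phi> \<psi>) \<longleftrightarrow> wf_fm L n \<phi> \<and> wf_fm L n \<psi>"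
| "wf_fm L n (FEx \<phi>) \<longleftrightarrow> wf_fm L (Suc n) \<phi>"

abbreviation sentence :: "('f, 'r) language \<Rightarrow> ('f, 'r) fm \<Rightarrow> bool" where
  "sentence L \<equiv> wf_fm L 0"

primrec qfree :: "('f, 'r) fm \<Rightarrow> bool" where
  "qfree (FEq s t) \<longleftrightarrow> True"
| "qfree (FRel R ts) \<longleftrightarrow> True"
| "qfree (FNeg \<phi>) \<longleftrightarrow> qfree \<phi>"
| "qfree (FConj \<phi> \<psi>) \<longleftrightarrow> qfree \<phi> \<and> qfree \<psi>"
| "qfree (FEx \<phi>) \<longleftrightarrow> False"

record ('f, 'r, 'u) struct =
  univ :: "'u set"
  fun_interp :: "'f \<Rightarrow> 'u list \<Rightarrow> 'u"
  rel_interp :: "'r \<Rightarrow> 'u list \<Rightarrow> bool"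

definition tuples :: "('f, 'r, 'u) struct \<Rightarrow> nat \<Rightarrow> 'u list set" where
  "tuples M n = {as. length as = n \<and> set as \<subseteq> univ M}"

definition is_structure :: "('f, 'r) language \<Rightarrow> ('f, 'r, 'u) struct \<Rightarrow> bool" where
  "is_structure L M \<longleftrightarrow> univ M \<noteq> {} \<and>
     (\<forall>f\<in>funs L. \<forall>as\<in>tuples M (fun_arity L f). fun_interp M f as \<in> univ M)"

primrec eval_tm :: "('f, 'r, 'u) struct \<Rightarrow> 'u list \<Rightarrow> 'f tm \<Rightarrow> 'u" where
  "eval_tm M e (Var i) = e ! i"
| "eval_tm M e (Fun f ts) = fun_interp M f (map (eval_tm M e) ts)"

primrec sat :: "('f, 'r, 'u) struct \<Rightarrow> 'u list \<Rightarrow> ('f, 'r) fm \<Rightarrow> bool" where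
  "sat M e (FEq s t) \<longleftrightarrow> eval_tm M e s = eval_tm M e t"
| "sat M e (FRel R ts) \<longleftrightarrow> rel_interp M R (map (eval_tm M e) ts)"
| "sat M e (FNeg \<phi>) \<longleftrightarrow> \<not> sat M e \<phi>"
| "sat M e (FConj \<phi> \<psi>) \<longleftrightarrow> sat M e \<phi> \<and> sat M e \<psi>"
| "sat M e (FEx \<phi>) \<longleftrightarrow> (\<exists>a\<in>univ M. sat M (a # e) \<phi>)"

definition models :: "('f, 'r) language \<Rightarrow> ('f, 'r, 'u) struct \<Rightarrow> ('f, 'r) fm set \<Rightarrow> bool" where
  "models L M T \<longleftrightarrow> is_structure L M \<and> (\<forall>\<sigma>\<in>T. sat M [] \<sigma>)"

text \<open>HOL cannot quantify over types inside a formula, so satisfiability and entailment range over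
  structures carried by sets of formulas.  Since the type \<open>('f, 'r) fm\<close> is infinite and has at least
  as many elements as there are \<open>L\<close>-formulas, by the Loewenheim-Skolem theorem this is the same as
  ranging over all structures.\<close>

definition satisfiable :: "('f, 'r) language \<Rightarrow> ('f, 'r) fm set \<Rightarrow> bool" where
  "satisfiable L T \<longleftrightarrow> (\<exists>M :: ('f, 'r, ('f, 'r) fm) struct. models L M T)"

definition entails :: "('f, 'r) language \<Rightarrow> ('f, 'r) fm set \<Rightarrow> ('f, 'r) fm \<Rightarrow> bool" where
  "entails L T \<sigma> \<longleftrightarrow> (\<forall>M :: ('f, 'r, ('f, 'r) fm) struct. models L M T \<longrightarrow> sat M [] \<sigma>)"

definition complete_theory :: "('f, 'r) language \<Rightarrow> ('f, 'r) fm set \<Rightarrow> bool" where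
  "complete_theory L T \<longleftrightarrow> (\<forall>\<sigma>\<in>T. sentence L \<sigma>) \<and> satisfiable L T \<and>
     (\<forall>\<sigma>. sentence L \<sigma> \<longrightarrow> entails L T \<sigma> \<or> entails L T (FNeg \<sigma>))"

text \<open>\<open>xs\<close> and \<open>ys\<close> have the same complete type over the parameter set \<open>C\<close>.\<close>

definition same_type :: "('f, 'r) language \<Rightarrow> ('f, 'r, 'u) struct \<Rightarrow> 'u set \<Rightarrow> 'u list \<Rightarrow> 'u list \<Rightarrow> bool"
  where
  "same_type L M C xs ys \<longleftrightarrow> length xs = length ys \<and>
     (\<forall>d \<phi>. set d \<subseteq> C \<and> wf_fm L (length xs + length d) \<phi> \<longrightarrow>
        (sat M (xs @ d) \<phi> \<longleftrightarrow> sat M (ys @ d) \<phi>))"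

definition same_qf_type :: "('f, 'r) language \<Rightarrow> ('f, 'r, 'u) struct \<Rightarrow> 'u list \<Rightarrow> 'u list \<Rightarrow> bool" where
  "same_qf_type L M xs ys \<longleftrightarrow> length xs = length ys \<and>
     (\<forall>\<phi>. wf_fm L (length xs) \<phi> \<and> qfree \<phi> \<longrightarrow> (sat M xs \<phi> \<longleftrightarrow> sat M ys \<phi>))"

text \<open>A pair \<open>(\<phi>, d)\<close> with \<open>\<phi>\<close> in \<open>m + length d\<close> free variables is the formula \<open>\<phi>(x, d)\<close> with
  parameters \<open>d\<close> in the \<open>m\<close>-tuple of variables \<open>x\<close>.  A set of such formulas is consistent (with the
  elementary diagram of \<open>M\<close>) iff it is finitely satisfiable in \<open>M\<close>.\<close>

definition consistent :: "('f, 'r, 'u) struct \<Rightarrow> nat \<Rightarrow> (('f, 'r) fm \<times> 'u list) set \<Rightarrow> bool" where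
  "consistent M m p \<longleftrightarrow>
     (\<forall>q\<subseteq>p. finite q \<longrightarrow> (\<exists>a\<in>tuples M m. \<forall>(\<phi>, d)\<in>q. sat M (a @ d) \<phi>))"


section \<open>Monster models\<close>

definition embedding ::
  "('f, 'r) language \<Rightarrow> ('f, 'r, 'u) struct \<Rightarrow> ('f, 'r, 'v) struct \<Rightarrow> ('u \<Rightarrow> 'v) \<Rightarrow> bool" where
  "embedding L M N h \<longleftrightarrow> inj_on h (univ M) \<and> h ` univ M \<subseteq> univ N \<and>
     (\<forall>f\<in>funs L. \<forall>as\<in>tuples M (fun_arity L f).
        h (fun_interp M f as) = fun_interp N f (map h as)) \<and>
     (\<forall>R\<in>rels L. \<forall>as\<in>tuples M (rel_arity L R).
        rel_interp M R as \<longleftrightarrow> rel_interp N R (map h as))"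

definition automorphism :: "('f, 'r) language \<Rightarrow> ('f, 'r, 'u) struct \<Rightarrow> ('u \<Rightarrow> 'u) \<Rightarrow> bool" where
  "automorphism L M g \<longleftrightarrow> embedding L M M g \<and> g ` univ M = univ M"

definition saturated :: "('f, 'r) language \<Rightarrow> 'k rel \<Rightarrow> ('f, 'r, 'u) struct \<Rightarrow> bool" where
  "saturated L \<kappa> M \<longleftrightarrow>
     (\<forall>C p. C \<subseteq> univ M \<and> (card_of C, \<kappa>) \<in> ordLess \<and>
        (\<forall>(\<phi>, d)\<in>p. set d \<subseteq> C \<and> wf_fm L (1 + length d) \<phi>) \<and> consistent M 1 p \<longrightarrow>
        (\<exists>a\<in>univ M. \<forall>(\<phi>, d)\<in>p. sat M (a # d) \<phi>))"

definition partial_elementary ::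
  "('f, 'r) language \<Rightarrow> ('f, 'r, 'u) struct \<Rightarrow> 'u set \<Rightarrow> ('u \<Rightarrow> 'u) \<Rightarrow> bool" where
  "partial_elementary L M X h \<longleftrightarrow> X \<subseteq> univ M \<and> h ` X \<subseteq> univ M \<and>
     (\<forall>as. set as \<subseteq> X \<longrightarrow> same_type L M {} as (map h as))"

definition strongly_homogeneous :: "('f, 'r) language \<Rightarrow> 'k rel \<Rightarrow> ('f, 'r, 'u) struct \<Rightarrow> bool" where
  "strongly_homogeneous L \<kappa> M \<longleftrightarrow>
     (\<forall>X h. partial_elementary L M X h \<and> (card_of X, \<kappa>) \<in> ordLess \<longrightarrow>
        (\<exists>g. automorphism L M g \<and> (\<forall>x\<in>X. g x = h x)))"

text \<open>\<open>\<kappa>\<close> is a cardinal larger than the number of \<open>L\<close>-formulas, which is \<open>|L| + \<aleph>\<^sub>0\<close>.\<close>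

definition monster_model ::
  "('f, 'r) language \<Rightarrow> ('f, 'r) fm set \<Rightarrow> 'k rel \<Rightarrow> ('f, 'r, 'u) struct \<Rightarrow> bool" where
  "monster_model L T \<kappa> U \<longleftrightarrow>
     Card_order \<kappa> \<and> (card_of {\<phi>. \<exists>n. wf_fm L n \<phi>}, \<kappa>) \<in> ordLess \<and>
     models L U T \<and> saturated L \<kappa> U \<and> strongly_homogeneous L \<kappa> U"


section \<open>The tree property of the second kind\<close>

text \<open>\<open>x\<close> is an \<open>m\<close>-tuple and \<open>y\<close> an \<open>n\<close>-tuple of variables.  The \<open>k\<close>-inconsistency of a row is that
  of the family indexed by \<open>j\<close>: any \<open>k\<close> distinct indices give an inconsistent set.\<close>

definition has_kTP2 ::
  "('f, 'r) language \<Rightarrow> ('f, 'r, 'u) struct \<Rightarrow> nat \<Rightarrow> nat \<Rightarrow> nat \<Rightarrow> ('f, 'r) fm \<Rightarrow> bool" where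
  "has_kTP2 L U k m n \<phi> \<longleftrightarrow>
     (\<exists>b :: nat \<Rightarrow> nat \<Rightarrow> 'u list.
        (\<forall>i j. b i j \<in> tuples U n) \<and>
        (\<forall>f :: nat \<Rightarrow> nat. consistent U m {(\<phi>, b i (f i)) | i. True}) \<and>
        (\<forall>i. \<forall>J. finite J \<and> card J = k \<longrightarrow> \<not> consistent U m {(\<phi>, b i j) | j. j \<in> J}))"

definition NTP2 :: "('f, 'r) language \<Rightarrow> ('f, 'r, 'u) struct \<Rightarrow> bool" where
  "NTP2 L U \<longleftrightarrow> \<not> (\<exists>k m n \<phi>. 2 \<le> k \<and> wf_fm L (m + n) \<phi> \<and> has_kTP2 L U k m n \<phi>)"


section \<open>Convexly ordered equivalence relations\<close>

datatype ceq_rel = CE | CLess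

definition L_ceq :: "(unit, ceq_rel) language" where
  "L_ceq = \<lparr>funs = {}, rels = {CE, CLess}, fun_arity = (\<lambda>_. 0), rel_arity = (\<lambda>_. 2)\<rparr>"

abbreviation fE :: "nat \<Rightarrow> nat \<Rightarrow> (unit, ceq_rel) fm" where
  "fE i j \<equiv> FRel CE [Var i, Var j]"
abbreviation fL :: "nat \<Rightarrow> nat \<Rightarrow> (unit, ceq_rel) fm" where
  "fL i j \<equiv> FRel CLess [Var i, Var j]"

definition T_ceq :: "(unit, ceq_rel) fm set" where
  "T_ceq =
    {FAll (fE 0 0),
     FAll (FAll (FImp (fE 0 1) (fE 1 0))),
     FAll (FAll (FAll (FImp (FConj (fE 0 1) (fE 1 2)) (fE 0 2)))),
     FAll (FNeg (fL 0 0)),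
     FAll (FAll (FAll (FImp (FConj (fL 0 1) (fL 1 2)) (fL 0 2)))),
     FAll (FAll (FDisj (fL 0 1) (FDisj (FEq (Var 0) (Var 1)) (fL 1 0)))),
     FAll (FAll (FAll
       (FImp (FConj (FConj (fL 0 1) (fL 1 2)) (fE 0 2)) (FConj (fE 0 1) (fE 1 2)))))}"

text \<open>For relational \<open>L\<close> only (so that finitely generated substructures are the finite ones).
  \<open>K\<close> is a class of finite \<open>L\<close>-structures closed under isomorphism: \<open>M\<close> is countable, its age is
  \<open>K\<close>, and isomorphisms between finite substructures extend to automorphisms.\<close>

definition fraisse_limit ::
  "('f, 'r) language \<Rightarrow> ('f, 'r, 'u) struct set \<Rightarrow> ('f, 'r, 'u) struct \<Rightarrow> bool" where
  "fraisse_limit L K M \<longleftrightarrow> is_structure L M \<and> countable (univ M) \<and>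
     (\<forall>B. is_structure L B \<and> finite (univ B) \<longrightarrow> (B \<in> K \<longleftrightarrow> (\<exists>h. embedding L B M h))) \<and>
     (\<forall>X h. finite X \<and> X \<subseteq> univ M \<and> embedding L (M\<lparr>univ := X\<rparr>) M h \<longrightarrow>
        (\<exists>g. automorphism L M g \<and> (\<forall>x\<in>X. g x = h x)))"

text \<open>The theory of the (up to isomorphism unique) Fraisse limit of the finite models of
  \<open>T_ceq\<close>.\<close>

definition T_ceq_star :: "(unit, ceq_rel) fm set" where
  "T_ceq_star = {\<sigma>. sentence L_ceq \<sigma> \<and>
     (\<forall>F :: (unit, ceq_rel, nat) struct.
        fraisse_limit L_ceq {B. finite (univ B) \<and> models L_ceq B T_ceq} F \<longrightarrow> sat F [] \<sigma>)}"


section \<open>Pictures and dividing\<close>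

definition indiscernible_sequence ::
  "('f, 'r) language \<Rightarrow> ('f, 'r, 'a) struct \<Rightarrow> (nat \<Rightarrow> 'a) \<Rightarrow> bool" where
  "indiscernible_sequence L A a \<longleftrightarrow> range a \<subseteq> univ A \<and>
     (\<forall>is js. sorted_wrt (<) is \<and> sorted_wrt (<) js \<and> length is = length js \<longrightarrow>
        same_type L A {} (map a is) (map a js))"

text \<open>A picture \<open>I\<close> of \<open>A\<close> in the \<open>n\<close>-tuples of \<open>U\<close>, indiscernible over the parameter set \<open>C\<close>;
  for \<open>C = {}\<close> the tuples \<open>I as\<close> and \<open>I bs\<close> have the same complete type over the empty set.

  For a formula \<open>\<phi>(x; y, c)\<close> with parameters \<open>c\<close> one has to take \<open>C = set c\<close>.  A picture that is
  merely indiscernible over \<open>{}\<close> is not controlled by \<open>c\<close>: with distinct \<open>E\<close>-equivalent points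
  \<open>p\<close>, \<open>q\<close> of \<open>A\<close>, the formula \<open>(y \<noteq> I p \<and> y \<noteq> I q) \<or> ((y = I p \<or> y = I q) \<and> x = y)\<close> divides across
  \<open>I\<close> along a sequence through \<open>p\<close> and \<open>q\<close>, but never vertically, in every theory.\<close>

definition indiscernible_picture ::
  "('f, 'r) language \<Rightarrow> ('f, 'r, 'u) struct \<Rightarrow> 'u set \<Rightarrow> nat \<Rightarrow>
   (unit, ceq_rel, 'a) struct \<Rightarrow> ('a \<Rightarrow> 'u list) \<Rightarrow> bool" where
  "indiscernible_picture L U C n A I \<longleftrightarrow>
     inj_on I (univ A) \<and> I ` univ A \<subseteq> tuples U n \<and>
     (\<forall>as bs. as \<noteq> [] \<and> set as \<subseteq> univ A \<and> set bs \<subseteq> univ A \<and> same_qf_type L_ceq A as bs \<longrightarrow>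
        same_type L U C (concat (map I as)) (concat (map I bs)))"

text \<open>The environment of \<open>\<phi>(x; y, c)\<close> is \<open>x @ y @ c\<close>.\<close>

definition divides_across ::
  "(unit, ceq_rel, 'a) struct \<Rightarrow> ('f, 'r, 'u) struct \<Rightarrow> ('a \<Rightarrow> 'u list) \<Rightarrow>
   nat \<Rightarrow> ('f, 'r) fm \<Rightarrow> 'u list \<Rightarrow> bool" where
  "divides_across A U I m \<phi> c \<longleftrightarrow>
     (\<exists>a. indiscernible_sequence L_ceq A a \<and>
        \<not> consistent U m {(\<phi>, I (a i) @ c) | i. True})"

definition divides_vertically_across ::
  "(unit, ceq_rel, 'a) struct \<Rightarrow> ('f, 'r, 'u) struct \<Rightarrow> ('a \<Rightarrow> 'u list) \<Rightarrow>
   nat \<Rightarrow> ('f, 'r) fm \<Rightarrow> 'u list \<Rightarrow> bool" where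
  "divides_vertically_across A U I m \<phi> c \<longleftrightarrow>
     (\<exists>a. indiscernible_sequence L_ceq A a \<and> \<not> rel_interp A CE [a 0, a 1] \<and>
        \<not> consistent U m {(\<phi>, I (a i) @ c) | i. True})"

end

theory Submission
  imports Defs "HOL-Library.Ramsey"
begin

text \<open>The models of \<open>T_ceq_star\<close> are the convexly ordered equivalence relations in which every class and
  the order of the classes are dense without endpoints.  Partial isomorphisms between such structures
  extend by one point, which gives quantifier elimination.

  If \<open>T\<close> is NTP2 and \<open>\<phi>\<close> divides across \<open>I\<close> but not vertically, then a dividing sequence stays in one
  class.  By indiscernibility of \<open>I\<close> any \<open>k\<close> elements of one class give an inconsistent set, for a
  fixed \<open>k\<close>, while increasing sequences through different classes give consistent sets.  An increasing
  sequence of classes, with an increasing sequence in each, is then an array witnessing \<open>k\<close>-TP2.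

  Conversely, Ramsey's theorem, compactness and saturation turn an array witnessing \<open>k\<close>-TP2 into an
  indiscernible picture sending classes to rows.  The formula then divides along any increasing
  sequence in one class, but never vertically.\<close>

section \<open>Rich convexly ordered equivalence relations\<close>

text \<open>Both implications rest on the fact that the existence of a common solution of finitely
  many instances of \<phi> is itself one first-order formula about the parameters of these
  instances. Indiscernibility therefore moves consistency and inconsistency between tuples of the
  same quantifier-free type, and compactness can demand either of a picture yet to be built. An
  array witnessing TP2 may repeat entries, whereas a picture is injective. So injectivity comes
  last: a collision would spread by indiscernibility along an increasing sequence in one class, and
  k-inconsistency would contradict the consistency of a single instance. As
  \<open>T_ceq_star\<close> is defined through Fraisse limits, its models are identified from both
  sides: every Fraisse limit is rich, and a countable rich structure is a Fraisse limit, so that the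
  defining condition is not vacuous. Parameters of \<phi> are harmless because the picture is
  indiscernible over them: they are appended to every entry of the array. The formula supplied by
  TP2 has none.\<close>

abbreviation eqv :: "('f, ceq_rel, 'a) struct \<Rightarrow> 'a \<Rightarrow> 'a \<Rightarrow> bool" where
  "eqv A x y \<equiv> rel_interp A CE [x, y]"
abbreviation lss :: "('f, ceq_rel, 'a) struct \<Rightarrow> 'a \<Rightarrow> 'a \<Rightarrow> bool" where
  "lss A x y \<equiv> rel_interp A CLess [x, y]"

definition ceq :: "('f, ceq_rel, 'a) struct \<Rightarrow> bool" where
  "ceq A \<longleftrightarrow> univ A \<noteq> {} \<and>
     (\<forall>x\<in>univ A. eqv A x x \<and> \<not> lss A x x) \<and>
     (\<forall>x\<in>univ A. \<forall>y\<in>univ A. (eqv A x y \<longrightarrow> eqv A y x) \<and> (lss A x y \<or> x = y \<or> lss A y x)) \<and>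
     (\<forall>x\<in>univ A. \<forall>y\<in>univ A. \<forall>z\<in>univ A.
        (eqv A x y \<and> eqv A y z \<longrightarrow> eqv A x z) \<and>
        (lss A x y \<and> lss A y z \<longrightarrow> lss A x z) \<and>
        (lss A x y \<and> lss A y z \<and> eqv A x z \<longrightarrow> eqv A x y \<and> eqv A y z))"

text \<open>By convexity the intermediate point in the penultimate clause lies in the class of
  \<open>x\<close> and \<open>z\<close>; the last clause asks for a third class strictly between two
  classes.\<close>

definition rich :: "('f, ceq_rel, 'a) struct \<Rightarrow> bool" where
  "rich A \<longleftrightarrow> ceq A \<and>
     (\<forall>x\<in>univ A. \<exists>y\<in>univ A. lss A x y \<and> eqv A x y) \<and>
     (\<forall>x\<in>univ A. \<exists>y\<in>univ A. lss A y x \<and> eqv A y x) \<and>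
     (\<forall>x\<in>univ A. \<exists>y\<in>univ A. lss A x y \<and> \<not> eqv A x y) \<and>
     (\<forall>x\<in>univ A. \<exists>y\<in>univ A. lss A y x \<and> \<not> eqv A y x) \<and>
     (\<forall>x\<in>univ A. \<forall>z\<in>univ A. lss A x z \<and> eqv A x z \<longrightarrow>
        (\<exists>y\<in>univ A. lss A x y \<and> lss A y z)) \<and>
     (\<forall>x\<in>univ A. \<forall>z\<in>univ A. lss A x z \<and> \<not> eqv A x z \<longrightarrow>
        (\<exists>y\<in>univ A. lss A x y \<and> lss A y z \<and> \<not> eqv A x y \<and> \<not> eqv A y z))"

lemma
  assumes "ceq A"
  shows ceq_nonempty: "univ A \<noteq> {}"
    and ceq_refl: "x \<in> univ A \<Longrightarrow> eqv A x x"
    and ceq_irrefl: "x \<in> univ A \<Longrightarrow> \<not> lss A x x"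
    and ceq_sym: "x \<in> univ A \<Longrightarrow> y \<in> univ A \<Longrightarrow> eqv A x y \<Longrightarrow> eqv A y x"
    and ceq_trichotomy: "x \<in> univ A \<Longrightarrow> y \<in> univ A \<Longrightarrow> lss A x y \<or> x = y \<or> lss A y x"
    and ceq_eqv_trans:
      "x \<in> univ A \<Longrightarrow> y \<in> univ A \<Longrightarrow> z \<in> univ A \<Longrightarrow> eqv A x y \<Longrightarrow> eqv A y z \<Longrightarrow> eqv A x z"
    and ceq_lss_trans:
      "x \<in> univ A \<Longrightarrow> y \<in> univ A \<Longrightarrow> z \<in> univ A \<Longrightarrow> lss A x y \<Longrightarrow> lss A y z \<Longrightarrow> lss A x z"
    and ceq_convex1: "x \<in> univ A \<Longrightarrow> y \<in> univ A \<Longrightarrow> z \<in> univ A \<Longrightarrow>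
       lss A x y \<Longrightarrow> lss A y z \<Longrightarrow> eqv A x z \<Longrightarrow> eqv A x y"
    and ceq_convex2: "x \<in> univ A \<Longrightarrow> y \<in> univ A \<Longrightarrow> z \<in> univ A \<Longrightarrow>
       lss A x y \<Longrightarrow> lss A y z \<Longrightarrow> eqv A x z \<Longrightarrow> eqv A y z"
  using assms unfolding ceq_def by (blast+)

lemma ceq_asym:
  "ceq A \<Longrightarrow> x \<in> univ A \<Longrightarrow> y \<in> univ A \<Longrightarrow> lss A x y \<Longrightarrow> \<not> lss A y x"
  by (meson ceq_irrefl ceq_lss_trans)

lemma models_T_ceq: "models L_ceq A T_ceq \<longleftrightarrow> ceq A"
proof -
  \<comment> \<open>The quantifiers stand in the order produced by the de Bruijn indices: the
    innermost one binds index 0.\<close>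
  have "models L_ceq A T_ceq \<longleftrightarrow> univ A \<noteq> {} \<and>
     (\<forall>x\<in>univ A. eqv A x x) \<and>
     (\<forall>y\<in>univ A. \<forall>x\<in>univ A. eqv A x y \<longrightarrow> eqv A y x) \<and>
     (\<forall>z\<in>univ A. \<forall>y\<in>univ A. \<forall>x\<in>univ A. eqv A x y \<and> eqv A y z \<longrightarrow> eqv A x z) \<and>
     (\<forall>x\<in>univ A. \<not> lss A x x) \<and>
     (\<forall>z\<in>univ A. \<forall>y\<in>univ A. \<forall>x\<in>univ A. lss A x y \<and> lss A y z \<longrightarrow> lss A x z) \<and>
     (\<forall>y\<in>univ A. \<forall>x\<in>univ A. lss A x y \<or> x = y \<or> lss A y x) \<and>
     (\<forall>z\<in>univ A. \<forall>y\<in>univ A. \<forall>x\<in>univ A.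
        lss A x y \<and> lss A y z \<and> eqv A x z \<longrightarrow> eqv A x y \<and> eqv A y z)"
    unfolding models_def is_structure_def T_ceq_def
    by (simp add: L_ceq_def, intro conj_cong refl) blast+
  also have "\<dots> \<longleftrightarrow> ceq A"
    unfolding ceq_def ball_conj_distrib by (intro iffI conjI; elim conjE; assumption?; metis)
  finally show ?thesis .
qed

lemma rich_ceq: "rich A \<Longrightarrow> ceq A"
  by (simp add: rich_def)

text \<open>A relation instead of a function makes converses, extensions by a pair and unions of
  chains easy to handle, and \<open>set (zip xs ys)\<close> then expresses that two tuples have the
  same quantifier-free type. Single-valuedness and injectivity are consequences of preserving a
  linear order.\<close>

definition piso ::
  "('f, ceq_rel, 'a) struct \<Rightarrow> ('f, ceq_rel, 'b) struct \<Rightarrow> ('a \<times> 'b) set \<Rightarrow> bool" where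
  "piso A B p \<longleftrightarrow> p \<subseteq> univ A \<times> univ B \<and>
     (\<forall>(x, y)\<in>p. \<forall>(x', y')\<in>p. (eqv A x x' \<longleftrightarrow> eqv B y y') \<and> (lss A x x' \<longleftrightarrow> lss B y y'))"

lemma pisoI:
  assumes "\<And>x y. (x, y) \<in> p \<Longrightarrow> x \<in> univ A \<and> y \<in> univ B"
    and "\<And>x y x' y'. (x, y) \<in> p \<Longrightarrow> (x', y') \<in> p \<Longrightarrow>
      (eqv A x x' \<longleftrightarrow> eqv B y y') \<and> (lss A x x' \<longleftrightarrow> lss B y y')"
  shows "piso A B p"
  unfolding piso_def
proof (intro conjI ballI subsetI)
  fix z assume "z \<in> p"
  then show "z \<in> univ A \<times> univ B" using assms(1) by (cases z) simp
  fix z' assume "z' \<in> p"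
  show "case z of (x, y) \<Rightarrow> \<forall>(x', y')\<in>p. (eqv A x x' \<longleftrightarrow> eqv B y y') \<and> (lss A x x' \<longleftrightarrow> lss B y y')"
    using assms(2) \<open>z \<in> p\<close> by (cases z) auto
qed

lemma pisoD:
  assumes "piso A B p" "(x, y) \<in> p"
  shows "x \<in> univ A" "y \<in> univ B"
    "(x', y') \<in> p \<Longrightarrow> eqv A x x' \<longleftrightarrow> eqv B y y'" "(x', y') \<in> p \<Longrightarrow> lss A x x' \<longleftrightarrow> lss B y y'"
  using assms unfolding piso_def by fast+

lemma piso_eq_iff:
  assumes "ceq A" "ceq B" "piso A B p" "(x, y) \<in> p" "(x', y') \<in> p"
  shows "x = x' \<longleftrightarrow> y = y'"
  using ceq_trichotomy[OF assms(1), of x x'] ceq_trichotomy[OF assms(2), of y y']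
    ceq_irrefl[OF assms(1)] ceq_irrefl[OF assms(2)]
    pisoD[OF assms(3) assms(4)] pisoD[OF assms(3) assms(5)] assms(4,5) by blast

lemma piso_subset: "piso A B p \<Longrightarrow> q \<subseteq> p \<Longrightarrow> piso A B q"
  unfolding piso_def by blast

lemma piso_converse: "piso A B p \<Longrightarrow> piso B A (p\<inverse>)"
  unfolding piso_def by fast

lemma piso_empty: "piso A B {}"
  by (simp add: piso_def)

lemma piso_insert:
  assumes "ceq A" "ceq B" "piso A B p" "a \<in> univ A" "b \<in> univ B"
    and "\<And>x y. (x, y) \<in> p \<Longrightarrow> (eqv A a x \<longleftrightarrow> eqv B b y) \<and> (lss A a x \<longleftrightarrow> lss B b y) \<and> (lss A x a \<longleftrightarrow> lss B y b)"
  shows "piso A B (insert (a, b) p)"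
proof -
  have sym: "eqv A x a \<longleftrightarrow> eqv B y b" if "(x, y) \<in> p" for x y
    using assms(6)[OF that] pisoD(1,2)[OF assms(3) that] assms(4,5)
      ceq_sym[OF \<open>ceq A\<close>] ceq_sym[OF \<open>ceq B\<close>] by blast
  have refl: "eqv A a a" "eqv B b b" "\<not> lss A a a" "\<not> lss B b b"
    by (simp_all add: assms(1,2,4,5) ceq_refl ceq_irrefl)
  show ?thesis
  proof (rule pisoI)
    fix x y assume xy: "(x, y) \<in> insert (a, b) p"
    then show "x \<in> univ A \<and> y \<in> univ B" using assms(4,5) pisoD(1,2)[OF assms(3)] by blast
    fix x' y' assume xy': "(x', y') \<in> insert (a, b) p"
    have "(x = a \<and> y = b) \<or> (x, y) \<in> p" "(x' = a \<and> y' = b) \<or> (x', y') \<in> p"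
      using xy xy' by blast+
    then show "(eqv A x x' \<longleftrightarrow> eqv B y y') \<and> (lss A x x' \<longleftrightarrow> lss B y y')"
      by (elim disjE conjE; hypsubst?)
        (simp_all only: refl sym assms(6) pisoD(3,4)[OF assms(3)])
  qed
qed

section \<open>Cuts over finite sets of points and of classes\<close>

lemma ceq_asymp_on: "ceq A \<Longrightarrow> S \<subseteq> univ A \<Longrightarrow> asymp_on S (lss A)"
  by (rule asymp_onI) (meson ceq_asym subsetD)

lemma ceq_transp_on: "ceq A \<Longrightarrow> S \<subseteq> univ A \<Longrightarrow> transp_on S (lss A)"
  by (rule transp_onI) (meson ceq_lss_trans subsetD)

lemma ceq_finite_max:
  assumes "ceq A" "finite S" "S \<noteq> {}" "S \<subseteq> univ A"
  obtains m where "m \<in> S" "\<And>x. x \<in> S \<Longrightarrow> x = m \<or> lss A x m"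
proof -
  obtain m where "m \<in> S" "\<forall>x\<in>S. x \<noteq> m \<longrightarrow> \<not> lss A m x"
    using Finite_Set.bex_max_element[OF assms(2) ceq_asymp_on ceq_transp_on] assms by blast
  then show ?thesis using that assms(4) ceq_trichotomy[OF assms(1)] by blast
qed

lemma ceq_finite_min:
  assumes "ceq A" "finite S" "S \<noteq> {}" "S \<subseteq> univ A"
  obtains m where "m \<in> S" "\<And>x. x \<in> S \<Longrightarrow> x = m \<or> lss A m x"
proof -
  obtain m where "m \<in> S" "\<forall>x\<in>S. x \<noteq> m \<longrightarrow> \<not> lss A x m"
    using Finite_Set.bex_min_element[OF assms(2) ceq_asymp_on ceq_transp_on] assms by blast
  then show ?thesis using that assms(4) ceq_trichotomy[OF assms(1)] by blast
qed

text \<open>Only the greatest element of \<open>P\<close> and the least element of \<open>Q\<close>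
  matter. If both exist, density of the class gives \<open>b\<close>; if one of the sets is empty,
  the absence of endpoints does; if both are empty, \<open>u\<close> itself serves.\<close>

lemma rich_between:
  assumes A: "rich A" and u: "u \<in> univ A"
    and P: "finite P" "P \<subseteq> univ A" and Q: "finite Q" "Q \<subseteq> univ A"
    and uP: "\<And>x. x \<in> P \<Longrightarrow> eqv A u x" and uQ: "\<And>x. x \<in> Q \<Longrightarrow> eqv A u x"
    and PQ: "\<And>x y. x \<in> P \<Longrightarrow> y \<in> Q \<Longrightarrow> lss A x y"
  obtains b where "b \<in> univ A" "eqv A u b" "\<And>x. x \<in> P \<Longrightarrow> lss A x b" "\<And>x. x \<in> Q \<Longrightarrow> lss A b x"
proof -
  note cA = rich_ceq[OF A]
  note R = A[unfolded rich_def]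
  note tr = ceq_lss_trans[OF cA] ceq_eqv_trans[OF cA]
  have up: "lss A x b" if "x = p \<or> lss A x p" "lss A p b" "x \<in> P" "b \<in> univ A" "p \<in> P" for x p b
    using that P(2) tr(1)[of x p b] by blast
  have dn: "lss A b x" if "x = q \<or> lss A q x" "lss A b q" "x \<in> Q" "b \<in> univ A" "q \<in> Q" for x q b
    using that Q(2) tr(1)[of b q x] by blast
  consider "P = {}" "Q = {}" | "P = {}" "Q \<noteq> {}" | "P \<noteq> {}" "Q = {}" | "P \<noteq> {}" "Q \<noteq> {}" by blast
  then show ?thesis
  proof cases
    case 1 then show ?thesis using that[OF u ceq_refl[OF cA u]] by blast
  next
    case 2
    obtain q where q: "q \<in> Q" "\<And>x. x \<in> Q \<Longrightarrow> x = q \<or> lss A q x"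
      using ceq_finite_min[OF cA Q(1) 2(2) Q(2)] by blast
    have qA: "q \<in> univ A" using q(1) Q(2) by blast
    obtain b where b: "b \<in> univ A" "lss A b q" "eqv A b q" using R qA by blast
    show ?thesis
    proof (rule that[OF b(1)])
      show "eqv A u b" by (rule tr(2)[OF u qA b(1) uQ[OF q(1)] ceq_sym[OF cA b(1) qA b(3)]])
    qed (use b(1,2) 2 q dn in auto)
  next
    case 3
    obtain p where p: "p \<in> P" "\<And>x. x \<in> P \<Longrightarrow> x = p \<or> lss A x p"
      using ceq_finite_max[OF cA P(1) 3(1) P(2)] by blast
    have pA: "p \<in> univ A" using p(1) P(2) by blast
    obtain b where b: "b \<in> univ A" "lss A p b" "eqv A p b" using R pA by blast
    show ?thesis
    proof (rule that[OF b(1)])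
      show "eqv A u b" by (rule tr(2)[OF u pA b(1) uP[OF p(1)] b(3)])
    qed (use b(1,2) 3 p up in auto)
  next
    case 4
    obtain p where p: "p \<in> P" "\<And>x. x \<in> P \<Longrightarrow> x = p \<or> lss A x p"
      using ceq_finite_max[OF cA P(1) 4(1) P(2)] by blast
    obtain q where q: "q \<in> Q" "\<And>x. x \<in> Q \<Longrightarrow> x = q \<or> lss A q x"
      using ceq_finite_min[OF cA Q(1) 4(2) Q(2)] by blast
    have U: "p \<in> univ A" "q \<in> univ A" using p(1) q(1) P(2) Q(2) by blast+
    have pq: "lss A p q" "eqv A p q"
      using PQ[OF p(1) q(1)] tr(2)[OF U(1) u U(2) ceq_sym[OF cA u U(1) uP[OF p(1)]] uQ[OF q(1)]] .
    then obtain b where b: "b \<in> univ A" "lss A p b" "lss A b q" using R U by blast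
    have "eqv A p b" by (rule ceq_convex1[OF cA U(1) b(1) U(2) b(2,3) pq(2)])
    then have "eqv A u b" by (rule tr(2)[OF u U(1) b(1) uP[OF p(1)]])
    then show ?thesis using that[OF b(1)] up[OF p(2) b(2) _ b(1) p(1)] dn[OF q(2) b(3) _ b(1) q(1)] by simp
  qed
qed

text \<open>The same cut one level up, by density and absence of endpoints in the order of the
  classes. Convexity carries non-equivalence from the extreme elements of \<open>P\<close> and
  \<open>Q\<close> to all the others.\<close>

lemma rich_between_classes:
  assumes A: "rich A"
    and P: "finite P" "P \<subseteq> univ A" and Q: "finite Q" "Q \<subseteq> univ A"
    and PQ: "\<And>x y. x \<in> P \<Longrightarrow> y \<in> Q \<Longrightarrow> lss A x y \<and> \<not> eqv A x y"
  obtains b where "b \<in> univ A" "\<And>x. x \<in> P \<Longrightarrow> lss A x b \<and> \<not> eqv A b x"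
    "\<And>x. x \<in> Q \<Longrightarrow> lss A b x \<and> \<not> eqv A b x"
proof -
  note cA = rich_ceq[OF A]
  note R = A[unfolded rich_def]
  note tr = ceq_lss_trans[OF cA]
  have up: "lss A x b \<and> \<not> eqv A b x"
    if "x = p \<or> lss A x p" "lss A p b" "\<not> eqv A p b" "x \<in> P" "b \<in> univ A" "p \<in> P" for x p b
    using that P(2) tr[of x p b] ceq_convex2[OF cA, of x p b] ceq_sym[OF cA, of b x] by blast
  have dn: "lss A b x \<and> \<not> eqv A b x"
    if "x = q \<or> lss A q x" "lss A b q" "\<not> eqv A b q" "x \<in> Q" "b \<in> univ A" "q \<in> Q" for x q b
    using that Q(2) tr[of b q x] ceq_convex1[OF cA, of b q x] by blast
  consider "P = {}" "Q = {}" | "P = {}" "Q \<noteq> {}" | "P \<noteq> {}" "Q = {}" | "P \<noteq> {}" "Q \<noteq> {}" by blast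
  then show ?thesis
  proof cases
    case 1
    obtain b where "b \<in> univ A" using ceq_nonempty[OF cA] by blast
    then show ?thesis using that 1 by blast
  next
    case 2
    obtain q where q: "q \<in> Q" "\<And>x. x \<in> Q \<Longrightarrow> x = q \<or> lss A q x"
      using ceq_finite_min[OF cA Q(1) 2(2) Q(2)] by blast
    have qA: "q \<in> univ A" using q(1) Q(2) by blast
    obtain b where b: "b \<in> univ A" "lss A b q" "\<not> eqv A b q" using R qA by blast
    show ?thesis using that[OF b(1)] dn[OF q(2) b(2,3) _ b(1) q(1)] 2(1) by simp
  next
    case 3
    obtain p where p: "p \<in> P" "\<And>x. x \<in> P \<Longrightarrow> x = p \<or> lss A x p"
      using ceq_finite_max[OF cA P(1) 3(1) P(2)] by blast
    have pA: "p \<in> univ A" using p(1) P(2) by blast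
    obtain b where b: "b \<in> univ A" "lss A p b" "\<not> eqv A p b" using R pA by blast
    show ?thesis using that[OF b(1)] up[OF p(2) b(2,3) _ b(1) p(1)] 3(2) by simp
  next
    case 4
    obtain p where p: "p \<in> P" "\<And>x. x \<in> P \<Longrightarrow> x = p \<or> lss A x p"
      using ceq_finite_max[OF cA P(1) 4(1) P(2)] by blast
    obtain q where q: "q \<in> Q" "\<And>x. x \<in> Q \<Longrightarrow> x = q \<or> lss A q x"
      using ceq_finite_min[OF cA Q(1) 4(2) Q(2)] by blast
    have U: "p \<in> univ A" "q \<in> univ A" using p(1) q(1) P(2) Q(2) by blast+
    obtain b where b: "b \<in> univ A" "lss A p b" "lss A b q" "\<not> eqv A p b" "\<not> eqv A b q"
      using R U PQ[OF p(1) q(1)] by blast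
    show ?thesis
      using that[OF b(1)] up[OF p(2) b(2,4) _ b(1) p(1)] dn[OF q(2) b(3,5) _ b(1) q(1)] by simp
  qed
qed

text \<open>By convexity a point outside a class cannot lie between two points of the class, so it
  has the same position relative to all of them.\<close>

lemma ceq_lss_class:
  assumes "ceq A" "x \<in> univ A" "y \<in> univ A" "z \<in> univ A" "eqv A x y" "\<not> eqv A x z"
  shows "lss A x z \<longleftrightarrow> lss A y z" "lss A z x \<longleftrightarrow> lss A z y"
proof -
  have "lss A y z" if "lss A x z" "eqv A x y" "\<not> eqv A x z" "x \<in> univ A" "y \<in> univ A" for x y
    using that assms(4) ceq_trichotomy[OF assms(1), of y z] ceq_convex1[OF assms(1), of x z y] by blast
  moreover have "lss A z y" if "lss A z x" "eqv A x y" "\<not> eqv A x z" "x \<in> univ A" "y \<in> univ A" for x y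
    using that assms(4) ceq_trichotomy[OF assms(1), of y z] ceq_convex2[OF assms(1), of y z x]
      ceq_sym[OF assms(1)] by blast
  moreover have "eqv A y x" "\<not> eqv A y z"
    using assms ceq_sym[OF assms(1), of x y] ceq_eqv_trans[OF assms(1), of x y z] by blast+
  ultimately show "lss A x z \<longleftrightarrow> lss A y z" "lss A z x \<longleftrightarrow> lss A z y"
    using assms(2-6) by blast+
qed

text \<open>If \<open>a\<close> is new but its class meets the domain in \<open>x\<close>, its image
  is sought in the class of the image of \<open>x\<close>. Only points of that class constrain the
  cut; all others compare with \<open>a\<close> as they do with \<open>x\<close>. If the class of
  \<open>a\<close> is new as well, the image goes to a new class in the corresponding gap. The
  source may be finite, which later yields the age of a rich structure.\<close>

lemma piso_extend:
  assumes A: "ceq A" and B: "rich B" and p: "piso A B p" "finite p" and a: "a \<in> univ A"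
  obtains b where "b \<in> univ B" "piso A B (insert (a, b) p)"
proof -
  note cB = rich_ceq[OF B]
  have pU: "x \<in> univ A \<and> y \<in> univ B" if "(x, y) \<in> p" for x y using pisoD p that by metis
  consider (same) y where "(a, y) \<in> p"
    | (cls) x y where "(x, y) \<in> p" "eqv A a x" "a \<notin> Domain p"
    | (new) "\<And>x y. (x, y) \<in> p \<Longrightarrow> \<not> eqv A a x"
    by blast
  then show ?thesis
  proof cases
    case same
    then show ?thesis using that[of y] pU p by (simp add: insert_absorb)
  next
    case cls
    note xy = pU[OF cls(1)]
    let ?P = "{v. \<exists>u. (u, v) \<in> p \<and> eqv A a u \<and> lss A u a}"
    let ?Q = "{v. \<exists>u. (u, v) \<in> p \<and> eqv A a u \<and> lss A a u}"
    have "?P \<subseteq> snd ` p" "?Q \<subseteq> snd ` p" by force+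
    then have fin: "finite ?P" "finite ?Q" using p(2) by (meson finite_imageI finite_subset)+
    have sub: "?P \<subseteq> univ B" "?Q \<subseteq> univ B" using pU by auto
    have ex: "eqv A a u \<longleftrightarrow> eqv A x u" if "u \<in> univ A" for u
      using cls(2) ceq_eqv_trans[OF A, of a x u] ceq_eqv_trans[OF A, of x a u] ceq_sym[OF A, of a x] a xy that
      by blast
    have e: "eqv B y v" if "(u, v) \<in> p" "eqv A a u" for u v
      using pisoD(3)[OF p(1) cls(1) that(1)] ex that pU[OF that(1)] by blast
    have l: "lss B v v'" if v: "v \<in> ?P" "v' \<in> ?Q" for v v'
    proof -
      obtain u u' where u: "(u, v) \<in> p" "(u', v') \<in> p" "lss A u a" "lss A a u'" using v by blast
      then have "lss A u u'" using ceq_lss_trans[OF A _ a] pU[OF u(1)] pU[OF u(2)] by blast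
      then show ?thesis using pisoD(4)[OF p(1) u(1,2)] by blast
    qed
    obtain b where b: "b \<in> univ B" "eqv B y b" "\<And>v. v \<in> ?P \<Longrightarrow> lss B v b" "\<And>v. v \<in> ?Q \<Longrightarrow> lss B b v"
      using rich_between[OF B conjunct2[OF xy] fin(1) sub(1) fin(2) sub(2) _ _ l] e by blast
    show ?thesis
    proof (rule that[OF b(1)], rule piso_insert[OF A cB p(1) a b(1)])
      fix u v assume uv: "(u, v) \<in> p"
      note uvU = pU[OF uv]
      have e2: "eqv B b v \<longleftrightarrow> eqv B y v"
        using b(1,2) ceq_eqv_trans[OF cB, of b y v] ceq_eqv_trans[OF cB, of y b v] ceq_sym[OF cB, of y b] xy uvU
        by blast
      have ee: "eqv A a u \<longleftrightarrow> eqv B b v" using ex uvU e2 pisoD(3)[OF p(1) cls(1) uv] by simp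
      have au: "a \<noteq> u" using cls uv by blast
      have "(lss A a u \<longleftrightarrow> lss B b v) \<and> (lss A u a \<longleftrightarrow> lss B v b)"
      proof (cases "eqv A a u")
        case True
        then have "lss A a u \<Longrightarrow> lss B b v" "lss A u a \<Longrightarrow> lss B v b" using uv b(3,4) by blast+
        then show ?thesis
          using ceq_trichotomy[OF A a, of u] au uvU ceq_asym[OF A a, of u] ceq_asym[OF cB b(1), of v]
            ceq_asym[OF A, of u a] a
          by blast
      next
        case False
        have "lss A a u \<longleftrightarrow> lss A x u" "lss A u a \<longleftrightarrow> lss A u x"
          using ceq_lss_class[OF A a _ _ cls(2) False] xy uvU by blast+
        moreover have "lss B b v \<longleftrightarrow> lss B y v" "lss B v b \<longleftrightarrow> lss B v y"
          using ceq_lss_class[OF cB b(1), of y v] ceq_sym[OF cB, of y b] False ee xy uvU b(1,2) by blast+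
        ultimately show ?thesis using pisoD(4)[OF p(1) cls(1) uv] pisoD(4)[OF p(1) uv cls(1)] by blast
      qed
      then show "(eqv A a u \<longleftrightarrow> eqv B b v) \<and> (lss A a u \<longleftrightarrow> lss B b v) \<and> (lss A u a \<longleftrightarrow> lss B v b)"
        using ee by blast
    qed
  next
    case new
    let ?P = "{v. \<exists>u. (u, v) \<in> p \<and> lss A u a}"
    let ?Q = "{v. \<exists>u. (u, v) \<in> p \<and> lss A a u}"
    have "?P \<subseteq> snd ` p" "?Q \<subseteq> snd ` p" by force+
    then have fin: "finite ?P" "finite ?Q" using p(2) by (meson finite_imageI finite_subset)+
    have sub: "?P \<subseteq> univ B" "?Q \<subseteq> univ B" using pU by auto
    have l: "lss B v v' \<and> \<not> eqv B v v'" if v: "v \<in> ?P" "v' \<in> ?Q" for v v'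
    proof -
      obtain u u' where u: "(u, v) \<in> p" "(u', v') \<in> p" "lss A u a" "lss A a u'" using v by blast
      then have "lss A u u' \<and> \<not> eqv A u u'"
        using ceq_lss_trans[OF A _ a, of u u'] ceq_convex2[OF A, of u a u'] new[OF u(2)] a
          pU[OF u(1)] pU[OF u(2)] by blast
      then show ?thesis using pisoD(3,4)[OF p(1) u(1,2)] by blast
    qed
    obtain b where b: "b \<in> univ B" "\<And>v. v \<in> ?P \<Longrightarrow> lss B v b \<and> \<not> eqv B b v"
      "\<And>v. v \<in> ?Q \<Longrightarrow> lss B b v \<and> \<not> eqv B b v"
      using rich_between_classes[OF B fin(1) sub(1) fin(2) sub(2) l] by blast
    show ?thesis
    proof (rule that[OF b(1)], rule piso_insert[OF A cB p(1) a b(1)])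
      fix u v assume uv: "(u, v) \<in> p"
      note uvU = pU[OF uv]
      have "a \<noteq> u" using new uv ceq_refl[OF A a] by blast
      then consider "lss A a u" | "lss A u a" using ceq_trichotomy[OF A a] uvU by blast
      then show "(eqv A a u \<longleftrightarrow> eqv B b v) \<and> (lss A a u \<longleftrightarrow> lss B b v) \<and> (lss A u a \<longleftrightarrow> lss B v b)"
        using b(1) b(2)[of v] b(3)[of v] uv uvU new[OF uv] ceq_asym[OF A a, of u] ceq_asym[OF A, of u a]
          ceq_asym[OF cB, of b v] ceq_asym[OF cB, of v b] a
        by cases blast+
    qed
  qed
qed

section \<open>Elimination of quantifiers for rich structures\<close>

lemma wf_tm_ceq: "wf_tm L_ceq n t \<longleftrightarrow> (\<exists>i<n. t = Var i)"
  by (cases t) (auto simp: L_ceq_def)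

lemma length_2_conv: "length xs = 2 \<longleftrightarrow> (\<exists>x y. xs = [x, y])"
  by (auto simp: numeral_2_eq_2 length_Suc_conv)

text \<open>Finite partial isomorphisms between rich structures form a back-and-forth system, so the
  existential case extends the matching by one pair, from either side. For empty tuples it says that
  all rich structures are elementarily equivalent.\<close>

lemma rich_sat_iff:
  assumes "rich A" "rich B"
  shows "length xs = length ys \<Longrightarrow> piso A B (set (zip xs ys)) \<Longrightarrow> wf_fm L_ceq (length xs) \<phi> \<Longrightarrow>
    sat A xs \<phi> \<longleftrightarrow> sat B ys \<phi>"
proof (induction \<phi> arbitrary: xs ys)
  case (FEq s t)
  then obtain i j where ij: "s = Var i" "t = Var j" "i < length xs" "j < length xs"
    by (auto simp: wf_tm_ceq)
  then have "(xs ! i, ys ! i) \<in> set (zip xs ys)" "(xs ! j, ys ! j) \<in> set (zip xs ys)"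
    using FEq by (metis in_set_zip fst_conv snd_conv)+
  then show ?case
    using piso_eq_iff[OF rich_ceq[OF assms(1)] rich_ceq[OF assms(2)] FEq(2)] ij by simp
next
  case (FRel R ts)
  then obtain s t where "ts = [s, t]" by (auto simp: L_ceq_def length_2_conv)
  with FRel obtain i j where ij: "ts = [Var i, Var j]" "i < length xs" "j < length xs"
    by (auto simp: wf_tm_ceq)
  then have "(xs ! i, ys ! i) \<in> set (zip xs ys)" "(xs ! j, ys ! j) \<in> set (zip xs ys)"
    using FRel by (metis in_set_zip fst_conv snd_conv)+
  then show ?case
    using pisoD(3,4)[OF FRel(2)] ij by (cases R) simp_all
next
  case (FEx \<phi>)
  have fin: "finite (set (zip xs ys))" by simp
  have z: "(set (zip xs ys))\<inverse> = set (zip ys xs)"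
    by (auto simp: set_zip FEx(2))
  show ?case
  proof
    assume "sat A xs (FEx \<phi>)"
    then obtain a where a: "a \<in> univ A" "sat A (a # xs) \<phi>" by auto
    obtain b where b: "b \<in> univ B" "piso A B (insert (a, b) (set (zip xs ys)))"
      using piso_extend[OF rich_ceq[OF assms(1)] assms(2) FEx(3) fin a(1)] .
    then have "sat B (b # ys) \<phi>" using FEx(1)[of "a # xs" "b # ys"] FEx(2,4) a b by simp
    then show "sat B ys (FEx \<phi>)" using b by auto
  next
    assume "sat B ys (FEx \<phi>)"
    then obtain b where b: "b \<in> univ B" "sat B (b # ys) \<phi>" by auto
    have "piso B A (set (zip ys xs))" using piso_converse[OF FEx(3)] z by simp
    then obtain a where a: "a \<in> univ A" "piso B A (insert (b, a) (set (zip ys xs)))"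
      using piso_extend[OF rich_ceq[OF assms(2)] assms(1) _ _ b(1)] by (metis List.finite_set)
    have "(insert (b, a) (set (zip ys xs)))\<inverse> = insert (a, b) (set (zip xs ys))"
      using z by auto
    then have "piso A B (insert (a, b) (set (zip xs ys)))" using piso_converse[OF a(2)] by simp
    then have "sat A (a # xs) \<phi>" using FEx(1)[of "a # xs" "b # ys"] FEx(2,4) b by simp
    then show "sat A xs (FEx \<phi>)" using a by auto
  qed
qed simp_all

section \<open>The Fraisse limit and its theory\<close>

text \<open>\<open>e\<close> gives each point its coordinates (class, position in the class).
  Pulling the lexicographic order back along \<open>e\<close> puts such a structure on any carrier:
  rational coordinates give a countable rich structure, natural ones give small patterns to be
  realized in a Fraisse limit.\<close>

definition lex_struct ::
  "('i \<Rightarrow> 'p::linorder \<times> 'q::linorder) \<Rightarrow> 'i set \<Rightarrow> (unit, ceq_rel, 'i) struct" where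
  "lex_struct e S = \<lparr>univ = S, fun_interp = undefined,
     rel_interp = (\<lambda>R xs. let (p, q) = e (xs ! 0); (p', q') = e (xs ! 1) in
       case R of CE \<Rightarrow> p = p' | CLess \<Rightarrow> p < p' \<or> p = p' \<and> q < q')\<rparr>"

lemma lex_struct_simps [simp]:
  "univ (lex_struct e S) = S"
  "eqv (lex_struct e S) x y \<longleftrightarrow> fst (e x) = fst (e y)"
  "lss (lex_struct e S) x y \<longleftrightarrow>
     fst (e x) < fst (e y) \<or> fst (e x) = fst (e y) \<and> snd (e x) < snd (e y)"
  by (simp_all add: lex_struct_def split: prod.split)

lemma ceq_lex_struct:
  assumes "inj_on e S" "S \<noteq> {}"
  shows "ceq (lex_struct e S)"
proof -
  have "x = y" if "x \<in> S" "y \<in> S" "fst (e x) = fst (e y)" "snd (e x) = snd (e y)" for x y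
    using assms(1) that by (meson inj_onD prod.expand)
  then have "(fst (e x) < fst (e y) \<or> fst (e x) = fst (e y) \<and> snd (e x) < snd (e y)) \<or> x = y \<or>
      (fst (e y) < fst (e x) \<or> fst (e y) = fst (e x) \<and> snd (e y) < snd (e x))"
    if "x \<in> S" "y \<in> S" for x y
    using that by (meson less_linear)
  then show ?thesis using assms(2) unfolding ceq_def lex_struct_simps by auto
qed

lemma rich_lex_struct:
  fixes e :: "'i \<Rightarrow> rat \<times> rat"
  assumes "bij_betw e S UNIV"
  shows "rich (lex_struct e S)"
proof -
  have "S \<noteq> {}" using assms by (auto simp: bij_betw_def)
  have surj: "\<exists>x\<in>S. fst (e x) = p \<and> snd (e x) = q" for p q
    using assms by (metis bij_betw_imp_surj_on UNIV_I fst_conv imageE snd_conv)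
  show ?thesis
    unfolding rich_def lex_struct_simps
  proof (intro conjI ballI impI)
    show "ceq (lex_struct e S)"
      using ceq_lex_struct assms \<open>S \<noteq> {}\<close> unfolding bij_betw_def by blast
  next
    fix x show "\<exists>y\<in>S. (fst (e x) < fst (e y) \<or> fst (e x) = fst (e y) \<and> snd (e x) < snd (e y)) \<and>
        fst (e x) = fst (e y)"
      using surj[of "fst (e x)" "snd (e x) + 1"] by (metis less_add_one)
  next
    fix x show "\<exists>y\<in>S. (fst (e y) < fst (e x) \<or> fst (e y) = fst (e x) \<and> snd (e y) < snd (e x)) \<and>
        fst (e y) = fst (e x)"
      using surj[of "fst (e x)" "snd (e x) - 1"] by (metis less_add_one diff_less_eq)
  next
    fix x show "\<exists>y\<in>S. (fst (e x) < fst (e y) \<or> fst (e x) = fst (e y) \<and> snd (e x) < snd (e y)) \<and>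
        fst (e x) \<noteq> fst (e y)"
      using surj[of "fst (e x) + 1" 0] by (metis less_add_one less_irrefl)
  next
    fix x show "\<exists>y\<in>S. (fst (e y) < fst (e x) \<or> fst (e y) = fst (e x) \<and> snd (e y) < snd (e x)) \<and>
        fst (e y) \<noteq> fst (e x)"
      using surj[of "fst (e x) - 1" 0] by (metis less_add_one diff_less_eq less_irrefl)
  next
    fix x z
    assume "(fst (e x) < fst (e z) \<or> fst (e x) = fst (e z) \<and> snd (e x) < snd (e z)) \<and> fst (e x) = fst (e z)"
    then obtain q where "fst (e x) = fst (e z)" "snd (e x) < q" "q < snd (e z)"
      using dense by auto
    then show "\<exists>y\<in>S. (fst (e x) < fst (e y) \<or> fst (e x) = fst (e y) \<and> snd (e x) < snd (e y)) \<and>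
        (fst (e y) < fst (e z) \<or> fst (e y) = fst (e z) \<and> snd (e y) < snd (e z))"
      using surj[of "fst (e x)" q] by metis
  next
    fix x z
    assume "(fst (e x) < fst (e z) \<or> fst (e x) = fst (e z) \<and> snd (e x) < snd (e z)) \<and> fst (e x) \<noteq> fst (e z)"
    then obtain p where "fst (e x) < p" "p < fst (e z)"
      using dense by auto
    then show "\<exists>y\<in>S. (fst (e x) < fst (e y) \<or> fst (e x) = fst (e y) \<and> snd (e x) < snd (e y)) \<and>
        (fst (e y) < fst (e z) \<or> fst (e y) = fst (e z) \<and> snd (e y) < snd (e z)) \<and>
        fst (e x) \<noteq> fst (e y) \<and> fst (e y) \<noteq> fst (e z)"
      using surj[of p 0] by (metis less_irrefl)
  qed
qed

text \<open>The rational plane, ordered lexicographically with the vertical lines as classes, is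
  transported along an injection into the given type.\<close>

lemma ex_rich_countable:
  assumes "infinite (UNIV :: 'a set)"
  shows "\<exists>A :: (unit, ceq_rel, 'a) struct. rich A \<and> countable (univ A)"
proof -
  obtain g :: "nat \<Rightarrow> 'a" where g: "inj g" using assms infinite_countable_subset by blast
  define e where "e = g \<circ> (to_nat :: rat \<times> rat \<Rightarrow> nat)"
  have "inj e" using g by (simp add: e_def inj_compose)
  then have "bij_betw (inv e) (range e) UNIV" by (simp add: inj_imp_bij_betw_inv)
  then have "rich (lex_struct (inv e) (range e))" by (rule rich_lex_struct)
  moreover have "countable (univ (lex_struct (inv e) (range e)))" by simp
  ultimately show ?thesis by blast
qed

section \<open>Embeddings and the back-and-forth argument\<close>

lemma is_structure_ceq: "is_structure L_ceq M \<longleftrightarrow> univ M \<noteq> {}"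
  by (simp add: is_structure_def L_ceq_def)

lemma embedding_ceq:
  "embedding L_ceq M N h \<longleftrightarrow> inj_on h (univ M) \<and> h ` univ M \<subseteq> univ N \<and>
     (\<forall>x\<in>univ M. \<forall>y\<in>univ M. (eqv M x y \<longleftrightarrow> eqv N (h x) (h y)) \<and> (lss M x y \<longleftrightarrow> lss N (h x) (h y)))"
proof -
  have "(\<forall>as\<in>tuples M 2. rel_interp M R as \<longleftrightarrow> rel_interp N R (map h as)) \<longleftrightarrow>
      (\<forall>x\<in>univ M. \<forall>y\<in>univ M. rel_interp M R [x, y] \<longleftrightarrow> rel_interp N R [h x, h y])" for R
    by (auto simp: tuples_def length_2_conv)
  then show ?thesis unfolding embedding_def by (auto simp: L_ceq_def)
qed

lemma embedding_ceq_iff_piso: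
  assumes "ceq M" "ceq N"
  shows "embedding L_ceq M N h \<longleftrightarrow> piso M N ((\<lambda>x. (x, h x)) ` univ M)"
proof
  assume "embedding L_ceq M N h"
  then show "piso M N ((\<lambda>x. (x, h x)) ` univ M)"
    unfolding embedding_ceq by (intro pisoI) auto
next
  assume p: "piso M N ((\<lambda>x. (x, h x)) ` univ M)"
  have g: "(x, h x) \<in> (\<lambda>x. (x, h x)) ` univ M" if "x \<in> univ M" for x using that by blast
  show "embedding L_ceq M N h"
    unfolding embedding_ceq
  proof (intro conjI ballI subsetI inj_onI)
    fix x y assume "x \<in> univ M" "y \<in> univ M"
    note xy = g[OF this(1)] g[OF this(2)]
    show "eqv M x y \<longleftrightarrow> eqv N (h x) (h y)" "lss M x y \<longleftrightarrow> lss N (h x) (h y)"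
      using pisoD(3,4)[OF p xy] by blast+
    show "x = y" if "h x = h y" using piso_eq_iff[OF assms p xy] that by blast
  next
    fix y assume "y \<in> h ` univ M" then show "y \<in> univ N" using pisoD(2)[OF p g] by blast
  qed
qed

lemma ceq_of_embedding:
  assumes "embedding L_ceq B A h" "ceq A" "univ B \<noteq> {}"
  shows "ceq B"
proof -
  note e = assms(1)[unfolded embedding_ceq]
  have m: "h x \<in> univ A" if "x \<in> univ B" for x using e that by blast
  have eq: "h x = h y \<longleftrightarrow> x = y" if "x \<in> univ B" "y \<in> univ B" for x y
    using e that by (meson inj_on_eq_iff)
  have r: "eqv B x y \<longleftrightarrow> eqv A (h x) (h y)" "lss B x y \<longleftrightarrow> lss A (h x) (h y)"
    if "x \<in> univ B" "y \<in> univ B" for x y using e that by blast+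
  show ?thesis
    unfolding ceq_def
  proof (intro conjI ballI)
    show "univ B \<noteq> {}" by (fact assms)
  next
    fix x y assume "x \<in> univ B" "y \<in> univ B"
    then show "lss B x y \<or> x = y \<or> lss B y x"
      using ceq_trichotomy[OF assms(2) m m] r eq by metis
  qed (use assms(2) m r in \<open>auto simp: ceq_refl ceq_irrefl intro: ceq_sym ceq_eqv_trans ceq_lss_trans ceq_convex1 ceq_convex2\<close>)
qed

lemma piso_extend_finite:
  assumes "ceq A" "rich B" "finite S" "S \<subseteq> univ A"
  shows "\<exists>p. finite p \<and> piso A B p \<and> S \<subseteq> Domain p"
  using assms(3,4)
proof (induction S)
  case empty
  show ?case using piso_empty by (metis empty_subsetI finite.emptyI)
next
  case (insert x S)
  then obtain p where p: "finite p" "piso A B p" "S \<subseteq> Domain p" by auto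
  obtain y where "piso A B (insert (x, y) p)"
    using piso_extend[OF assms(1,2) p(2,1), of x] insert.prems by blast
  then show ?case using p by (intro exI[of _ "insert (x, y) p"]) auto
qed

lemma back_and_forth:
  fixes A :: "('f, ceq_rel, 'a) struct" and B :: "('f, ceq_rel, 'b) struct"
  assumes A: "rich A" "countable (univ A)" and B: "rich B" "countable (univ B)"
    and p: "finite p" "piso A B p"
  shows "\<exists>q. p \<subseteq> q \<and> piso A B q \<and> Domain q = univ A \<and> Range q = univ B"
proof -
  note cA = rich_ceq[OF A(1)] and cB = rich_ceq[OF B(1)]
  note neA = ceq_nonempty[OF cA] and neB = ceq_nonempty[OF cB]
  define P where "P q \<longleftrightarrow> p \<subseteq> q \<and> finite q \<and> piso A B q" for q
  \<comment> \<open>Stage \<open>n\<close> puts the \<open>n\<close>-th points of the two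
    enumerations into the domain and the range, so the union of all stages is total and
    onto.\<close>
  define Q where "Q n q q' \<longleftrightarrow> q \<subseteq> q' \<and> from_nat_into (univ A) n \<in> Domain q' \<and>
      from_nat_into (univ B) n \<in> Range q'" for n and q q' :: "('a \<times> 'b) set"
  have step: "\<exists>q'. P q' \<and> Q n q q'" if "P q" for n q
  proof -
    have q: "p \<subseteq> q" "finite q" "piso A B q" using that by (auto simp: P_def)
    obtain b where b: "piso A B (insert (from_nat_into (univ A) n, b) q)"
      using piso_extend[OF cA B(1) q(3,2) from_nat_into[OF neA]] by blast
    let ?q = "insert (from_nat_into (univ A) n, b) q"
    have "finite (?q\<inverse>)" using q(2) by simp
    then obtain a where "piso B A (insert (from_nat_into (univ B) n, a) (?q\<inverse>))"
      using piso_extend[OF cB A(1) piso_converse[OF b] _ from_nat_into[OF neB]] by blast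
    from piso_converse[OF this] have "piso A B (insert (a, from_nat_into (univ B) n) ?q)"
      by (rule piso_subset) auto
    then show ?thesis
      using q by (intro exI[of _ "insert (a, from_nat_into (univ B) n) ?q"]) (auto simp: P_def Q_def)
  qed
  have "P p" using p by (simp add: P_def)
  have "\<exists>f. \<forall>n. P (f n) \<and> Q n (f n) (f (Suc n))"
  proof (rule dependent_nat_choice)
    show "\<exists>q. P q" using \<open>P p\<close> by blast
    show "\<exists>q'. P q' \<and> Q n q q'" if "P q" for q n by (rule step[OF that])
  qed
  then obtain f where f: "P (f n)" "Q n (f n) (f (Suc n))" for n by blast
  have "f n \<subseteq> f (Suc n)" for n using f(2) by (simp add: Q_def)
  then have "mono f" by (simp add: mono_iff_le_Suc)
  let ?q = "\<Union>n. f n"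
  have "piso A B ?q"
  proof (rule pisoI)
    fix x y assume "(x, y) \<in> ?q"
    then obtain n where n: "(x, y) \<in> f n" by blast
    then show "x \<in> univ A \<and> y \<in> univ B" using f(1)[of n] pisoD(1,2)[of A B "f n" x y] unfolding P_def by blast
    fix x' y' assume "(x', y') \<in> ?q"
    then obtain n' where "(x', y') \<in> f n'" by blast
    then have "(x, y) \<in> f (max n n')" "(x', y') \<in> f (max n n')"
      using n monoD[OF \<open>mono f\<close>] by (meson max.cobounded1 max.cobounded2 subsetD)+
    then show "(eqv A x x' \<longleftrightarrow> eqv B y y') \<and> (lss A x x' \<longleftrightarrow> lss B y y')"
      using f(1)[of "max n n'"] pisoD(3,4)[of A B "f (max n n')" x y x' y'] unfolding P_def by blast
  qed
  moreover have "p \<subseteq> ?q" using f(1) unfolding P_def by blast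
  moreover have "univ A \<subseteq> Domain ?q"
  proof
    fix x assume "x \<in> univ A"
    then obtain n where "x = from_nat_into (univ A) n" using A(2) by (metis from_nat_into_surj)
    then show "x \<in> Domain ?q" using f(2)[of n] unfolding Q_def by blast
  qed
  moreover have "univ B \<subseteq> Range ?q"
  proof
    fix x assume "x \<in> univ B"
    then obtain n where "x = from_nat_into (univ B) n" using B(2) by (metis from_nat_into_surj)
    then show "x \<in> Range ?q" using f(2)[of n] unfolding Q_def by blast
  qed
  moreover have "Domain ?q \<subseteq> univ A" "Range ?q \<subseteq> univ B"
    using pisoD(1,2)[OF \<open>piso A B ?q\<close>] by blast+
  ultimately show ?thesis by blast
qed

abbreviation finite_ceq_structs :: "(unit, ceq_rel, 'a) struct set" where
  "finite_ceq_structs \<equiv> {B. finite (univ B) \<and> models L_ceq B T_ceq}"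

lemma piso_functional:
  assumes "ceq A" "ceq B" "piso A B p"
  shows "\<exists>h. \<forall>x y. (x, y) \<in> p \<longrightarrow> h x = y"
proof (intro exI allI impI)
  fix x y assume "(x, y) \<in> p"
  then show "(SOME y. (x, y) \<in> p) = y" using piso_eq_iff[OF assms] by (metis someI)
qed

text \<open>Finite models embed by extending the empty matching point by point; homogeneity is
  back-and-forth starting from the given finite map. On the natural numbers this supplies a Fraisse
  limit among the structures over which \<open>T_ceq_star\<close> quantifies.\<close>

lemma fraisse_limit_rich:
  assumes F: "rich F" "countable (univ F)"
  shows "fraisse_limit L_ceq finite_ceq_structs F"
proof -
  note cF = rich_ceq[OF F(1)]
  have age: "B \<in> finite_ceq_structs \<longleftrightarrow> (\<exists>h. embedding L_ceq B F h)"
    if B: "univ B \<noteq> {}" "finite (univ B)" for B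
  proof
    assume "B \<in> finite_ceq_structs"
    then have cB: "ceq B" by (simp add: models_T_ceq)
    obtain p where p: "piso B F p" "univ B \<subseteq> Domain p"
      using piso_extend_finite[OF cB F(1) B(2)] by blast
    obtain h where h: "\<And>x y. (x, y) \<in> p \<Longrightarrow> h x = y" using piso_functional[OF cB cF p(1)] by blast
    have "(x, h x) \<in> p" if x: "x \<in> univ B" for x
    proof -
      obtain y where y: "(x, y) \<in> p" using x p(2) by blast
      show ?thesis using y h[OF y] by simp
    qed
    then have "(\<lambda>x. (x, h x)) ` univ B \<subseteq> p" by blast
    then show "\<exists>h. embedding L_ceq B F h"
      using embedding_ceq_iff_piso[OF cB cF] piso_subset[OF p(1)] by blast
  next
    assume "\<exists>h. embedding L_ceq B F h"
    then show "B \<in> finite_ceq_structs"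
      using ceq_of_embedding[OF _ cF B(1)] B(2) by (auto simp: models_T_ceq)
  qed
  have hom: "\<exists>g. automorphism L_ceq F g \<and> (\<forall>x\<in>X. g x = h x)"
    if X: "finite X" "X \<subseteq> univ F" and h: "embedding L_ceq (F\<lparr>univ := X\<rparr>) F h" for X h
  proof -
    have pi: "piso F F ((\<lambda>x. (x, h x)) ` X)"
    proof (rule pisoI)
      fix x y x' y'
      assume "(x, y) \<in> (\<lambda>x. (x, h x)) ` X"
      then have x: "x \<in> X" "y = h x" by auto
      then show "x \<in> univ F \<and> y \<in> univ F" using h X(2) unfolding embedding_ceq by auto
      assume "(x', y') \<in> (\<lambda>x. (x, h x)) ` X"
      then have "x' \<in> X" "y' = h x'" by auto
      with x show "(eqv F x x' \<longleftrightarrow> eqv F y y') \<and> (lss F x x' \<longleftrightarrow> lss F y y')"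
        using h unfolding embedding_ceq by simp
    qed
    obtain q where q: "(\<lambda>x. (x, h x)) ` X \<subseteq> q" "piso F F q" "Domain q = univ F" "Range q = univ F"
      using back_and_forth[OF F F finite_imageI[OF X(1)] pi] by blast
    obtain g where g: "\<And>x y. (x, y) \<in> q \<Longrightarrow> g x = y" using piso_functional[OF cF cF q(2)] by blast
    have gq: "(x, g x) \<in> q" if x: "x \<in> univ F" for x
    proof -
      obtain y where y: "(x, y) \<in> q" using x q(3) by blast
      show ?thesis using y g[OF y] by simp
    qed
    then have "(\<lambda>x. (x, g x)) ` univ F \<subseteq> q" by blast
    then have "embedding L_ceq F F g"
      using embedding_ceq_iff_piso[OF cF cF] piso_subset[OF q(2)] by blast
    moreover have "g ` univ F = univ F"
    proof
      show "univ F \<subseteq> g ` univ F" 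
      proof
        fix y assume "y \<in> univ F"
        then obtain x where x: "(x, y) \<in> q" using q(4) by blast
        then have "x \<in> univ F" using q(3) by blast
        then show "y \<in> g ` univ F" using g[OF x] by blast
      qed
      show "g ` univ F \<subseteq> univ F" using gq q(4) by blast
    qed
    moreover have "g x = h x" if "x \<in> X" for x
    proof (rule g)
      show "(x, h x) \<in> q" using that q(1) by blast
    qed
    ultimately show ?thesis unfolding automorphism_def by blast
  qed
  show ?thesis
    unfolding fraisse_limit_def is_structure_ceq
  proof (intro conjI allI impI; (elim conjE)?)
    show "univ F \<noteq> {}" by (rule ceq_nonempty[OF cF])
    show "countable (univ F)" by (rule F(2))
  qed (rule age hom; assumption)+
qed

section \<open>Fraisse limits are rich\<close>

lemma fraisse_limit_age:
  assumes "fraisse_limit L K F" "is_structure L B" "finite (univ B)"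
  shows "B \<in> K \<longleftrightarrow> (\<exists>h. embedding L B F h)"
  using assms by (simp add: fraisse_limit_def)

lemma fraisse_limit_homogeneous:
  assumes "fraisse_limit L K F" "finite X" "X \<subseteq> univ F" "embedding L (F\<lparr>univ := X\<rparr>) F h"
  shows "\<exists>g. automorphism L F g \<and> (\<forall>x\<in>X. g x = h x)"
  using assms by (simp add: fraisse_limit_def)

lemma embedding_ceqD:
  assumes "embedding L_ceq M N h"
  shows "inj_on h (univ M)" "x \<in> univ M \<Longrightarrow> h x \<in> univ N"
    "x \<in> univ M \<Longrightarrow> y \<in> univ M \<Longrightarrow> eqv N (h x) (h y) \<longleftrightarrow> eqv M x y"
    "x \<in> univ M \<Longrightarrow> y \<in> univ M \<Longrightarrow> lss N (h x) (h y) \<longleftrightarrow> lss M x y"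
  using assms by (auto simp: embedding_ceq)

lemma embedding_ceqI:
  assumes "inj_on h (univ M)" "\<And>x. x \<in> univ M \<Longrightarrow> h x \<in> univ N"
    "\<And>x y. x \<in> univ M \<Longrightarrow> y \<in> univ M \<Longrightarrow> eqv N (h x) (h y) \<longleftrightarrow> eqv M x y"
    "\<And>x y. x \<in> univ M \<Longrightarrow> y \<in> univ M \<Longrightarrow> lss N (h x) (h y) \<longleftrightarrow> lss M x y"
  shows "embedding L_ceq M N h"
  using assms by (auto simp: embedding_ceq)

text \<open>The axioms concern at most three points at a time. A substructure with at most three
  points embeds into \<open>F\<close>, hence belongs to the age, hence is a model of
  \<open>T_ceq\<close>.\<close>

lemma fraisse_limit_ceq:
  assumes F: "fraisse_limit L_ceq finite_ceq_structs F"
  shows "ceq F"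
proof -
  have sub: "ceq (F\<lparr>univ := S\<rparr>)" if "finite S" "S \<noteq> {}" "S \<subseteq> univ F" for S
  proof -
    have "embedding L_ceq (F\<lparr>univ := S\<rparr>) F id" using that unfolding embedding_ceq by simp
    then have "F\<lparr>univ := S\<rparr> \<in> finite_ceq_structs"
      using fraisse_limit_age[OF F, of "F\<lparr>univ := S\<rparr>"] that by (auto simp: is_structure_ceq)
    then show ?thesis by (simp add: models_T_ceq)
  qed
  have tri: "ceq (F\<lparr>univ := {x, y, z}\<rparr>)" if "x \<in> univ F" "y \<in> univ F" "z \<in> univ F" for x y z
    using sub[of "{x, y, z}"] that by simp
  show ?thesis
    unfolding ceq_def
  proof (intro conjI ballI)
    show "univ F \<noteq> {}" using F by (simp add: fraisse_limit_def is_structure_ceq)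
  next
    fix x assume x: "x \<in> univ F"
    show "eqv F x x" "\<not> lss F x x"
      using ceq_refl[OF tri[OF x x x], of x] ceq_irrefl[OF tri[OF x x x], of x] by simp_all
    fix y assume y: "y \<in> univ F"
    show "eqv F x y \<longrightarrow> eqv F y x" "lss F x y \<or> x = y \<or> lss F y x"
      using ceq_sym[OF tri[OF x x y], of x y] ceq_trichotomy[OF tri[OF x x y], of x y] by auto
    fix z assume z: "z \<in> univ F"
    show "eqv F x y \<and> eqv F y z \<longrightarrow> eqv F x z"
      using ceq_eqv_trans[OF tri[OF x y z], of x y z] by simp
    show "lss F x y \<and> lss F y z \<longrightarrow> lss F x z"
      using ceq_lss_trans[OF tri[OF x y z], of x y z] by simp
    show "lss F x y \<and> lss F y z \<and> eqv F x z \<longrightarrow> eqv F x y \<and> eqv F y z"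
      using ceq_convex1[OF tri[OF x y z], of x y z] ceq_convex2[OF tri[OF x y z], of x y z] by simp
  qed
qed

text \<open>Extension property from homogeneity: embed \<open>B\<close> anywhere by
  \<open>h\<close>, then correct the position of \<open>X\<close> by an automorphism extending the
  finite map that sends \<open>h x\<close> to \<open>k x\<close>.\<close>

lemma fraisse_limit_extend:
  fixes F B :: "(unit, ceq_rel, 'a) struct"
  assumes F: "fraisse_limit L_ceq finite_ceq_structs F"
    and B: "ceq B" "finite (univ B)" and X: "X \<subseteq> univ B"
    and k: "embedding L_ceq (B\<lparr>univ := X\<rparr>) F k"
  obtains k' where "embedding L_ceq B F k'" "\<And>x. x \<in> X \<Longrightarrow> k' x = k x"
proof -
  have "B \<in> finite_ceq_structs" using B by (simp add: models_T_ceq)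
  moreover have "is_structure L_ceq B" using ceq_nonempty[OF B(1)] by (simp add: is_structure_ceq)
  ultimately obtain h where h: "embedding L_ceq B F h"
    using fraisse_limit_age[OF F _ B(2)] by auto
  let ?j = "k \<circ> inv_into (univ B) h"
  note hD = embedding_ceqD[OF h] and kD = embedding_ceqD[OF k, simplified]
  have XB: "x \<in> univ B" if "x \<in> X" for x using X that by blast
  have j: "?j (h x) = k x" if "x \<in> X" for x using XB[OF that] hD(1) by simp
  have "embedding L_ceq (F\<lparr>univ := h ` X\<rparr>) F ?j"
  proof (rule embedding_ceqI; simp del: o_apply)
    show "inj_on ?j (h ` X)"
      using kD(1) j by (auto simp add: inj_on_def simp del: o_apply)
    show "?j x \<in> univ F" if "x \<in> h ` X" for x
      using that j kD(2) by (auto simp del: o_apply)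
    show "eqv F (?j x) (?j y) \<longleftrightarrow> eqv F x y" if "x \<in> h ` X" "y \<in> h ` X" for x y
      using that j kD(3) hD(3) XB by (auto simp del: o_apply)
    show "lss F (?j x) (?j y) \<longleftrightarrow> lss F x y" if "x \<in> h ` X" "y \<in> h ` X" for x y
      using that j kD(4) hD(4) XB by (auto simp del: o_apply)
  qed
  moreover have "finite (h ` X)" using X B(2) by (meson finite_imageI finite_subset)
  moreover have "h ` X \<subseteq> univ F" using hD(2) XB by blast
  ultimately obtain g where g: "automorphism L_ceq F g" "\<forall>x\<in>h ` X. g x = ?j x"
    using fraisse_limit_homogeneous[OF F] by metis
  then have "embedding L_ceq F F g" by (simp add: automorphism_def)
  note gD = embedding_ceqD[OF this]
  have "inj_on g (h ` univ B)" using gD(1) hD(2) by (meson image_subsetI inj_on_subset)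
  then have "embedding L_ceq B F (g \<circ> h)"
    using hD gD comp_inj_on by (intro embedding_ceqI) auto
  moreover have "(g \<circ> h) x = k x" if "x \<in> X" for x using g(2) j[OF that] that by simp
  ultimately show ?thesis using that by blast
qed

lemma fraisse_limit_one_point:
  fixes v :: "nat \<Rightarrow> nat \<times> nat" and F :: "(unit, ceq_rel, nat) struct"
  assumes F: "fraisse_limit L_ceq finite_ceq_structs F"
    and v: "inj_on v {0, 1}" and x: "x \<in> univ F"
  defines "B \<equiv> lex_struct v {0, 1}"
  obtains y where "y \<in> univ F" "eqv F x y \<longleftrightarrow> eqv B 0 1" "eqv F y x \<longleftrightarrow> eqv B 1 0"
    "lss F x y \<longleftrightarrow> lss B 0 1" "lss F y x \<longleftrightarrow> lss B 1 0"
proof -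
  have cB: "ceq B" unfolding B_def using v by (intro ceq_lex_struct) auto
  have uB: "univ B = {0, 1}" by (simp add: B_def)
  have "embedding L_ceq (B\<lparr>univ := {0}\<rparr>) F (\<lambda>_. x)"
    using x ceq_refl[OF cB, of 0] ceq_irrefl[OF cB, of 0] uB
      ceq_refl[OF fraisse_limit_ceq[OF F] x] ceq_irrefl[OF fraisse_limit_ceq[OF F] x]
    by (intro embedding_ceqI) simp_all
  then obtain k where k: "embedding L_ceq B F k" "\<And>i. i \<in> {0} \<Longrightarrow> k i = x"
    by (rule fraisse_limit_extend[OF F cB, rotated 2]) (auto simp: uB)
  note kD = embedding_ceqD[OF k(1), unfolded uB]
  show ?thesis
    using that[of "k 1"] kD(2)[of 1] kD(3,4)[of 0 1] kD(3,4)[of 1 0] k(2)[of 0] by simp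
qed

lemma fraisse_limit_two_points:
  fixes v :: "nat \<Rightarrow> nat \<times> nat" and F :: "(unit, ceq_rel, nat) struct"
  assumes F: "fraisse_limit L_ceq finite_ceq_structs F"
    and v: "inj_on v {0, 1, 2}" and x: "x \<in> univ F" "z \<in> univ F"
  defines "B \<equiv> lex_struct v {0, 1, 2}"
  assumes xz: "lss F x z" "lss B 0 2" "eqv F x z \<longleftrightarrow> eqv B 0 2"
  obtains y where "y \<in> univ F" "eqv F x y \<longleftrightarrow> eqv B 0 1" "eqv F y z \<longleftrightarrow> eqv B 1 2"
    "lss F x y \<longleftrightarrow> lss B 0 1" "lss F y z \<longleftrightarrow> lss B 1 2"
proof -
  note cF = fraisse_limit_ceq[OF F]
  have cB: "ceq B" unfolding B_def using v by (intro ceq_lex_struct) auto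
  have uB: "univ B = {0, 1, 2}" by (simp add: B_def)
  let ?k = "\<lambda>i. if i = 0 then x else z"
  have "x \<noteq> z" "\<not> lss F z x" "\<not> lss B 2 0" "eqv F z x \<longleftrightarrow> eqv B 2 0"
    using xz ceq_irrefl[OF cF] x ceq_asym[OF cF x] ceq_asym[OF cB, of 0 2] uB
      ceq_sym[OF cF] ceq_sym[OF cB] by blast+
  then have "embedding L_ceq (B\<lparr>univ := {0, 2}\<rparr>) F ?k"
    using x ceq_refl[OF cB] ceq_irrefl[OF cB] uB ceq_refl[OF cF] ceq_irrefl[OF cF] xz
    by (intro embedding_ceqI) (auto simp add: inj_on_def)
  then obtain k where k: "embedding L_ceq B F k" "\<And>i. i \<in> {0, 2} \<Longrightarrow> k i = ?k i"
    by (rule fraisse_limit_extend[OF F cB, rotated 2]) (auto simp: uB)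
  note kD = embedding_ceqD[OF k(1), unfolded uB]
  show ?thesis
    using that[of "k 1"] kD(2)[of 1] kD(3,4)[of 0 1] kD(3,4)[of 1 2] k(2)[of 0] k(2)[of 2] by simp
qed

text \<open>Every clause adds one point to one or two given points. The lists hold the coordinates
  (class, position) of the resulting pattern; index 1 is the new point, indices 0 and 2 are the
  given ones.\<close>

lemma rich_fraisse_limit:
  fixes F :: "(unit, ceq_rel, nat) struct"
  assumes F: "fraisse_limit L_ceq finite_ceq_structs F"
  shows "rich F"
  unfolding rich_def
proof (intro conjI ballI impI)
  show "ceq F" by (rule fraisse_limit_ceq[OF F])
next
  fix x assume x: "x \<in> univ F"
  show "\<exists>y\<in>univ F. lss F x y \<and> eqv F x y"
    by (rule fraisse_limit_one_point[OF F _ x, of "(!) [(0, 0), (0, 1)]"]) auto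
  show "\<exists>y\<in>univ F. lss F y x \<and> eqv F y x"
    by (rule fraisse_limit_one_point[OF F _ x, of "(!) [(0, 1), (0, 0)]"]) auto
  show "\<exists>y\<in>univ F. lss F x y \<and> \<not> eqv F x y"
    by (rule fraisse_limit_one_point[OF F _ x, of "(!) [(0, 0), (1, 0)]"]) auto
  show "\<exists>y\<in>univ F. lss F y x \<and> \<not> eqv F y x"
    by (rule fraisse_limit_one_point[OF F _ x, of "(!) [(1, 0), (0, 0)]"]) auto
next
  fix x z assume x: "x \<in> univ F" "z \<in> univ F" and xz: "lss F x z \<and> eqv F x z"
  show "\<exists>y\<in>univ F. lss F x y \<and> lss F y z"
    by (rule fraisse_limit_two_points[OF F _ x, of "(!) [(0, 0), (0, 1), (0, 2)]"]) (use xz in auto)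
next
  fix x z assume x: "x \<in> univ F" "z \<in> univ F" and xz: "lss F x z \<and> \<not> eqv F x z"
  show "\<exists>y\<in>univ F. lss F x y \<and> lss F y z \<and> \<not> eqv F x y \<and> \<not> eqv F y z"
    by (rule fraisse_limit_two_points[OF F _ x, of "(!) [(0, 0), (1, 0), (2, 0)]"]) (use xz in auto)
qed

text \<open>Richness as a set of sentences, so that it passes from the Fraisse limits to all models
  of \<open>T_ceq_star\<close>. The point claimed to exist is always index 0, which shifts the outer
  variables: in the last two sentences x and z are 1 and 0 before the existential quantifier, 2 and
  1 after it.\<close>

definition rich_axioms :: "(unit, ceq_rel) fm set" where
  "rich_axioms = T_ceq \<union>
    {FAll (FEx (FConj (fL 1 0) (fE 1 0))),
     FAll (FEx (FConj (fL 0 1) (fE 0 1))),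
     FAll (FEx (FConj (fL 1 0) (FNeg (fE 1 0)))),
     FAll (FEx (FConj (fL 0 1) (FNeg (fE 0 1)))),
     FAll (FAll (FImp (FConj (fL 1 0) (fE 1 0)) (FEx (FConj (fL 2 0) (fL 0 1))))),
     FAll (FAll (FImp (FConj (fL 1 0) (FNeg (fE 1 0)))
       (FEx (FConj (fL 2 0) (FConj (fL 0 1) (FConj (FNeg (fE 2 0)) (FNeg (fE 0 1))))))))}"

lemma models_rich_axioms: "models L_ceq A rich_axioms \<longleftrightarrow> rich A"
proof -
  have split: "models L_ceq A (T_ceq \<union> S) \<longleftrightarrow> ceq A \<and> (\<forall>\<sigma>\<in>S. sat A [] \<sigma>)" for S
    unfolding models_T_ceq[symmetric] models_def by blast
  show ?thesis
    unfolding rich_axioms_def rich_def split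
    by (rule conj_cong[OF refl], simp, intro conj_cong refl) blast+
qed

lemma sentence_rich_axioms: "\<sigma> \<in> rich_axioms \<Longrightarrow> sentence L_ceq \<sigma>"
  unfolding rich_axioms_def T_ceq_def by (auto simp: L_ceq_def)

text \<open>The richness axioms hold in all Fraisse limits on the natural numbers and so belong to
  \<open>T_ceq_star\<close>. Conversely, elementary equivalence of rich structures transfers each
  sentence of \<open>T_ceq_star\<close> from one such limit, itself rich, to
  \<open>A\<close>.\<close>

lemma models_T_ceq_star: "models L_ceq A T_ceq_star \<longleftrightarrow> rich A"
proof
  assume A: "models L_ceq A T_ceq_star"
  have "rich_axioms \<subseteq> T_ceq_star"
    using sentence_rich_axioms rich_fraisse_limit models_rich_axioms
    unfolding T_ceq_star_def models_def by blast
  then show "rich A" using A models_rich_axioms unfolding models_def by blast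
next
  assume A: "rich A"
  obtain F :: "(unit, ceq_rel, nat) struct" where F: "rich F" "countable (univ F)"
    using ex_rich_countable[OF infinite_UNIV_nat] by blast
  have "sat A [] \<sigma>" if "\<sigma> \<in> T_ceq_star" for \<sigma>
  proof -
    have "sentence L_ceq \<sigma>" "sat F [] \<sigma>"
      using that fraisse_limit_rich[OF F] unfolding T_ceq_star_def by blast+
    then show ?thesis using rich_sat_iff[OF A F(1), of "[]" "[]" \<sigma>] piso_empty[of A F] by simp
  qed
  then show "models L_ceq A T_ceq_star"
    using ceq_nonempty[OF rich_ceq[OF A]] unfolding models_def is_structure_ceq by blast
qed

lemma same_qf_type_iff:
  assumes A: "rich A" and "set xs \<subseteq> univ A" "set ys \<subseteq> univ A" "length xs = length ys"
  shows "same_qf_type L_ceq A xs ys \<longleftrightarrow> piso A A (set (zip xs ys))"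
proof
  assume q: "same_qf_type L_ceq A xs ys"
  have r: "rel_interp A R [xs ! i, xs ! j] \<longleftrightarrow> rel_interp A R [ys ! i, ys ! j]"
    if "i < length xs" "j < length xs" for R i j
  proof -
    have "R \<in> rels L_ceq" by (cases R) (simp_all add: L_ceq_def)
    then have "wf_fm L_ceq (length xs) (FRel R [Var i, Var j])" "qfree (FRel R [Var i, Var j])"
      using that by (simp_all add: L_ceq_def)
    then have "sat A xs (FRel R [Var i, Var j]) \<longleftrightarrow> sat A ys (FRel R [Var i, Var j])"
      using q unfolding same_qf_type_def by blast
    then show ?thesis by simp
  qed
  show "piso A A (set (zip xs ys))"
    using assms r by (intro pisoI) (auto simp: set_zip)
next
  assume "piso A A (set (zip xs ys))"
  then show "same_qf_type L_ceq A xs ys"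
    using rich_sat_iff[OF A A assms(4)] assms(4) unfolding same_qf_type_def by blast
qed

lemma same_type_rich:
  assumes "rich A" "set xs \<subseteq> univ A" "set ys \<subseteq> univ A" "length xs = length ys" "piso A A (set (zip xs ys))"
  shows "same_type L_ceq A {} xs ys"
  using rich_sat_iff[OF assms(1,1,4,5)] assms(4) unfolding same_type_def by simp

section \<open>Renaming of variables and realizing countable types\<close>

definition lift :: "(nat \<Rightarrow> nat) \<Rightarrow> nat \<Rightarrow> nat" where
  "lift r i = (case i of 0 \<Rightarrow> 0 | Suc j \<Rightarrow> Suc (r j))"

lemma lift_simps [simp]: "lift r 0 = 0" "lift r (Suc j) = Suc (r j)"
  by (simp_all add: lift_def)

primrec ren_tm :: "(nat \<Rightarrow> nat) \<Rightarrow> 'f tm \<Rightarrow> 'f tm" where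
  "ren_tm r (Var i) = Var (r i)"
| "ren_tm r (Fun f ts) = Fun f (map (ren_tm r) ts)"

text \<open>Serves to read one formula in several environments: with different blocks of parameters,
  on two halves of an environment, or with its variables numbered backwards.\<close>

primrec ren :: "('f, 'r) fm \<Rightarrow> (nat \<Rightarrow> nat) \<Rightarrow> ('f, 'r) fm" where
  "ren (FEq s t) r = FEq (ren_tm r s) (ren_tm r t)"
| "ren (FRel R ts) r = FRel R (map (ren_tm r) ts)"
| "ren (FNeg \<phi>) r = FNeg (ren \<phi> r)"
| "ren (FConj \<phi> \<psi>) r = FConj (ren \<phi> r) (ren \<psi> r)"
| "ren (FEx \<phi>) r = FEx (ren \<phi> (lift r))"

lemma wf_ren_tm: "wf_tm L n t \<Longrightarrow> (\<And>i. i < n \<Longrightarrow> r i < n') \<Longrightarrow> wf_tm L n' (ren_tm r t)"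
  by (induction t) (auto simp: list_all_iff)

lemma wf_ren: "wf_fm L n \<phi> \<Longrightarrow> (\<And>i. i < n \<Longrightarrow> r i < n') \<Longrightarrow> wf_fm L n' (ren \<phi> r)"
proof (induction \<phi> arbitrary: n n' r)
  case (FEx \<phi>)
  have "lift r i < Suc n'" if "i < Suc n" for i using that FEx.prems(2) by (cases i) auto
  then show ?case using FEx by auto
qed (auto simp: list_all_iff wf_ren_tm)

lemma eval_ren_tm:
  "wf_tm L n t \<Longrightarrow> (\<And>i. i < n \<Longrightarrow> e' ! r i = e ! i) \<Longrightarrow> eval_tm M e' (ren_tm r t) = eval_tm M e t"
proof (induction t)
  case (Fun f ts)
  then have "map (\<lambda>t. eval_tm M e' (ren_tm r t)) ts = map (eval_tm M e) ts"
    by (auto simp: list_all_iff)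
  then show ?case by (simp add: comp_def cong: map_cong)
qed simp

lemma sat_ren:
  "wf_fm L n \<phi> \<Longrightarrow> (\<And>i. i < n \<Longrightarrow> e' ! r i = e ! i) \<Longrightarrow> sat M e' (ren \<phi> r) \<longleftrightarrow> sat M e \<phi>"
proof (induction \<phi> arbitrary: n e e' r)
  case (FEq s t)
  then show ?case using eval_ren_tm[of L n _ e' r e M] by simp
next
  case (FRel R ts)
  then have "map (\<lambda>t. eval_tm M e' (ren_tm r t)) ts = map (eval_tm M e) ts"
    using eval_ren_tm[of L n _ e' r e M] by (auto simp: list_all_iff)
  then show ?case by (simp add: comp_def cong: map_cong)
next
  case (FEx \<phi>)
  have "sat M (a # e') (ren \<phi> (lift r)) \<longleftrightarrow> sat M (a # e) \<phi>" for a
  proof (rule FEx.IH)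
    show "wf_fm L (Suc n) \<phi>" using FEx.prems by simp
    show "(a # e') ! lift r i = (a # e) ! i" if "i < Suc n" for i
      using that FEx.prems(2) by (cases i) auto
  qed
  then show ?case by simp
next
  case (FConj \<phi> \<psi>)
  show ?case using FConj.IH[of n e' r e] FConj.prems by simp
next
  case (FNeg \<phi>)
  show ?case using FNeg.IH[of n e' r e] FNeg.prems by simp
qed

text \<open>A closed formula, so that the empty conjunction has no free variables.\<close>

definition FTrue :: "('f, 'r) fm" where
  "FTrue = FAll (FEq (Var 0) (Var 0))"

definition FConjs :: "('f, 'r) fm list \<Rightarrow> ('f, 'r) fm" where
  "FConjs \<phi>s = foldr FConj \<phi>s FTrue"

lemma FConjs_simps [simp]:
  "wf_fm L n (FConjs \<phi>s) \<longleftrightarrow> (\<forall>\<phi>\<in>set \<phi>s. wf_fm L n \<phi>)"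
  "sat M e (FConjs \<phi>s) \<longleftrightarrow> (\<forall>\<phi>\<in>set \<phi>s. sat M e \<phi>)"
  by (induction \<phi>s) (auto simp: FConjs_def FTrue_def)

primrec exs :: "nat \<Rightarrow> ('f, 'r) fm \<Rightarrow> ('f, 'r) fm" where
  "exs 0 \<phi> = \<phi>"
| "exs (Suc m) \<phi> = FEx (exs m \<phi>)"

lemma wf_exs [simp]: "wf_fm L n (exs m \<phi>) \<longleftrightarrow> wf_fm L (m + n) \<phi>"
  by (induction m arbitrary: n) auto

lemma sat_exs [simp]: "sat M e (exs m \<phi>) \<longleftrightarrow> (\<exists>a\<in>tuples M m. sat M (a @ e) \<phi>)"
proof (induction m arbitrary: e)
  case 0
  then show ?case by (auto simp: tuples_def)
next
  case (Suc m)
  \<comment> \<open>The outermost quantifier binds the last entry of the tuple, so tuples are taken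
    apart at the end.\<close>
  have "sat M e (exs (Suc m) \<phi>) \<longleftrightarrow> (\<exists>b\<in>univ M. \<exists>a\<in>tuples M m. sat M ((a @ [b]) @ e) \<phi>)"
    using Suc by simp
  also have "\<dots> \<longleftrightarrow> (\<exists>a\<in>tuples M (Suc m). sat M (a @ e) \<phi>)"
  proof
    assume "\<exists>b\<in>univ M. \<exists>a\<in>tuples M m. sat M ((a @ [b]) @ e) \<phi>"
    then obtain a b where "b \<in> univ M" "a \<in> tuples M m" "sat M ((a @ [b]) @ e) \<phi>" by blast
    then show "\<exists>a\<in>tuples M (Suc m). sat M (a @ e) \<phi>"
      by (intro bexI[of _ "a @ [b]"]) (auto simp: tuples_def)
  next
    assume "\<exists>a\<in>tuples M (Suc m). sat M (a @ e) \<phi>"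
    then obtain c where c: "c \<in> tuples M (Suc m)" "sat M (c @ e) \<phi>" by blast
    then obtain a b where "c = a @ [b]" by (cases c rule: rev_cases) (auto simp: tuples_def)
    then show "\<exists>b\<in>univ M. \<exists>a\<in>tuples M m. sat M ((a @ [b]) @ e) \<phi>"
      using c by (intro bexI[of _ b] bexI[of _ a]) (auto simp: tuples_def)
  qed
  finally show ?case .
qed

section \<open>Common solvability as a formula\<close>

lemma nth_concat_equal_lengths:
  assumes "\<forall>y\<in>set ys. length y = n" "i < length ys" "j < n"
  shows "concat ys ! (i * n + j) = ys ! i ! j"
  using assms
proof (induction ys arbitrary: i)
  case (Cons y ys)
  then show ?case by (cases i) (auto simp: nth_append)
qed simp

lemma length_concat_equal_lengths:
  "\<forall>y\<in>set ys. length y = n \<Longrightarrow> length (concat ys) = length ys * n"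
  by (induction ys) auto

text \<open>\<open>joint m n k \<phi>\<close> is evaluated at \<open>concat ys @ c\<close> with \<open>ys\<close> a list of \<open>k\<close> tuples of length \<open>n\<close>.  It says
  that the formulas \<open>\<phi>(x, y, c)\<close>, \<open>y\<close> in \<open>ys\<close>, have a common solution \<open>x\<close>.\<close>

definition joint :: "nat \<Rightarrow> nat \<Rightarrow> nat \<Rightarrow> ('f, 'r) fm \<Rightarrow> ('f, 'r) fm" where
  "joint m n k \<phi> = exs m (FConjs (map (\<lambda>i. ren \<phi>
     (\<lambda>v. if v < m then v else if v < m + n then v + i * n else v + k * n - n)) [0..<k]))"

lemma wf_joint:
  assumes "wf_fm L (m + n + l) \<phi>"
  shows "wf_fm L (k * n + l) (joint m n k \<phi>)"
proof -
  have "wf_fm L (m + (k * n + l))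
      (ren \<phi> (\<lambda>v. if v < m then v else if v < m + n then v + i * n else v + k * n - n))"
    if "i < k" for i
  proof (rule wf_ren[OF assms])
    fix v assume "v < m + n + l"
    have "n + i * n \<le> k * n" using that mult_le_mono1[of "Suc i" k n] by simp
    then show "(if v < m then v else if v < m + n then v + i * n else v + k * n - n) < m + (k * n + l)"
      using \<open>v < m + n + l\<close> by auto
  qed
  then show ?thesis by (simp add: joint_def)
qed

lemma sat_joint:
  assumes "wf_fm L (m + n + length c) \<phi>" "\<forall>y\<in>set ys. length y = n"
  shows "sat M (concat ys @ c) (joint m n (length ys) \<phi>) \<longleftrightarrow>
    (\<exists>a\<in>tuples M m. \<forall>y\<in>set ys. sat M (a @ y @ c) \<phi>)"
proof -
  have "sat M (a @ concat ys @ c)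
      (ren \<phi> (\<lambda>v. if v < m then v else if v < m + n then v + i * n else v + length ys * n - n)) \<longleftrightarrow>
      sat M (a @ ys ! i @ c) \<phi>" if "a \<in> tuples M m" "i < length ys" for a i
  proof (rule sat_ren[OF assms(1)])
    fix v assume v: "v < m + n + length c"
    have la: "length a = m" using that by (simp add: tuples_def)
    have ly: "length (ys ! i) = n" using that assms by simp
    have lc: "length (concat ys) = length ys * n"
      using assms(2) by (rule length_concat_equal_lengths)
    have le: "n + i * n \<le> length ys * n" using that mult_le_mono1[of "Suc i" "length ys" n] by simp
    consider "v < m" | j where "v = m + j" "j < n" | j where "v = m + n + j"
      by (metis add_less_cancel_left le_Suc_ex not_less)
    then show "(a @ concat ys @ c) !
        (if v < m then v else if v < m + n then v + i * n else v + length ys * n - n) =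
        (a @ ys ! i @ c) ! v"
    proof cases
      case 1
      then show ?thesis using la by (simp add: nth_append)
    next
      case 2
      have "(a @ concat ys @ c) ! (m + (i * n + j)) = concat ys ! (i * n + j)"
        using 2 la le lc by (simp add: nth_append)
      also have "\<dots> = ys ! i ! j"
        using nth_concat_equal_lengths[OF assms(2) that(2) 2(2)] .
      finally show ?thesis using 2 la ly by (simp add: nth_append ac_simps)
    next
      case 3
      \<comment> \<open>A parameter now stands behind \<open>length ys\<close> blocks instead of
        one.\<close>
      have "v + length ys * n - n = m + (length ys * n + j)" using 3 by simp
      then show ?thesis using 3 la ly lc by (simp add: nth_append)
    qed
  qed
  then show ?thesis by (simp add: joint_def all_set_conv_all_nth atLeast0LessThan flip: Ball_def lessThan_iff)
qed

text \<open>A finite parameter set is small: \<kappa> exceeds the number of formulas, which is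
  infinite because the equations of a variable with itself exist in every language.\<close>

lemma saturated_finite_parameters:
  assumes "saturated L \<kappa> M" "Card_order \<kappa>" "(card_of {\<phi> :: ('f, 'r) fm. \<exists>n. wf_fm L n \<phi>}, \<kappa>) \<in> ordLess"
    and d: "set d \<subseteq> univ M" and p: "\<And>\<phi>. \<phi> \<in> p \<Longrightarrow> wf_fm L (Suc (length d)) \<phi>"
    and fin: "\<And>q. q \<subseteq> p \<Longrightarrow> finite q \<Longrightarrow> \<exists>a\<in>univ M. \<forall>\<phi>\<in>q. sat M (a # d) \<phi>"
  shows "\<exists>a\<in>univ M. \<forall>\<phi>\<in>p. sat M (a # d) \<phi>"
proof -
  let ?F = "{\<phi> :: ('f, 'r) fm. \<exists>n. wf_fm L n \<phi>}"
  let ?v = "\<lambda>i. FEq (Var i) (Var i) :: ('f, 'r) fm"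
  have "wf_fm L (Suc i) (?v i)" for i by simp
  then have "range ?v \<subseteq> ?F" by blast
  moreover have "inj ?v" by (rule injI) simp
  ultimately have "infinite ?F" by (meson finite_subset range_inj_infinite)
  then have "(card_of (set d), card_of ?F) \<in> ordLess"
    by (intro finite_ordLess_infinite) (auto simp: card_of_well_order_on Field_card_of)
  then have card: "(card_of (set d), \<kappa>) \<in> ordLess" using assms(3) ordLess_transitive by blast
  have "consistent M 1 ((\<lambda>\<phi>. (\<phi>, d)) ` p)"
    unfolding consistent_def
  proof (intro allI impI)
    fix q assume q: "q \<subseteq> (\<lambda>\<phi>. (\<phi>, d)) ` p" "finite q"
    then have "fst ` q \<subseteq> p" "finite (fst ` q)" by auto
    then obtain a where a: "a \<in> univ M" "\<forall>\<phi>\<in>fst ` q. sat M (a # d) \<phi>" using fin by meson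
    then have "\<forall>(\<phi>, d)\<in>q. sat M ([a] @ d) \<phi>" using q(1) by fastforce
    moreover have "[a] \<in> tuples M 1" using a by (simp add: tuples_def)
    ultimately show "\<exists>a\<in>tuples M 1. \<forall>(\<phi>, d)\<in>q. sat M (a @ d) \<phi>" by blast
  qed
  moreover have "\<forall>(\<phi>, d')\<in>(\<lambda>\<phi>. (\<phi>, d)) ` p. set d' \<subseteq> set d \<and> wf_fm L (1 + length d') \<phi>"
    using p by auto
  ultimately have "\<exists>a\<in>univ M. \<forall>(\<phi>, d)\<in>(\<lambda>\<phi>. (\<phi>, d)) ` p. sat M (a # d) \<phi>"
    using assms(1) card d unfolding saturated_def by blast
  then show ?thesis by auto
qed

text \<open>A pair \<open>(\<psi>, is)\<close> stands for the formula \<open>\<psi>(x\<^sub>i)\<close>, \<open>i\<close> ranging over \<open>is\<close>, in the countably many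
  variables \<open>x\<^sub>0, x\<^sub>1, \<dots>\<close>; these are realized one after the other.\<close>

lemma saturated_realizes:
  fixes M :: "('f, 'r, 'u) struct" and D :: "(('f, 'r) fm \<times> nat list) set"
  assumes sat: "saturated L \<kappa> M" "Card_order \<kappa>" "(card_of {\<phi> :: ('f, 'r) fm. \<exists>n. wf_fm L n \<phi>}, \<kappa>) \<in> ordLess"
    and wf: "\<And>\<psi> is. (\<psi>, is) \<in> D \<Longrightarrow> wf_fm L (length is) \<psi>"
    and fin: "\<And>D0. D0 \<subseteq> D \<Longrightarrow> finite D0 \<Longrightarrow>
      \<exists>w. range w \<subseteq> univ M \<and> (\<forall>(\<psi>, is)\<in>D0. sat M (map w is) \<psi>)"
  shows "\<exists>w. range w \<subseteq> univ M \<and> (\<forall>(\<psi>, is)\<in>D. sat M (map w is) \<psi>)"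
proof -
  \<comment> \<open>A list is good if every finite part of \<open>D\<close> has a realization
    beginning with it. The newest entry comes first, because a quantifier puts its witness at the
    front of the environment.\<close>
  define good where "good us \<longleftrightarrow> set us \<subseteq> univ M \<and>
    (\<forall>D0\<subseteq>D. finite D0 \<longrightarrow> (\<exists>w. range w \<subseteq> univ M \<and> rev (map w [0..<length us]) = us \<and>
       (\<forall>(\<psi>, is)\<in>D0. sat M (map w is) \<psi>)))" for us :: "'u list"
  have step: "\<exists>u. good (u # us)" if us: "good us" for us
  proof -
    define t where "t = length us"
    have usU: "set us \<subseteq> univ M" using us by (simp add: good_def)
    \<comment> \<open>In the environment \<open>rev (map w [0..<N])\<close> the variable x_i has
      index N - 1 - i.\<close>
    define body where "body N xs = map (\<lambda>(\<psi>, is). ren \<psi> (\<lambda>j. N - 1 - is ! j)) xs"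
      for N and xs :: "(('f, 'r) fm \<times> nat list) list"
    define adm where "adm N xs \<longleftrightarrow> set xs \<subseteq> D \<and> t < N \<and> (\<forall>(\<psi>, is)\<in>set xs. \<forall>i\<in>set is. i < N)"
      for N xs
    \<comment> \<open>Binding the N - t - 1 variables after x_t leaves x_t at index 0 with
      \<open>us\<close> behind it. These formulas together form the type that the next value has to
      realize.\<close>
    define \<theta> where "\<theta> N xs = exs (N - t - 1) (FConjs (body N xs))" for N xs
    have sat_body: "sat M e (FConjs (body N xs)) \<longleftrightarrow> (\<forall>(\<psi>, is)\<in>set xs. sat M (map w is) \<psi>)"
      if "adm N xs" "e = rev (map w [0..<N])" for N xs e w
    proof -
      have "sat M e (ren \<psi> (\<lambda>j. N - 1 - is ! j)) \<longleftrightarrow> sat M (map w is) \<psi>" if "(\<psi>, is) \<in> set xs" for \<psi> "is"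
      proof (rule sat_ren)
        have "(\<psi>, is) \<in> D" using that \<open>adm N xs\<close> unfolding adm_def by blast
        then show "wf_fm L (length is) \<psi>" by (rule wf)
        fix j assume j: "j < length is"
        then have "is ! j < N" using that \<open>adm N xs\<close> unfolding adm_def by fastforce
        then show "e ! (N - 1 - is ! j) = map w is ! j"
          using j \<open>e = _\<close> by (simp add: rev_nth)
      qed
      then show ?thesis by (fastforce simp: body_def)
    qed
    let ?p = "{\<theta> N xs | N xs. adm N xs}"
    have "\<exists>a\<in>univ M. \<forall>\<phi>\<in>?p. sat M (a # us) \<phi>"
    proof (rule saturated_finite_parameters[OF sat usU])
      fix \<phi> assume "\<phi> \<in> ?p"
      then obtain N xs where \<phi>: "\<phi> = \<theta> N xs" "adm N xs" by blast
      have "wf_fm L N (ren \<psi> (\<lambda>j. N - 1 - is ! j))" if "(\<psi>, is) \<in> set xs" for \<psi> "is"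
        using that \<phi>(2) by (intro wf_ren[OF wf]) (auto simp: adm_def)
      then have "wf_fm L N (FConjs (body N xs))" by (auto simp: body_def)
      then show "wf_fm L (Suc (length us)) \<phi>" using \<phi> by (simp add: \<theta>_def adm_def t_def)
    next
      fix q assume q: "q \<subseteq> ?p" "finite q"
      then have "\<forall>\<phi>\<in>q. \<exists>z. \<phi> = \<theta> (fst z) (snd z) \<and> adm (fst z) (snd z)" by fastforce
      then obtain z where z: "\<And>\<phi>. \<phi> \<in> q \<Longrightarrow> \<phi> = \<theta> (fst (z \<phi>)) (snd (z \<phi>)) \<and> adm (fst (z \<phi>)) (snd (z \<phi>))"
        by (meson bchoice)
      \<comment> \<open>One realization of the union serves all formulas of \<open>q\<close>, and
        its value at \<open>t\<close> is their common witness.\<close>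
      let ?D0 = "\<Union>\<phi>\<in>q. set (snd (z \<phi>))"
      have "?D0 \<subseteq> D" "finite ?D0" using z q(2) unfolding adm_def by blast+
      then obtain w where w: "range w \<subseteq> univ M" "rev (map w [0..<t]) = us"
        "\<forall>(\<psi>, is)\<in>?D0. sat M (map w is) \<psi>"
        using us unfolding good_def t_def by metis
      have "sat M (w t # us) \<phi>" if \<phi>: "\<phi> \<in> q" for \<phi>
      proof -
        obtain N xs where N: "\<phi> = \<theta> N xs" "adm N xs" "z \<phi> = (N, xs)" using z[OF \<phi>] by (metis prod.collapse)
        have tN: "t < N" using N(2) by (simp add: adm_def)
        then have "[0..<N] = [0..<t] @ t # [Suc t..<N]"
          by (metis less_or_eq_imp_le upt_add_eq_append upt_conv_Cons zero_le le_add_diff_inverse add_0)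
        then have e: "rev (map w [Suc t..<N]) @ w t # us = rev (map w [0..<N])"
          using w(2) by simp
        have "\<forall>(\<psi>, is)\<in>set xs. sat M (map w is) \<psi>" using w(3) \<phi> N(3) by fastforce
        then have "sat M (rev (map w [Suc t..<N]) @ w t # us) (FConjs (body N xs))"
          using sat_body[OF N(2) e] by blast
        moreover have "rev (map w [Suc t..<N]) \<in> tuples M (N - t - 1)"
          using w(1) by (auto simp: tuples_def)
        ultimately show ?thesis unfolding N(1) \<theta>_def sat_exs by blast
      qed
      then show "\<exists>a\<in>univ M. \<forall>\<phi>\<in>q. sat M (a # us) \<phi>" using w(1) by blast
    qed
    then obtain u where u: "u \<in> univ M" "\<And>N xs. adm N xs \<Longrightarrow> sat M (u # us) (\<theta> N xs)" by blast
    have "good (u # us)"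
      unfolding good_def
    proof (intro conjI allI impI)
      show "set (u # us) \<subseteq> univ M" using usU u by simp
      fix D0 assume D0: "D0 \<subseteq> D" "finite D0"
      obtain xs where xs: "set xs = D0" using finite_list[OF D0(2)] by blast
      have "finite (\<Union>(\<psi>, is)\<in>D0. set is)" using D0(2) by auto
      then obtain N0 where N0: "\<forall>i\<in>(\<Union>(\<psi>, is)\<in>D0. set is). i < N0"
        using finite_nat_set_iff_bounded by auto
      define N where "N = max N0 (Suc t)"
      have adm: "adm N xs" using D0 xs N0 by (fastforce simp: adm_def N_def)
      then obtain a where a: "a \<in> tuples M (N - t - 1)" "sat M (a @ u # us) (FConjs (body N xs))"
        using u(2) unfolding \<theta>_def sat_exs by blast
      let ?e = "a @ u # us"
      have len: "length ?e = N" using a adm by (simp add: tuples_def adm_def t_def)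
      \<comment> \<open>All variables occurring in \<open>D0\<close> are below \<open>N\<close>;
        from \<open>N\<close> on, any element of the model serves.\<close>
      define w where "w i = (if i < N then rev ?e ! i else u)" for i
      have rng: "range w \<subseteq> univ M"
      proof
        fix v assume "v \<in> range w"
        then obtain i where v: "v = w i" by blast
        have "set (rev ?e) \<subseteq> univ M" using a usU u by (auto simp: tuples_def)
        moreover have "w i \<in> set (rev ?e)" if "i < N"
          unfolding w_def using that len nth_mem[of i "rev ?e"] by (simp del: set_rev rev_append)
        ultimately show "v \<in> univ M" using v u(1) by (cases "i < N") (auto simp: w_def)
      qed
      have e: "map w [0..<N] = rev ?e"
        using len by (intro nth_equalityI) (auto simp: w_def)
      have "\<forall>(\<psi>, is)\<in>D0. sat M (map w is) \<psi>"
        using sat_body[OF adm, of ?e w] e a(2) xs by simp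
      moreover have "rev (map w [0..<length (u # us)]) = u # us"
      proof -
        have "map w [0..<Suc t] = take (Suc t) (map w [0..<N])"
          using adm by (simp add: take_map adm_def del: upt_Suc)
        also have "\<dots> = rev (u # us)" unfolding e by (simp add: t_def)
        finally show ?thesis by (simp add: t_def)
      qed
      ultimately show "\<exists>w. range w \<subseteq> univ M \<and> rev (map w [0..<length (u # us)]) = u # us \<and>
          (\<forall>(\<psi>, is)\<in>D0. sat M (map w is) \<psi>)" using rng by blast
    qed
    then show ?thesis by blast
  qed
  have "\<exists>f. \<forall>n. (good (f n) \<and> length (f n) = n) \<and> (\<exists>u. f (Suc n) = u # f n)"
  proof (rule dependent_nat_choice)
    have "good []" using fin by (auto simp: good_def)
    then show "\<exists>us. good us \<and> length us = 0" by auto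
    show "\<exists>us'. (good us' \<and> length us' = Suc n) \<and> (\<exists>u. us' = u # us)" if "good us \<and> length us = n" for us n
      using step[of us] that by (metis length_Cons)
  qed
  then obtain f where f: "\<And>n. good (f n)" "\<And>n. length (f n) = n" "\<And>n. \<exists>u. f (Suc n) = u # f n" by blast
  define w where "w n = hd (f (Suc n))" for n
  have fw: "f n = rev (map w [0..<n])" for n
  proof (induction n)
    case 0
    then show ?case using f(2)[of 0] by simp
  next
    case (Suc n)
    have "f (Suc n) = w n # f n" using f(3)[of n] by (auto simp: w_def)
    then show ?case using Suc by simp
  qed
  have "w n \<in> univ M" for n
    using f(1)[of "Suc n"] f(3)[of n] unfolding good_def w_def by auto
  moreover have "sat M (map w is) \<psi>" if D: "(\<psi>, is) \<in> D" for \<psi> "is"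
  proof -
    \<comment> \<open>\<open>f N\<close> fixes all variables of \<psi>, so a realization of this
      single condition that begins with \<open>f N\<close> agrees with \<open>w\<close> on
      them.\<close>
    obtain N where N: "\<forall>i\<in>set is. i < N" using finite_nat_set_iff_bounded[of "set is"] by auto
    obtain w' where w': "rev (map w' [0..<N]) = f N" "sat M (map w' is) \<psi>"
      using f(1)[of N] D unfolding good_def f(2) by (metis (mono_tags, lifting) case_prodD empty_subsetI finite.emptyI finite.insertI insert_iff insert_subset)
    then have "map w' [0..<N] = map w [0..<N]" using fw[of N] by (metis rev_rev_ident)
    then have "map w is = map w' is" using N by auto
    then show ?thesis using w'(2) by (simp only:)
  qed
  ultimately show ?thesis by blast
qed

section \<open>Ramsey's theorem for arrays\<close>

text \<open>An increasing map on a finite set lists its image in order. This allows finite sets of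
  indices to be coloured in place of increasing maps.\<close>

lemma strict_mono_on_image_unique:
  fixes g h :: "'a::linorder \<Rightarrow> 'b::linorder"
  assumes "finite S" "strict_mono_on S g" "strict_mono_on S h" "g ` S = h ` S" "x \<in> S"
  shows "g x = h x"
proof -
  let ?l = "sorted_list_of_set S"
  have "sorted_wrt (<) (map f ?l)" if "strict_mono_on S f" for f :: "'a \<Rightarrow> 'b"
    unfolding sorted_wrt_map
  proof (rule sorted_wrt_mono_rel[OF _ strict_sorted_list_of_set])
    show "f x < f y" if "x \<in> set ?l" "y \<in> set ?l" "x < y" for x y
      using \<open>strict_mono_on S f\<close> that assms(1) by (simp add: strict_mono_on_def)
  qed
  then have "map g ?l = map h ?l"
    using assms by (intro strict_sorted_equal) simp_all
  then show ?thesis using assms by simp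
qed

text \<open>\<open>Q\<close> depends on an increasing map only through its values on the finite set
  \<open>S\<close>, hence only through the image of \<open>S\<close>; so it is a colouring of the
  sets of size \<open>card S\<close>. Inside a homogeneous set the images of \<open>S\<close> under
  \<open>h\<close> and \<open>h \<circ> g\<close> have this size, hence the same colour. Several
  properties are handled by thinning the infinite set repeatedly.\<close>

lemma Ramsey_strict_mono:
  fixes D :: "(((nat \<Rightarrow> nat) \<Rightarrow> bool) \<times> nat set \<times> (nat \<Rightarrow> nat)) set"
  assumes "finite D" "infinite Z"
    and "\<And>Q S g. (Q, S, g) \<in> D \<Longrightarrow> finite S \<and> strict_mono_on S g \<and>
      (\<forall>h h'. (\<forall>x\<in>S. h x = h' x) \<longrightarrow> Q h = Q h')"
  shows "\<exists>Y\<subseteq>Z. infinite Y \<and> (\<forall>h. strict_mono h \<and> range h \<subseteq> Y \<longrightarrow>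
    (\<forall>(Q, S, g)\<in>D. Q h = Q (h \<circ> g)))"
  using assms(1,3)
proof (induction D)
  case empty
  then show ?case using assms(2) by auto
next
  case (insert d D)
  obtain Q S g where d: "d = (Q, S, g)" by (cases d)
  have "\<exists>Y\<subseteq>Z. infinite Y \<and> (\<forall>h. strict_mono h \<and> range h \<subseteq> Y \<longrightarrow> (\<forall>(Q, S, g)\<in>D. Q h = Q (h \<circ> g)))"
    by (rule insert.IH, rule insert.prems, rule insertI2)
  then obtain Y where Y: "Y \<subseteq> Z" "infinite Y"
    "\<forall>h. strict_mono h \<and> range h \<subseteq> Y \<longrightarrow> (\<forall>(Q, S, g)\<in>D. Q h = Q (h \<circ> g))"
    by (elim exE conjE)
  have "(Q, S, g) \<in> insert d D" using d by simp
  note QSg = insert.prems[OF this]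
  note Q = conjunct1[OF QSg] conjunct1[OF conjunct2[OF QSg]] conjunct2[OF conjunct2[OF QSg]]
  define f where "f X = (if \<exists>h. strict_mono_on S h \<and> h ` S = X \<and> Q h then 1 else 0::nat)" for X
  have f: "f (h ` S) = (if Q h then 1 else 0)" if h: "strict_mono_on S h" for h
  proof -
    have "Q h' = Q h" if "strict_mono_on S h'" "h' ` S = h ` S" for h'
    proof (rule Q(3)[rule_format])
      show "h' x = h x" if "x \<in> S" for x
        using strict_mono_on_image_unique[OF Q(1) _ h _ that] \<open>strict_mono_on S h'\<close> \<open>h' ` S = h ` S\<close> .
    qed
    then have "(\<exists>h'. strict_mono_on S h' \<and> h' ` S = h ` S \<and> Q h') \<longleftrightarrow> Q h" using h by blast
    then show ?thesis by (simp add: f_def)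
  qed
  have "\<forall>X. X \<subseteq> Y \<and> finite X \<and> card X = card S \<longrightarrow> f X < 2" by (simp add: f_def)
  from Ramsey[OF Y(2) this] obtain Y' t where Y': "Y' \<subseteq> Y" "infinite Y'"
    "\<forall>X. X \<subseteq> Y' \<and> finite X \<and> card X = card S \<longrightarrow> f X = t"
    by (elim exE conjE)
  have ft: "(if Q h then 1 else 0) = t" if "strict_mono_on S h" "h ` S \<subseteq> Y'" for h
    using f[OF that(1)] Y'(3)[rule_format, of "h ` S"] that(2) Q(1) card_image[OF strict_mono_on_imp_inj_on[OF that(1)]] by simp
  have QY': "Q h = Q (h \<circ> g)" if h: "strict_mono h" "range h \<subseteq> Y'" for h
  proof -
    have "strict_mono_on S h" "strict_mono_on S (h \<circ> g)"
      using h(1) Q(2) by (auto simp: strict_mono_on_def strict_mono_def)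
    moreover have "h ` S \<subseteq> Y'" "(h \<circ> g) ` S \<subseteq> Y'" using h(2) by auto
    ultimately have "(if Q h then 1 else 0) = t" "(if Q (h \<circ> g) then 1 else 0) = t"
      using ft by blast+
    then show ?thesis by (simp split: if_splits)
  qed
  have "\<forall>h. strict_mono h \<and> range h \<subseteq> Y' \<longrightarrow> (\<forall>(Q, S, g)\<in>insert d D. Q h = Q (h \<circ> g))"
  proof (intro allI impI)
    fix h :: "nat \<Rightarrow> nat" assume h: "strict_mono h \<and> range h \<subseteq> Y'"
    then have "\<forall>(Q, S, g)\<in>D. Q h = Q (h \<circ> g)" using Y(3) Y'(1) by (meson order_trans)
    then show "\<forall>(Q, S, g)\<in>insert d D. Q h = Q (h \<circ> g)" using QY' h d by simp
  qed
  moreover have "Y' \<subseteq> Z" using Y(1) Y'(1) by blast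
  ultimately show ?case using Y'(2) by (intro exI[of _ Y'] conjI)
qed

lemma ex_strict_mono_on_of_relation:
  fixes \<rho> :: "(nat \<times> nat) set"
  assumes "\<And>x y x' y'. (x, y) \<in> \<rho> \<Longrightarrow> (x', y') \<in> \<rho> \<Longrightarrow> x < x' \<longleftrightarrow> y < y'"
  shows "\<exists>g. strict_mono_on (Domain \<rho>) g \<and> (\<forall>(x, y)\<in>\<rho>. g x = y)"
proof -
  define g where "g x = (SOME y. (x, y) \<in> \<rho>)" for x
  have g: "g x = y" if "(x, y) \<in> \<rho>" for x y
  proof -
    have *: "(x, g x) \<in> \<rho>" unfolding g_def using that by (rule someI)
    show ?thesis using assms[OF * that] assms[OF that *] by auto
  qed
  have "strict_mono_on (Domain \<rho>) g"
    by (rule strict_mono_onI) (use g assms in \<open>auto simp: Domain_iff\<close>)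
  then show ?thesis using g by blast
qed

text \<open>The source of column indices, as \<open>rank_class\<close> is of row indices. On
  \<open>S\<close>, \<open>rank_class\<close> is constant on each class and
  \<open>rank_below\<close> separates points. The number of a class is at most that of each of its
  points and greater than that of every point in a lower class.\<close>

definition rank_below :: "('f, ceq_rel, 'a) struct \<Rightarrow> 'a set \<Rightarrow> 'a \<Rightarrow> nat" where
  "rank_below A S a = card {x \<in> S. lss A x a}"

definition rank_class :: "('f, ceq_rel, 'a) struct \<Rightarrow> 'a set \<Rightarrow> 'a \<Rightarrow> nat" where
  "rank_class A S a = card {x \<in> S. lss A x a \<and> \<not> eqv A x a}"

lemma
  assumes A: "ceq A" and S: "finite S" "S \<subseteq> univ A" and ab: "a \<in> S" "b \<in> S"
  shows rank_below_less: "rank_below A S a < rank_below A S b \<longleftrightarrow> lss A a b"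
    and rank_class_less: "rank_class A S a < rank_class A S b \<longleftrightarrow> lss A a b \<and> \<not> eqv A a b"
    and rank_below_less_rank_class: "rank_below A S a < rank_class A S b \<longleftrightarrow> lss A a b \<and> \<not> eqv A a b"
proof -
  have U: "x \<in> univ A" if "x \<in> S" for x using that S by blast
  have below: "rank_below A S a < rank_below A S b" if "lss A a b" "a \<in> S" "b \<in> S" for a b
    unfolding rank_below_def
  proof (rule psubset_card_mono)
    show "{x \<in> S. lss A x a} \<subset> {x \<in> S. lss A x b}"
      using that ceq_irrefl[OF A U[OF that(2)]] ceq_lss_trans[OF A U U[OF that(2)] U[OF that(3)]] by blast
  qed (use S in simp)
  then show "rank_below A S a < rank_below A S b \<longleftrightarrow> lss A a b"
    using ceq_trichotomy[OF A U[OF ab(1)] U[OF ab(2)]] ab by (metis less_asym less_irrefl)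
  have le: "{x \<in> S. lss A x a} \<subseteq> {x \<in> S. lss A x b \<and> \<not> eqv A x b}"
    if "lss A a b" "\<not> eqv A a b" "a \<in> S" "b \<in> S" for a b
    using that ceq_lss_trans[OF A U U[OF that(3)] U[OF that(4)]]
      ceq_convex2[OF A U U[OF that(3)] U[OF that(4)]] by blast
  \<comment> \<open>\<open>a\<close> itself is counted on the right but not on the left, hence the
    strict inequality.\<close>
  have below_class: "rank_below A S a < rank_class A S b"
    if "lss A a b" "\<not> eqv A a b" "a \<in> S" "b \<in> S" for a b
    unfolding rank_below_def rank_class_def
  proof (rule psubset_card_mono)
    show "{x \<in> S. lss A x a} \<subset> {x \<in> S. lss A x b \<and> \<not> eqv A x b}"
      using le[OF that] that ceq_irrefl[OF A U[OF that(3)]] by blast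
  qed (use S in simp)
  have class_below: "rank_class A S a \<le> rank_below A S a" for a
    unfolding rank_class_def rank_below_def using S by (intro card_mono) auto
  have class_eq: "rank_class A S a = rank_class A S b" if "eqv A a b" "a \<in> S" "b \<in> S" for a b
  proof -
    have "(lss A x a \<and> \<not> eqv A x a) \<longleftrightarrow> (lss A x b \<and> \<not> eqv A x b)" if x: "x \<in> S" for x
      using ceq_lss_class(2)[OF A U[OF \<open>a \<in> S\<close>] U[OF \<open>b \<in> S\<close>] U[OF x] \<open>eqv A a b\<close>]
        ceq_sym[OF A U[OF \<open>a \<in> S\<close>] U[OF x]] ceq_sym[OF A U[OF x] U[OF \<open>a \<in> S\<close>]]
        ceq_eqv_trans[OF A U[OF x] U[OF \<open>a \<in> S\<close>] U[OF \<open>b \<in> S\<close>] _ \<open>eqv A a b\<close>]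
        ceq_eqv_trans[OF A U[OF x] U[OF \<open>b \<in> S\<close>] U[OF \<open>a \<in> S\<close>] _
          ceq_sym[OF A U[OF \<open>a \<in> S\<close>] U[OF \<open>b \<in> S\<close>] \<open>eqv A a b\<close>]]
      by blast
    then have "{x \<in> S. lss A x a \<and> \<not> eqv A x a} = {x \<in> S. lss A x b \<and> \<not> eqv A x b}" by blast
    then show ?thesis by (simp add: rank_class_def)
  qed
  consider "lss A a b" "\<not> eqv A a b" | "eqv A a b" | "lss A b a" "\<not> eqv A b a"
    using ceq_trichotomy[OF A U[OF ab(1)] U[OF ab(2)]] ceq_refl[OF A U[OF ab(1)]]
      ceq_sym[OF A U[OF ab(2)] U[OF ab(1)]] by blast
  then have "(rank_class A S a < rank_class A S b \<longleftrightarrow> lss A a b \<and> \<not> eqv A a b) \<and>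
      (rank_below A S a < rank_class A S b \<longleftrightarrow> lss A a b \<and> \<not> eqv A a b)"
  proof cases
    case 1
    then show ?thesis using below_class[OF 1 ab] class_below[of a] by simp
  next
    case 2
    then show ?thesis using class_eq[OF 2 ab] class_below[of a] by simp
  next
    case 3
    then show ?thesis
      using below_class[OF 3 ab(2,1)] class_below[of a] class_below[of b]
        ceq_asym[OF A U[OF ab(2)] U[OF ab(1)]] by simp
  qed
  then show "rank_class A S a < rank_class A S b \<longleftrightarrow> lss A a b \<and> \<not> eqv A a b"
    "rank_below A S a < rank_class A S b \<longleftrightarrow> lss A a b \<and> \<not> eqv A a b" by blast+
qed

text \<open>The entry of the array assigned to \<open>a\<close> has row \<open>h (2 * rank_class a)\<close> and column
  \<open>h (2 * rank_below a + 1)\<close>.  These indices interleave so that the quantifier-free type of a tuple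
  determines the order type of all its row and column indices together; hence the classical
  Ramsey theorem is enough.\<close>

lemma array_homogeneous:
  fixes A :: "('f, ceq_rel, 'a) struct"
    and \<Phi> :: "(((nat \<times> nat) list \<Rightarrow> bool) \<times> 'a list \<times> 'a list) set"
  assumes A: "ceq A" and S: "finite S" "S \<subseteq> univ A" and "finite \<Phi>"
    and \<Phi>: "\<And>P as bs. (P, as, bs) \<in> \<Phi> \<Longrightarrow> set as \<subseteq> S \<and> set bs \<subseteq> S \<and> length as = length bs \<and>
      piso A A (set (zip as bs))"
  shows "\<exists>R J. (\<forall>a\<in>S. \<forall>b\<in>S. (R a = R b \<longleftrightarrow> eqv A a b) \<and> (J a = J b \<longleftrightarrow> a = b)) \<and>
    (\<forall>(P, as, bs)\<in>\<Phi>. P (map (\<lambda>a. (R a, J a)) as) \<longleftrightarrow> P (map (\<lambda>a. (R a, J a)) bs))"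
proof -
  \<comment> \<open>Even numbers for rows, odd ones for columns: a row index precedes the column
    indices of its own class and follows those of all lower classes.\<close>
  define r where "r a = 2 * rank_class A S a" for a
  define j where "j a = Suc (2 * rank_below A S a)" for a
  note rank = rank_below_less[OF A S] rank_class_less[OF A S] rank_below_less_rank_class[OF A S]
  define rj where "rj h a = (h (r a), h (j a))" for h :: "nat \<Rightarrow> nat" and a
  have U: "x \<in> univ A" if "x \<in> S" for x using that S by blast
  have rr: "r a < r b \<longleftrightarrow> lss A a b \<and> \<not> eqv A a b"
    and jj: "j a < j b \<longleftrightarrow> lss A a b"
    and jr: "j a < r b \<longleftrightarrow> lss A a b \<and> \<not> eqv A a b"
    and rj: "r a < j b \<longleftrightarrow> \<not> (lss A b a \<and> \<not> eqv A b a)" if "a \<in> S" "b \<in> S" for a b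
    using rank[OF that] rank(3)[OF that(2,1)] unfolding r_def j_def by linarith+
  have "\<exists>g. strict_mono_on (r ` set as \<union> j ` set as) g \<and> (\<forall>h. map (rj (h \<circ> g)) as = map (rj h) bs)"
    if in\<Phi>: "(P, as, bs) \<in> \<Phi>" for P as bs
  proof -
    let ?z = "set (zip as bs)"
    \<comment> \<open>Matching the indices of \<open>as\<close> with those of \<open>bs\<close>
      preserves all comparisons, so it is an increasing map \<open>g\<close>; reading
      \<open>as\<close> through \<open>h \<circ> g\<close> is then reading \<open>bs\<close> through
      \<open>h\<close>.\<close>
    let ?\<rho> = "(\<lambda>(a, b). (r a, r b)) ` ?z \<union> (\<lambda>(a, b). (j a, j b)) ` ?z"
    have z: "length as = length bs" "piso A A ?z" "set as \<subseteq> S" "set bs \<subseteq> S" using \<Phi>[OF in\<Phi>] by blast+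
    have zS: "a \<in> S" "b \<in> S" if "(a, b) \<in> ?z" for a b
      using set_zip_leftD[OF that] set_zip_rightD[OF that] z by blast+
    have lt: "(r a < r a' \<longleftrightarrow> r b < r b') \<and> (j a < j a' \<longleftrightarrow> j b < j b') \<and>
        (r a < j a' \<longleftrightarrow> r b < j b') \<and> (j a < r a' \<longleftrightarrow> j b < r b')"
      if ab: "(a, b) \<in> ?z" "(a', b') \<in> ?z" for a b a' b'
      using pisoD(3,4)[OF z(2) ab] pisoD(3,4)[OF z(2) ab(2,1)]
      unfolding rr[OF zS(1)[OF ab(1)] zS(1)[OF ab(2)]] rr[OF zS(2)[OF ab(1)] zS(2)[OF ab(2)]]
        jj[OF zS(1)[OF ab(1)] zS(1)[OF ab(2)]] jj[OF zS(2)[OF ab(1)] zS(2)[OF ab(2)]]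
        rj[OF zS(1)[OF ab(1)] zS(1)[OF ab(2)]] rj[OF zS(2)[OF ab(1)] zS(2)[OF ab(2)]]
        jr[OF zS(1)[OF ab(1)] zS(1)[OF ab(2)]] jr[OF zS(2)[OF ab(1)] zS(2)[OF ab(2)]]
      by blast
    have "\<exists>g. strict_mono_on (Domain ?\<rho>) g \<and> (\<forall>(x, y)\<in>?\<rho>. g x = y)"
    proof (rule ex_strict_mono_on_of_relation)
      have cases: "\<exists>a b. (a, b) \<in> ?z \<and> (x = r a \<and> y = r b \<or> x = j a \<and> y = j b)"
        if "(x, y) \<in> ?\<rho>" for x y
        using that by (auto split: prod.splits)
      fix x y x' y' assume "(x, y) \<in> ?\<rho>" "(x', y') \<in> ?\<rho>"
      from cases[OF this(1)] cases[OF this(2)] obtain a b a' b' where ab: "(a, b) \<in> ?z" "(a', b') \<in> ?z"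
        and "x = r a \<and> y = r b \<or> x = j a \<and> y = j b" "x' = r a' \<and> y' = r b' \<or> x' = j a' \<and> y' = j b'"
        by (elim exE conjE)
      then show "x < x' \<longleftrightarrow> y < y'" using lt[OF ab] by (elim disjE) simp_all
    qed
    then obtain g where g: "strict_mono_on (Domain ?\<rho>) g" "\<forall>(x, y)\<in>?\<rho>. g x = y"
      by (elim exE conjE)
    have g2: "g (r a) = r b \<and> g (j a) = j b" if "(a, b) \<in> ?z" for a b
      using g(2) that unfolding ball_Un by auto
    have "Domain ?\<rho> = r ` set as \<union> j ` set as"
    proof -
      have "as = map fst (zip as bs)" using z(1) by simp
      then have "set as = fst ` ?z" by (metis list.set_map)
      then show ?thesis by force
    qed
    moreover have "map (rj (h \<circ> g)) as = map (rj h) bs" for h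
    proof (rule nth_equalityI)
      fix i assume "i < length (map (rj (h \<circ> g)) as)"
      then have i: "i < length as" by simp
      then have "(as ! i, bs ! i) \<in> ?z" using z(1) by (auto simp: set_zip)
      then show "map (rj (h \<circ> g)) as ! i = map (rj h) bs ! i" using g2 i z(1) by (simp add: rj_def)
    qed (simp add: z)
    ultimately show ?thesis using g(1) by metis
  qed
  then have "\<forall>d\<in>\<Phi>. \<exists>g. strict_mono_on (r ` set (fst (snd d)) \<union> j ` set (fst (snd d))) g \<and>
      (\<forall>h. map (rj (h \<circ> g)) (fst (snd d)) = map (rj h) (snd (snd d)))"
    by (metis prod.collapse)
  then obtain G where G: "\<And>d. d \<in> \<Phi> \<Longrightarrow> strict_mono_on (r ` set (fst (snd d)) \<union> j ` set (fst (snd d))) (G d) \<and>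
      (\<forall>h. map (rj (h \<circ> G d)) (fst (snd d)) = map (rj h) (snd (snd d)))"
    using bchoice by (metis (no_types, lifting))
  let ?D = "(\<lambda>d. (\<lambda>h. fst d (map (rj h) (fst (snd d))), r ` set (fst (snd d)) \<union> j ` set (fst (snd d)), G d)) ` \<Phi>"
  have "\<exists>Y\<subseteq>UNIV. infinite Y \<and> (\<forall>h. strict_mono h \<and> range h \<subseteq> Y \<longrightarrow>
      (\<forall>(Q, S, g)\<in>?D. Q h = Q (h \<circ> g)))"
  proof (rule Ramsey_strict_mono)
    fix Q S g assume "(Q, S, g) \<in> ?D"
    then obtain d where d: "d \<in> \<Phi>" "Q = (\<lambda>h. fst d (map (rj h) (fst (snd d))))"
      "S = r ` set (fst (snd d)) \<union> j ` set (fst (snd d))" "g = G d"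
      by auto
    have "Q h = Q h'" if "\<forall>x\<in>S. h x = h' x" for h h'
    proof -
      have "map (rj h) (fst (snd d)) = map (rj h') (fst (snd d))" using that d(3) by (simp add: rj_def)
      then show ?thesis by (simp only: d(2))
    qed
    then show "finite S \<and> strict_mono_on S g \<and> (\<forall>h h'. (\<forall>x\<in>S. h x = h' x) \<longrightarrow> Q h = Q h')"
      using G[OF d(1)] d(3,4) by simp
  qed (use \<open>finite \<Phi>\<close> in simp_all)
  then obtain Y where Y: "infinite Y"
    "\<forall>h. strict_mono h \<and> range h \<subseteq> Y \<longrightarrow> (\<forall>(Q, S, g)\<in>?D. Q h = Q (h \<circ> g))"
    by (elim exE conjE)
  define h where "h = enumerate Y"
  have h: "strict_mono h" "range h \<subseteq> Y"
    using Y(1) enumerate_in_set[of Y] by (auto simp: h_def strict_mono_enumerate)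
  have hD: "\<forall>(Q, S, g)\<in>?D. Q h = Q (h \<circ> g)" by (rule mp[OF spec[OF Y(2)] conjI[OF h]])
  show ?thesis
  proof (intro exI conjI ballI)
    fix a b assume ab: "a \<in> S" "b \<in> S"
    have "r a = r b \<longleftrightarrow> eqv A a b"
      using rr[OF ab] rr[OF ab(2,1)] ceq_trichotomy[OF A U U, OF ab] ceq_refl[OF A U[OF ab(1)]]
        ceq_sym[OF A U U, OF ab] ceq_sym[OF A U U, OF ab(2,1)]
      by (metis less_irrefl nat_neq_iff)
    then show "h (r a) = h (r b) \<longleftrightarrow> eqv A a b" using h(1) by (simp add: strict_mono_eq)
    have "j a = j b \<longleftrightarrow> a = b"
      using jj[OF ab] jj[OF ab(2,1)] ceq_trichotomy[OF A U U, OF ab] by (metis less_irrefl)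
    then show "h (j a) = h (j b) \<longleftrightarrow> a = b" using h(1) by (simp add: strict_mono_eq)
  next
    have "P (map (rj h) as) \<longleftrightarrow> P (map (rj h) bs)" if "(P, as, bs) \<in> \<Phi>" for P as bs
      using hD G[OF that] that by fastforce
    then show "case d of (P, as, bs) \<Rightarrow> P (map (\<lambda>a. (h (r a), h (j a))) as) \<longleftrightarrow>
        P (map (\<lambda>a. (h (r a), h (j a))) bs)" if "d \<in> \<Phi>" for d
      using that unfolding rj_def by (auto split: prod.splits)
  qed
qed

section \<open>From arrays to pictures\<close>

text \<open>Equal truth values on two tuples as a single formula, so that indiscernibility can be
  part of a type to be realized.\<close>

definition iff_fm :: "nat \<Rightarrow> ('f, 'r) fm \<Rightarrow> ('f, 'r) fm" where
  "iff_fm N \<psi> = (let \<psi>1 = ren \<psi> (\<lambda>i. i); \<psi>2 = ren \<psi> (\<lambda>i. N + i) in FConj (FImp \<psi>1 \<psi>2) (FImp \<psi>2 \<psi>1))"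

lemma wf_iff_fm: "wf_fm L N \<psi> \<Longrightarrow> wf_fm L (N + N) (iff_fm N \<psi>)"
  by (simp add: iff_fm_def Let_def wf_ren)

lemma sat_iff_fm:
  assumes "wf_fm L N \<psi>" "length e = N"
  shows "sat M (e @ e') (iff_fm N \<psi>) \<longleftrightarrow> (sat M e \<psi> \<longleftrightarrow> sat M e' \<psi>)"
proof -
  have "sat M (e @ e') (ren \<psi> (\<lambda>i. i)) \<longleftrightarrow> sat M e \<psi>"
    by (rule sat_ren[OF assms(1)]) (use assms(2) in \<open>simp add: nth_append\<close>)
  moreover have "sat M (e @ e') (ren \<psi> (\<lambda>i. N + i)) \<longleftrightarrow> sat M e' \<psi>"
    by (rule sat_ren[OF assms(1)]) (use assms(2) in \<open>simp add: nth_append\<close>)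
  ultimately show ?thesis by (auto simp: iff_fm_def Let_def)
qed

text \<open>Distinct points get distinct columns even when their rows differ. What is true under
  every such placement in the array is inherited by the picture.\<close>

definition separates ::
  "('f, ceq_rel, 'a) struct \<Rightarrow> 'a set \<Rightarrow> ('a \<Rightarrow> nat) \<Rightarrow> ('a \<Rightarrow> nat) \<Rightarrow> bool" where
  "separates A S R J \<longleftrightarrow>
     (\<forall>a\<in>S. \<forall>b\<in>S. (R a = R b \<longleftrightarrow> eqv A a b) \<and> (J a = J b \<longleftrightarrow> a = b))"

lemma separates_subset: "separates A S R J \<Longrightarrow> S' \<subseteq> S \<Longrightarrow> separates A S' R J"
  unfolding separates_def by blast

lemma concat_map_upt:
  assumes "\<And>a. a \<in> set as \<Longrightarrow> map w [p a..<p a + n] = f a"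
  shows "map w (concat (map (\<lambda>a. [p a..<p a + n]) as)) = concat (map f as)"
  using assms by (induction as) auto

lemma finite_subset_Un_image:
  assumes "finite D" "D \<subseteq> f ` S \<union> g ` T"
  shows "\<exists>B C. B \<subseteq> S \<and> C \<subseteq> T \<and> finite B \<and> finite C \<and> D = f ` B \<union> g ` C"
proof -
  have "\<exists>B\<subseteq>S. finite B \<and> D \<inter> f ` S = f ` B" by (rule finite_subset_image) (use assms(1) in auto)
  moreover have "\<exists>C\<subseteq>T. finite C \<and> D \<inter> g ` T = g ` C" by (rule finite_subset_image) (use assms(1) in auto)
  ultimately obtain B C where BC: "B \<subseteq> S" "finite B" "D \<inter> f ` S = f ` B"
    "C \<subseteq> T" "finite C" "D \<inter> g ` T = g ` C" by (elim exE conjE)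
  have "D = (D \<inter> f ` S) \<union> (D \<inter> g ` T)" using assms(2) by auto
  then show ?thesis using BC by metis
qed

text \<open>Indiscernibility and the inherited formulas are conditions on countably many variables,
  \<open>n\<close> for each point of \<open>A\<close>. Finitely many conditions mention finitely
  many points, which \<open>array_homogeneous\<close> places in the array so that the required
  equivalences hold. Saturation then realizes all conditions at once.\<close>

lemma ex_picture_of_array:
  fixes A :: "('g, ceq_rel, 'a) struct" and M :: "('f, 'r, 'u) struct"
  assumes sat: "saturated L \<kappa> M" "Card_order \<kappa>" "(card_of {\<phi> :: ('f, 'r) fm. \<exists>n. wf_fm L n \<phi>}, \<kappa>) \<in> ordLess"
    and A: "ceq A" "countable (univ A)"
    and M: "univ M \<noteq> {}" and b: "\<And>i j. b i j \<in> tuples M n"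
  shows "\<exists>I. (\<forall>a\<in>univ A. I a \<in> tuples M n) \<and>
    (\<forall>as bs. set as \<subseteq> univ A \<and> set bs \<subseteq> univ A \<and> length as = length bs \<and> piso A A (set (zip as bs)) \<longrightarrow>
       same_type L M {} (concat (map I as)) (concat (map I bs))) \<and>
    (\<forall>as \<psi>. set as \<subseteq> univ A \<and> wf_fm L (length as * n) \<psi> \<and>
       (\<forall>R J. separates A (set as) R J \<longrightarrow> sat M (concat (map (\<lambda>a. b (R a) (J a)) as)) \<psi>) \<longrightarrow>
       sat M (concat (map I as)) \<psi>)"
proof -
  \<comment> \<open>The point numbered \<open>i\<close> owns the \<open>n\<close> variables starting
    at \<open>i * n\<close>.\<close>
  define pos where "pos a = to_nat_on (univ A) a * n" for a
  define idx where "idx as = concat (map (\<lambda>a. [pos a..<pos a + n]) as)" for as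
  have len_idx: "length (idx as) = length as * n" for as by (induction as) (auto simp: idx_def)
  define T1 where "T1 = {(\<psi>, as, bs). set as \<subseteq> univ A \<and> set bs \<subseteq> univ A \<and> length as = length bs \<and>
    piso A A (set (zip as bs)) \<and> wf_fm L (length as * n) \<psi>}"
  define T2 where "T2 = {(\<psi>, as). set as \<subseteq> univ A \<and> wf_fm L (length as * n) \<psi> \<and>
    (\<forall>R J. separates A (set as) R J \<longrightarrow> sat M (concat (map (\<lambda>a. b (R a) (J a)) as)) \<psi>)}"
  have T1D: "set as \<subseteq> univ A" "set bs \<subseteq> univ A" "length as = length bs" "piso A A (set (zip as bs))"
      "wf_fm L (length as * n) \<psi>" if "(\<psi>, as, bs) \<in> T1" for \<psi> as bs
    using that[unfolded T1_def mem_Collect_eq case_prod_conv] by blast+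
  have T2D: "set as \<subseteq> univ A" "wf_fm L (length as * n) \<psi>"
    "\<forall>R J. separates A (set as) R J \<longrightarrow> sat M (concat (map (\<lambda>a. b (R a) (J a)) as)) \<psi>"
    if "(\<psi>, as) \<in> T2" for \<psi> as
    using that by (simp_all add: T2_def)
  let ?f1 = "\<lambda>(\<psi>, as, bs). (iff_fm (length as * n) \<psi>, idx as @ idx bs)"
  let ?f2 = "\<lambda>(\<psi>, as). (\<psi>, idx as)"
  let ?D = "?f1 ` T1 \<union> ?f2 ` T2"
  have "\<exists>w. range w \<subseteq> univ M \<and> (\<forall>(\<psi>, is)\<in>?D. sat M (map w is) \<psi>)"
  proof (rule saturated_realizes[OF sat])
    fix \<psi> "is" assume "(\<psi>, is) \<in> ?D"
    then consider \<chi> as bs where "(\<chi>, as, bs) \<in> T1" "\<psi> = iff_fm (length as * n) \<chi>" "is = idx as @ idx bs"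
      | as where "(\<psi>, as) \<in> T2" "is = idx as"
      by auto
    then show "wf_fm L (length is) \<psi>"
    proof cases
      case 1
      then show ?thesis using wf_iff_fm[OF T1D(5)[OF 1(1)]] T1D(3)[OF 1(1)] by (simp add: len_idx)
    next
      case 2
      then show ?thesis using T2D(2) by (simp add: len_idx)
    qed
  next
    fix D0 assume D0: "D0 \<subseteq> ?D" "finite D0"
    from finite_subset_Un_image[OF D0(2,1)] obtain C1 C2 where
      C: "C1 \<subseteq> T1" "C2 \<subseteq> T2" "finite C1" "finite C2" "D0 = ?f1 ` C1 \<union> ?f2 ` C2"
      by (elim exE conjE)
    define S where "S = (\<Union>(\<psi>, as, bs)\<in>C1. set as \<union> set bs) \<union> (\<Union>(\<psi>, as)\<in>C2. set as)"
    have S1: "set as \<subseteq> S" "set bs \<subseteq> S" if "(\<psi>, as, bs) \<in> C1" for \<psi> as bs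
      using that unfolding S_def by fastforce+
    have S2: "set as \<subseteq> S" if "(\<psi>, as) \<in> C2" for \<psi> as
      using that unfolding S_def by fastforce
    have "finite S" unfolding S_def using C(3,4) by auto
    moreover have "S \<subseteq> univ A"
    proof
      fix x assume "x \<in> S"
      then consider \<psi> as bs where "(\<psi>, as, bs) \<in> C1" "x \<in> set as \<union> set bs"
        | \<psi> as where "(\<psi>, as) \<in> C2" "x \<in> set as"
        unfolding S_def by auto
      then show "x \<in> univ A"
      proof cases
        case 1
        then show ?thesis using T1D(1,2)[of \<psi> as bs] C(1) by auto
      next
        case 2
        then show ?thesis using T2D(1)[of \<psi> as] C(2) by auto
      qed
    qed
    ultimately have S: "finite S" "S \<subseteq> univ A" by simp_all
    let ?P = "\<lambda>\<psi> rj. sat M (concat (map (\<lambda>(i, j). b i j) rj)) \<psi>"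
    let ?\<Phi> = "(\<lambda>(\<psi>, as, bs). (?P \<psi>, as, bs)) ` C1"
    have "\<exists>R J. (\<forall>a\<in>S. \<forall>b\<in>S. (R a = R b \<longleftrightarrow> eqv A a b) \<and> (J a = J b \<longleftrightarrow> a = b)) \<and>
      (\<forall>(P, as, bs)\<in>?\<Phi>. P (map (\<lambda>a. (R a, J a)) as) \<longleftrightarrow> P (map (\<lambda>a. (R a, J a)) bs))"
    proof (rule array_homogeneous[OF A(1) S])
      show "finite ?\<Phi>" using C(3) by simp
      fix P as bs assume "(P, as, bs) \<in> ?\<Phi>"
      then obtain \<psi> where \<psi>: "(\<psi>, as, bs) \<in> C1" by auto
      then have "(\<psi>, as, bs) \<in> T1" using C(1) by blast
      then show "set as \<subseteq> S \<and> set bs \<subseteq> S \<and> length as = length bs \<and> piso A A (set (zip as bs))"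
        using S1[OF \<psi>] T1D(3,4) by simp
    qed
    then obtain R J where sep: "separates A S R J"
      and hom: "\<forall>(P, as, bs)\<in>?\<Phi>. P (map (\<lambda>a. (R a, J a)) as) \<longleftrightarrow> P (map (\<lambda>a. (R a, J a)) bs)"
      unfolding separates_def by (elim exE conjE)
    obtain u where u: "u \<in> univ M" using M by blast
    \<comment> \<open>Division by \<open>n\<close> recovers the point, the remainder its coordinate.
      For \<open>n = 0\<close> no variable belongs to a point, and any element serves as the
      value.\<close>
    define w where "w v = (if n = 0 then u else
      (let a = from_nat_into (univ A) (v div n) in b (R a) (J a) ! (v mod n)))" for v
    have lb: "length (b i j) = n" for i j using b[of i j] by (simp add: tuples_def)
    have "w v \<in> univ M" for v
    proof (cases "n = 0")
      case False
      let ?a = "from_nat_into (univ A) (v div n)"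
      have "b (R ?a) (J ?a) ! (v mod n) \<in> set (b (R ?a) (J ?a))"
        using False lb by (intro nth_mem) simp
      then show ?thesis using b[of "R ?a" "J ?a"] False by (auto simp: w_def tuples_def Let_def)
    qed (simp add: w_def u)
    moreover have wa: "map w [pos a..<pos a + n] = b (R a) (J a)" if "a \<in> univ A" for a
    proof (rule nth_equalityI)
      fix i assume "i < length (map w [pos a..<pos a + n])"
      then have i: "i < n" by simp
      then have "(pos a + i) div n = to_nat_on (univ A) a" "(pos a + i) mod n = i"
        by (simp_all add: pos_def)
      then show "map w [pos a..<pos a + n] ! i = b (R a) (J a) ! i"
        using i A(2) that by (simp add: w_def)
    qed (simp add: lb)
    have widx: "map w (idx as) = concat (map (\<lambda>a. b (R a) (J a)) as)" if "set as \<subseteq> univ A" for as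
      unfolding idx_def using that wa by (intro concat_map_upt) blast
    have "sat M (map w is) \<psi>" if inD0: "(\<psi>, is) \<in> D0" for \<psi> "is"
    proof -
      have "(\<psi>, is) \<in> ?f1 ` C1 \<union> ?f2 ` C2" using inD0 unfolding C(5) .
      then consider \<chi> as bs where "(\<chi>, as, bs) \<in> C1" "\<psi> = iff_fm (length as * n) \<chi>" "is = idx as @ idx bs"
        | as where "(\<psi>, as) \<in> C2" "is = idx as"
        by auto
      then show ?thesis
      proof cases
        case 1
        have "(\<chi>, as, bs) \<in> T1" using 1(1) C(1) by blast
        note * = T1D(1,2,5)[OF this]
        have "(?P \<chi>, as, bs) \<in> ?\<Phi>" using 1(1) by force
        then have "?P \<chi> (map (\<lambda>a. (R a, J a)) as) \<longleftrightarrow> ?P \<chi> (map (\<lambda>a. (R a, J a)) bs)"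
          using bspec[OF hom, of "(?P \<chi>, as, bs)"] by simp
        then have "sat M (map w (idx as)) \<chi> \<longleftrightarrow> sat M (map w (idx bs)) \<chi>"
          unfolding widx[OF *(1)] widx[OF *(2)] by (simp add: comp_def)
        then show ?thesis using sat_iff_fm[OF *(3), of "map w (idx as)"] 1 by (simp add: len_idx)
      next
        case 2
        then have "(\<psi>, as) \<in> T2" using C(2) by blast
        note * = T2D(1,3)[OF this]
        show ?thesis
          unfolding 2(2) widx[OF *(1)]
          by (rule *(2)[rule_format]) (rule separates_subset[OF sep S2[OF 2(1)]])
      qed
    qed
    ultimately show "\<exists>w. range w \<subseteq> univ M \<and> (\<forall>(\<psi>, is)\<in>D0. sat M (map w is) \<psi>)" by blast
  qed
  then obtain w where w: "range w \<subseteq> univ M" "\<forall>(\<psi>, is)\<in>?D. sat M (map w is) \<psi>"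
    by (elim exE conjE)
  define I where "I a = map w [pos a..<pos a + n]" for a
  have I: "concat (map I as) = map w (idx as)" for as
    unfolding idx_def I_def by (rule concat_map_upt[symmetric]) simp
  show ?thesis
  proof (intro exI[of _ I] conjI allI impI ballI)
    fix a show "I a \<in> tuples M n" using w(1) by (auto simp: I_def tuples_def)
  next
    fix as bs
    assume *: "set as \<subseteq> univ A \<and> set bs \<subseteq> univ A \<and> length as = length bs \<and> piso A A (set (zip as bs))"
    have "sat M (map w (idx as)) \<psi> \<longleftrightarrow> sat M (map w (idx bs)) \<psi>" if wf: "wf_fm L (length as * n) \<psi>" for \<psi>
    proof -
      have "(\<psi>, as, bs) \<in> T1" using * wf by (simp add: T1_def)
      then have "?f1 (\<psi>, as, bs) \<in> ?D" by (intro UnI1 imageI)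
      from bspec[OF w(2) this] have "sat M (map w (idx as @ idx bs)) (iff_fm (length as * n) \<psi>)" by simp
      then show ?thesis using sat_iff_fm[OF wf, of "map w (idx as)"] by (simp add: len_idx)
    qed
    then show "same_type L M {} (concat (map I as)) (concat (map I bs))"
      using * unfolding I same_type_def by (simp add: len_idx)
  next
    fix as \<psi>
    assume "set as \<subseteq> univ A \<and> wf_fm L (length as * n) \<psi> \<and>
       (\<forall>R J. separates A (set as) R J \<longrightarrow> sat M (concat (map (\<lambda>a. b (R a) (J a)) as)) \<psi>)"
    then have "(\<psi>, as) \<in> T2" by (simp add: T2_def)
    then have "?f2 (\<psi>, as) \<in> ?D" by (intro UnI2 imageI)
    from bspec[OF w(2) this] show "sat M (concat (map I as)) \<psi>" unfolding I by simp
  qed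
qed

section \<open>NTP2 and dividing across pictures\<close>

text \<open>Instances with equal parameters are the same formula; passing from finite sets of
  formulas to finite sets of indices makes such repetitions harmless.\<close>

lemma consistent_family:
  "consistent M m {(\<phi>, d i) | i. i \<in> S} \<longleftrightarrow>
    (\<forall>F\<subseteq>S. finite F \<longrightarrow> (\<exists>a\<in>tuples M m. \<forall>i\<in>F. sat M (a @ d i) \<phi>))"
proof -
  have S: "{(\<phi>, d i) | i. i \<in> S} = (\<lambda>i. (\<phi>, d i)) ` S" by blast
  let ?P = "\<lambda>q. \<exists>a\<in>tuples M m. \<forall>(\<phi>, d)\<in>q. sat M (a @ d) \<phi>"
  have "consistent M m ((\<lambda>i. (\<phi>, d i)) ` S) \<longleftrightarrow>
    (\<forall>q. finite q \<and> q \<subseteq> (\<lambda>i. (\<phi>, d i)) ` S \<longrightarrow> ?P q)"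
    unfolding consistent_def by blast
  also have "\<dots> \<longleftrightarrow> (\<forall>F. finite F \<and> F \<subseteq> S \<longrightarrow> ?P ((\<lambda>i. (\<phi>, d i)) ` F))"
    by (rule all_finite_subset_image)
  finally show ?thesis unfolding S by auto
qed

lemma consistent_finite_family:
  assumes "finite S"
  shows "consistent M m {(\<phi>, d i) | i. i \<in> S} \<longleftrightarrow> (\<exists>a\<in>tuples M m. \<forall>i\<in>S. sat M (a @ d i) \<phi>)"
  unfolding consistent_family using assms by (meson order_refl subsetD)

lemma consistent_sequence:
  "consistent M m {(\<phi>, d i) | i. True} \<longleftrightarrow>
    (\<forall>F. finite F \<longrightarrow> (\<exists>a\<in>tuples M m. \<forall>i\<in>F. sat M (a @ d i) \<phi>))"
  using consistent_family[of M m \<phi> d UNIV] by simp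

section \<open>Increasing sequences and their types\<close>

lemma ex_transitive_chain:
  assumes "x \<in> X" "\<And>x. x \<in> X \<Longrightarrow> \<exists>y\<in>X. r x y"
    and trans: "\<And>x y z. x \<in> X \<Longrightarrow> y \<in> X \<Longrightarrow> z \<in> X \<Longrightarrow> r x y \<Longrightarrow> r y z \<Longrightarrow> r x z"
  shows "\<exists>s :: nat \<Rightarrow> 'a. s 0 = x \<and> range s \<subseteq> X \<and> (\<forall>i j. i < j \<longrightarrow> r (s i) (s j))"
proof -
  have "\<exists>s. \<forall>n. (s n \<in> X \<and> (n = 0 \<longrightarrow> s n = x)) \<and> r (s n) (s (Suc n))"
  proof (rule dependent_nat_choice)
    show "\<exists>y. y \<in> X \<and> (0 = 0 \<longrightarrow> y = x)" for x0 :: nat using assms(1) by blast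
    show "\<exists>z. (z \<in> X \<and> (Suc n = 0 \<longrightarrow> z = x)) \<and> r y z" if "y \<in> X \<and> (n = 0 \<longrightarrow> y = x)" for y n
      using assms(2) that by auto
  qed
  then obtain s where s: "\<And>n. s n \<in> X" "s 0 = x" "\<And>n. r (s n) (s (Suc n))" by metis
  have "r (s i) (s j)" if "i < j" for i j
    using that
  proof (induction j)
    case (Suc j)
    show ?case
    proof (cases "i = j")
      case False
      then have "r (s i) (s j)" using Suc by simp
      then show ?thesis using trans[OF s(1) s(1) s(1) _ s(3)] by simp
    qed (simp add: s(3))
  qed simp
  then show ?thesis using s(1,2) by blast
qed

lemma rich_row:
  assumes A: "rich A" and x: "x \<in> univ A"
  shows "\<exists>s :: nat \<Rightarrow> 'a. s 0 = x \<and> range s \<subseteq> univ A \<and> (\<forall>i j. i < j \<longrightarrow> lss A (s i) (s j) \<and> eqv A (s i) (s j))"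
proof (rule ex_transitive_chain[OF x])
  show "\<exists>y\<in>univ A. lss A x y \<and> eqv A x y" if "x \<in> univ A" for x
    using A that unfolding rich_def by blast
  show "lss A x z \<and> eqv A x z" if "x \<in> univ A" "y \<in> univ A" "z \<in> univ A"
    "lss A x y \<and> eqv A x y" "lss A y z \<and> eqv A y z" for x y z
    using that ceq_lss_trans[OF rich_ceq[OF A], of x y z] ceq_eqv_trans[OF rich_ceq[OF A], of x y z] by simp
qed

lemma rich_transversal:
  assumes A: "rich A"
  shows "\<exists>s :: nat \<Rightarrow> 'a. range s \<subseteq> univ A \<and> (\<forall>i j. i < j \<longrightarrow> lss A (s i) (s j) \<and> \<not> eqv A (s i) (s j))"
proof -
  obtain x where x: "x \<in> univ A" using ceq_nonempty[OF rich_ceq[OF A]] by blast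
  have "\<exists>s :: nat \<Rightarrow> 'a. s 0 = x \<and> range s \<subseteq> univ A \<and> (\<forall>i j. i < j \<longrightarrow> lss A (s i) (s j) \<and> \<not> eqv A (s i) (s j))"
  proof (rule ex_transitive_chain[OF x])
    show "\<exists>y\<in>univ A. lss A x y \<and> \<not> eqv A x y" if "x \<in> univ A" for x
      using A that unfolding rich_def by blast
    show "lss A x z \<and> \<not> eqv A x z" if "x \<in> univ A" "y \<in> univ A" "z \<in> univ A"
      "lss A x y \<and> \<not> eqv A x y" "lss A y z \<and> \<not> eqv A y z" for x y z
      using that ceq_lss_trans[OF rich_ceq[OF A], of x y z] ceq_convex1[OF rich_ceq[OF A], of x y z] by blast
  qed
  then show ?thesis by blast
qed

text \<open>\<open>e\<close> says whether the list runs inside one class or through pairwise different classes.\<close>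

definition increasing :: "('f, ceq_rel, 'a) struct \<Rightarrow> bool \<Rightarrow> 'a list \<Rightarrow> bool" where
  "increasing A e xs \<longleftrightarrow> set xs \<subseteq> univ A \<and> sorted_wrt (\<lambda>x y. lss A x y \<and> (eqv A x y \<longleftrightarrow> e)) xs"

text \<open>In such a list positions decide everything: entry i lies below entry j exactly if i < j,
  and they are equivalent exactly if i = j or \<open>e\<close> holds.\<close>

lemma piso_increasing:
  assumes A: "ceq A" and xs: "increasing A e xs" and ys: "increasing A e ys" and len: "length xs = length ys"
  shows "piso A A (set (zip xs ys))"
proof (rule pisoI)
  have U: "zs ! i \<in> univ A" if "increasing A e zs" "i < length zs" for i zs
    using that nth_mem by (fastforce simp: increasing_def)
  have lt: "lss A (zs ! i) (zs ! j) \<and> (eqv A (zs ! i) (zs ! j) \<longleftrightarrow> e)"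
    if "increasing A e zs" "i < j" "j < length zs" for i j zs
    using that by (auto simp: increasing_def sorted_wrt_iff_nth_less)
  have rel: "(eqv A (zs ! i) (zs ! j) \<longleftrightarrow> i = j \<or> e) \<and> (lss A (zs ! i) (zs ! j) \<longleftrightarrow> i < j)"
    if zs: "increasing A e zs" and ij: "i < length zs" "j < length zs" for i j zs
  proof -
    consider "i < j" | "i = j" | "j < i" by linarith
    then show ?thesis
    proof cases
      case 1
      then show ?thesis using lt[OF zs 1 ij(2)] by simp
    next
      case 2
      then show ?thesis using ceq_refl[OF A U[OF zs ij(1)]] ceq_irrefl[OF A U[OF zs ij(1)]] by simp
    next
      case 3
      then show ?thesis
        using lt[OF zs 3 ij(1)] ceq_asym[OF A U[OF zs ij(2)] U[OF zs ij(1)]]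
          ceq_sym[OF A U[OF zs ij(2)] U[OF zs ij(1)]] ceq_sym[OF A U[OF zs ij(1)] U[OF zs ij(2)]] by auto
    qed
  qed
  fix x y assume "(x, y) \<in> set (zip xs ys)"
  then obtain i where i: "i < length xs" "x = xs ! i" "y = ys ! i" by (auto simp: set_zip)
  then show "x \<in> univ A \<and> y \<in> univ A" using U xs ys len by simp
  fix x' y' assume "(x', y') \<in> set (zip xs ys)"
  then obtain j where j: "j < length xs" "x' = xs ! j" "y' = ys ! j" by (auto simp: set_zip)
  show "(eqv A x x' \<longleftrightarrow> eqv A y y') \<and> (lss A x x' \<longleftrightarrow> lss A y y')"
    using rel[OF xs i(1) j(1)] rel[OF ys i(1)[unfolded len] j(1)[unfolded len]] i j by simp
qed

lemma increasing_map:
  assumes "range s \<subseteq> univ A" "\<And>i j. i < j \<Longrightarrow> lss A (s i) (s j) \<and> (eqv A (s i) (s j) \<longleftrightarrow> e)"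
    "sorted_wrt (<) is"
  shows "increasing A e (map s is)"
  using assms unfolding increasing_def sorted_wrt_map by (auto intro: sorted_wrt_mono_rel[rotated])

lemma increasing_subset: "increasing A e xs \<Longrightarrow> set xs \<subseteq> univ A"
  by (simp add: increasing_def)

lemma increasing_pair:
  "increasing A e [x, y] \<longleftrightarrow> x \<in> univ A \<and> y \<in> univ A \<and> lss A x y \<and> (eqv A x y \<longleftrightarrow> e)"
  by (auto simp: increasing_def)

lemma increasing_same_qf_type:
  assumes "rich A" "increasing A e xs" "increasing A e ys" "length xs = length ys"
  shows "same_qf_type L_ceq A xs ys"
  using same_qf_type_iff[OF assms(1) _ _ assms(4)] piso_increasing[OF rich_ceq[OF assms(1)] assms(2-4)] assms(2,3)
  by (simp add: increasing_def)

lemma indiscernible_increasing: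
  assumes A: "rich A" and s: "range s \<subseteq> univ A" "\<And>i j. i < j \<Longrightarrow> lss A (s i) (s j) \<and> (eqv A (s i) (s j) \<longleftrightarrow> e)"
  shows "indiscernible_sequence L_ceq A s"
  unfolding indiscernible_sequence_def
proof (intro conjI allI impI)
  fix "is" js :: "nat list" assume "sorted_wrt (<) is \<and> sorted_wrt (<) js \<and> length is = length js"
  then have inc: "increasing A e (map s is)" "increasing A e (map s js)"
    and len: "length (map s is) = length (map s js)"
    using increasing_map[OF s] by simp_all
  show "same_type L_ceq A {} (map s is) (map s js)"
    by (rule same_type_rich[OF A inc[THEN increasing_subset] len piso_increasing[OF rich_ceq[OF A] inc len]])
qed (fact s(1))

lemma indiscernible_pair_iff:
  assumes a: "indiscernible_sequence L_ceq A a" and "i < j" "wf_fm L_ceq 2 \<psi>"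
  shows "sat A [a i, a j] \<psi> \<longleftrightarrow> sat A [a 0, a 1] \<psi>"
proof -
  have "same_type L_ceq A {} (map a [i, j]) (map a [0, 1])"
    using a[unfolded indiscernible_sequence_def, THEN conjunct2, rule_format, of "[i, j]" "[0, 1]"] assms(2) by simp
  then show ?thesis using assms(3) unfolding same_type_def by (force simp: numeral_2_eq_2)
qed

lemma indiscernible_pair:
  assumes a: "indiscernible_sequence L_ceq A a" and ij: "i < j"
  shows "eqv A (a i) (a j) \<longleftrightarrow> eqv A (a 0) (a 1)" "lss A (a i) (a j) \<longleftrightarrow> lss A (a 0) (a 1)"
    "lss A (a j) (a i) \<longleftrightarrow> lss A (a 1) (a 0)"
  using indiscernible_pair_iff[OF a ij, of "fE 0 1"] indiscernible_pair_iff[OF a ij, of "fL 0 1"]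
    indiscernible_pair_iff[OF a ij, of "fL 1 0"] by (simp_all add: L_ceq_def)

text \<open>Common solvability at finitely many points is the formula \<open>joint\<close> about
  their images and \<open>c\<close>, and indiscernibility over \<open>c\<close> makes its truth
  depend on the quantifier-free type alone.\<close>

lemma indiscernible_picture_common_solution:
  assumes I: "indiscernible_picture L U (set c) n A I" and wf: "wf_fm L (m + n + length c) \<phi>"
    and as: "as \<noteq> []" "set as \<subseteq> univ A" "set bs \<subseteq> univ A" "same_qf_type L_ceq A as bs"
  shows "(\<exists>x\<in>tuples U m. \<forall>a\<in>set as. sat U (x @ I a @ c) \<phi>) \<longleftrightarrow>
    (\<exists>x\<in>tuples U m. \<forall>a\<in>set bs. sat U (x @ I a @ c) \<phi>)"
proof -
  have len: "\<forall>y\<in>set (map I zs). length y = n" if "set zs \<subseteq> univ A" for zs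
    using I that unfolding indiscernible_picture_def tuples_def by auto
  have eq: "length as = length bs" using as(4) by (simp add: same_qf_type_def)
  have "same_type L U (set c) (concat (map I as)) (concat (map I bs))"
    using I as unfolding indiscernible_picture_def by blast
  moreover have "wf_fm L (length (concat (map I as)) + length c) (joint m n (length as) \<phi>)"
    using length_concat_equal_lengths[OF len[OF as(2)]] wf_joint[OF wf, of "length as"] by simp
  ultimately have "sat U (concat (map I as) @ c) (joint m n (length as) \<phi>) \<longleftrightarrow>
      sat U (concat (map I bs) @ c) (joint m n (length as) \<phi>)"
    unfolding same_type_def by blast
  then show ?thesis
    using sat_joint[OF wf len[OF as(2)], of U] sat_joint[OF wf len[OF as(3)], of U] eq by simp
qed

section \<open>From dividing inside one class to an array\<close>

lemma NTP2_imp_not_divides_across: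
  fixes A :: "(unit, ceq_rel, 'a) struct"
  assumes NTP2: "NTP2 L U" and A: "rich A" and wf: "wf_fm L (m + n + length c) \<phi>" and c: "set c \<subseteq> univ U"
    and I: "indiscernible_picture L U (set c) n A I"
    and vert: "\<not> divides_vertically_across A U I m \<phi> c"
  shows "\<not> divides_across A U I m \<phi> c"
proof
  note cA = rich_ceq[OF A]
  define sol where "sol S \<longleftrightarrow> (\<exists>x\<in>tuples U m. \<forall>a\<in>S. sat U (x @ I a @ c) \<phi>)" for S
  have sol_mono: "sol S'" if "sol S" "S' \<subseteq> S" for S S' using that unfolding sol_def by blast
  have sol_eq: "sol (set as) \<longleftrightarrow> sol (set bs)"
    if "as \<noteq> []" "set as \<subseteq> univ A" "set bs \<subseteq> univ A" "same_qf_type L_ceq A as bs" for as bs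
    using indiscernible_picture_common_solution[OF I wf that] unfolding sol_def .
  have seq: "consistent U m {(\<phi>, I (a i) @ c) | i. True} \<longleftrightarrow> (\<forall>F. finite F \<longrightarrow> sol (a ` F))" for a :: "nat \<Rightarrow> 'a"
    unfolding consistent_sequence sol_def by simp
  assume "divides_across A U I m \<phi> c"
  then obtain a where a: "indiscernible_sequence L_ceq A a" and "\<not> consistent U m {(\<phi>, I (a i) @ c) | i. True}"
    unfolding divides_across_def by blast
  then obtain F where F: "finite F" "\<not> sol (a ` F)" unfolding seq by blast
  have aU: "a i \<in> univ A" for i using a unfolding indiscernible_sequence_def by blast
  have E: "eqv A (a 0) (a 1)"
    using vert a \<open>\<not> consistent U m _\<close> unfolding divides_vertically_across_def by blast
  obtain k0 where k0: "\<forall>i\<in>F. i < k0" using F(1) finite_nat_set_iff_bounded by auto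
  \<comment> \<open>\<open>k0\<close> bounds the indices of the finite unsolvable part. Adding 2
    secures the bound 2 \<le> k demanded by TP2, and a larger set of points stays
    unsolvable.\<close>
  define k where "k = k0 + 2"
  have "a ` F \<subseteq> set (map a [0..<k])" using k0 by (auto simp: k_def)
  then have nsol: "\<not> sol (set (map a [0..<k]))" using F(2) sol_mono by blast
  have row: "\<not> sol (set xs)" if xs: "increasing A True xs" "length xs = k" for xs
  proof -
    have Ea: "eqv A (a i) (a j)" if "i < j" for i j using indiscernible_pair(1)[OF a that] E by simp
    have ne: "xs \<noteq> []" using xs(2) by (auto simp: k_def)
    have xsU: "set xs \<subseteq> univ A" using xs(1) by (simp add: increasing_def)
    have cmp: "\<not> sol (set xs)" if zs: "increasing A True zs" "length zs = k" "set zs = set (map a [0..<k])" for zs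
      using sol_eq[OF ne xsU increasing_subset[OF zs(1)] increasing_same_qf_type[OF A xs(1) zs(1)]]
        xs(2) zs(2) nsol[folded zs(3)] by simp
    \<comment> \<open>The sequence may also be constant or decreasing. If constant, one instance is
      already unsolvable, and all points have the same type. If decreasing, the reversed list is
      increasing and has the same set of points.\<close>
    consider "lss A (a 0) (a 1)" | "a 0 = a 1" | "lss A (a 1) (a 0)"
      using ceq_trichotomy[OF cA aU aU] by blast
    then show ?thesis
    proof cases
      case 1
      have "increasing A True (map a [0..<k])"
      proof (rule increasing_map)
        show "lss A (a i) (a j) \<and> (eqv A (a i) (a j) \<longleftrightarrow> True)" if "i < j" for i j
          using Ea[OF that] indiscernible_pair(2)[OF a that] 1 by simp
      qed (use aU in auto)
      then show ?thesis by (rule cmp) simp_all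
    next
      case 2
      have const: "a i = a 0" for i
      proof (cases "i = 0")
        case False
        then show ?thesis using indiscernible_pair_iff[OF a, of 0 i "FEq (Var 0) (Var 1)"] 2 by simp
      qed simp
      have "b = a 0" if "b \<in> set (map a [0..<k])" for b using that const by fastforce
      then have "set (map a [0..<k]) \<subseteq> set [a 0]" by auto
      then have n0: "\<not> sol (set [a 0])" using nsol sol_mono by blast
      obtain x where x: "x \<in> set xs" using ne by (meson hd_in_set)
      have "piso A A (set (zip [x] [a 0]))"
        using x xsU aU ceq_refl[OF cA] ceq_irrefl[OF cA] by (intro pisoI) auto
      then have "same_qf_type L_ceq A [x] [a 0]" using same_qf_type_iff[OF A] x xsU aU by auto
      then have "\<not> sol (set [x])" using sol_eq[of "[x]" "[a 0]"] n0 x xsU aU by auto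
      then show ?thesis using sol_mono x by auto
    next
      case 3
      have "increasing A True (rev (map a [0..<k]))"
        unfolding increasing_def sorted_wrt_rev sorted_wrt_map
      proof (intro conjI)
        have "lss A (a j) (a i) \<and> (eqv A (a j) (a i) \<longleftrightarrow> True)" if "i < j" for i j
          using ceq_sym[OF cA aU aU Ea[OF that]] indiscernible_pair(3)[OF a that] 3 by simp
        then show "sorted_wrt (\<lambda>x y. lss A (a y) (a x) \<and> (eqv A (a y) (a x) \<longleftrightarrow> True)) [0..<k]"
          by (intro sorted_wrt_mono_rel[OF _ sorted_wrt_upt]) simp
      qed (use aU in auto)
      then show ?thesis by (rule cmp) simp_all
    qed
  qed
  obtain r :: "nat \<Rightarrow> 'a" where r: "range r \<subseteq> univ A" "\<forall>i j. i < j \<longrightarrow> lss A (r i) (r j) \<and> \<not> eqv A (r i) (r j)"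
    using rich_transversal[OF A] by (elim exE conjE)
  have "\<exists>s :: nat \<Rightarrow> 'a. s 0 = r i \<and> range s \<subseteq> univ A \<and> (\<forall>i j. i < j \<longrightarrow> lss A (s i) (s j) \<and> eqv A (s i) (s j))" for i
    using rich_row[OF A] r(1) by blast
  \<comment> \<open>Row \<open>i\<close> is an increasing sequence in the class of
    \<open>r i\<close>, so points of different rows compare like the points of the
    transversal.\<close>
  then obtain e :: "nat \<Rightarrow> nat \<Rightarrow> 'a" where e: "\<forall>i. e i 0 = r i \<and> range (e i) \<subseteq> univ A \<and>
      (\<forall>j j'. j < j' \<longrightarrow> lss A (e i j) (e i j') \<and> eqv A (e i j) (e i j'))"
    using choice[of "\<lambda>i s. s 0 = r i \<and> range s \<subseteq> univ A \<and> (\<forall>j j'. j < j' \<longrightarrow> lss A (s j) (s j') \<and> eqv A (s j) (s j'))"]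
    by blast
  have eU: "e i j \<in> univ A" for i j using e by blast
  have er: "eqv A (r i) (e i j)" for i j
    using e ceq_refl[OF cA eU, of i 0] by (cases "j = 0") (metis gr0I)+
  have transversal: "lss A (e i j) (e i' j') \<and> \<not> eqv A (e i j) (e i' j')" if "i < i'" for i j i' j'
  proof -
    have rU: "r i \<in> univ A" "r i' \<in> univ A" using r(1) by blast+
    have rr: "lss A (r i) (r i')" "\<not> eqv A (r i) (r i')" using r(2) that by blast+
    have 1: "lss A (e i j) (r i')" using ceq_lss_class(1)[OF cA rU(1) eU rU(2) er rr(2)] rr(1) by blast
    have 2: "\<not> eqv A (e i j) (r i')"
      using rr(2) ceq_eqv_trans[OF cA rU(1) eU rU(2) er] by blast
    have 3: "\<not> eqv A (r i') (e i j)" using 2 ceq_sym[OF cA rU(2) eU] by blast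
    have "lss A (e i j) (e i' j')" using ceq_lss_class(2)[OF cA rU(2) eU eU er 3] 1 by blast
    moreover have "\<not> eqv A (e i j) (e i' j')"
      using 2 ceq_eqv_trans[OF cA eU eU rU(2) _ ceq_sym[OF cA rU(2) eU er]] by blast
    ultimately show ?thesis by blast
  qed
  have len: "I x \<in> tuples U n" if "x \<in> univ A" for x
    using I that unfolding indiscernible_picture_def by blast
  \<comment> \<open>TP2 concerns formulas without parameters, so \<open>c\<close> becomes a constant
    part of every entry.\<close>
  have "has_kTP2 L U k m (n + length c) \<phi>"
    unfolding has_kTP2_def
  proof (intro exI[of _ "\<lambda>i j. I (e i j) @ c"] conjI allI impI)
    show "I (e i j) @ c \<in> tuples U (n + length c)" for i j
      using len[OF eU] c by (auto simp: tuples_def)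
  next
    fix f :: "nat \<Rightarrow> nat"
    \<comment> \<open>A path takes one point from each row, hence is an indiscernible sequence of
      inequivalent points; it is consistent because \<phi> does not divide vertically.\<close>
    have tr: "lss A (e i (f i)) (e j (f j)) \<and> (eqv A (e i (f i)) (e j (f j)) \<longleftrightarrow> False)" if "i < j" for i j
      using transversal[OF that] by blast
    have "range (\<lambda>i. e i (f i)) \<subseteq> univ A" using eU by blast
    from indiscernible_increasing[OF A this tr] have "indiscernible_sequence L_ceq A (\<lambda>i. e i (f i))" .
    moreover have "\<not> eqv A (e 0 (f 0)) (e 1 (f 1))" using tr[of 0 1] by simp
    ultimately show "consistent U m {(\<phi>, I (e i (f i)) @ c) | i. True}"
      using vert unfolding divides_vertically_across_def by blast
  next
    fix i and J :: "nat set" assume J: "finite J \<and> card J = k"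
    have "increasing A True (map (e i) (sorted_list_of_set J))"
      by (rule increasing_map) (use e eU in auto)
    then have "\<not> sol (e i ` J)" using row[of "map (e i) (sorted_list_of_set J)"] J by simp
    then show "\<not> consistent U m {(\<phi>, I (e i j) @ c) | j. j \<in> J}"
      using J consistent_finite_family[of J U m \<phi> "\<lambda>j. I (e i j) @ c"] unfolding sol_def by simp
  qed
  moreover have "2 \<le> k" by (simp add: k_def)
  ultimately show False using NTP2 wf unfolding NTP2_def by (metis add.assoc)
qed

text \<open>Equality of the two blocks is expressed by equations between coordinates, and these
  belong to the type.\<close>

lemma same_type_block_eq:
  assumes "same_type L M C (u @ v) (u' @ v')" "length u = n" "length v = n" "length u' = n" "length v' = n"
    and "u = v"
  shows "u' = v'"
proof (rule nth_equalityI)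
  fix l assume l: "l < length u'"
  then have "wf_fm L (length (u @ v) + length []) (FEq (Var l) (Var (n + l)))" using assms by simp
  then have "sat M ((u @ v) @ []) (FEq (Var l) (Var (n + l))) \<longleftrightarrow> sat M ((u' @ v') @ []) (FEq (Var l) (Var (n + l)))"
    using assms(1) unfolding same_type_def by (metis empty_subsetI list.set(1))
  then show "u' ! l = v' ! l" using assms l by (simp add: nth_append)
qed (use assms in simp)

text \<open>Solvability at inequivalent points and unsolvability at \<open>k\<close> points of one
  class hold under every separating placement in the array, so the picture inherits them through
  \<open>joint\<close> and its negation. Injectivity is deduced from these two facts and
  indiscernibility.\<close>

lemma kTP2_imp_divides_only_horizontally:
  fixes U :: "('f, 'r, 'u) struct" and A :: "(unit, ceq_rel, 'a) struct"
  assumes sat: "saturated L \<kappa> U" "Card_order \<kappa>" "(card_of {\<phi> :: ('f, 'r) fm. \<exists>n. wf_fm L n \<phi>}, \<kappa>) \<in> ordLess"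
    and U: "univ U \<noteq> {}" and k: "2 \<le> k" and wf: "wf_fm L (m + n) \<phi>" and tp: "has_kTP2 L U k m n \<phi>"
    and A: "rich A" "countable (univ A)"
  shows "\<exists>I. indiscernible_picture L U {} n A I \<and> \<not> divides_vertically_across A U I m \<phi> [] \<and>
    divides_across A U I m \<phi> []"
proof -
  note cA = rich_ceq[OF A(1)]
  obtain b where b: "\<And>i j. b i j \<in> tuples U n"
    and path: "\<And>f :: nat \<Rightarrow> nat. consistent U m {(\<phi>, b i (f i)) | i. True}"
    and row: "\<And>i J. finite J \<Longrightarrow> card J = k \<Longrightarrow> \<not> consistent U m {(\<phi>, b i j) | j. j \<in> J}"
    using tp unfolding has_kTP2_def by blast
  obtain I where I: "\<forall>a\<in>univ A. I a \<in> tuples U n"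
    and I_same: "\<forall>as bs. set as \<subseteq> univ A \<and> set bs \<subseteq> univ A \<and> length as = length bs \<and> piso A A (set (zip as bs)) \<longrightarrow>
       same_type L U {} (concat (map I as)) (concat (map I bs))"
    and I_sat: "\<forall>as \<psi>. set as \<subseteq> univ A \<and> wf_fm L (length as * n) \<psi> \<and>
       (\<forall>R J. separates A (set as) R J \<longrightarrow> sat U (concat (map (\<lambda>a. b (R a) (J a)) as)) \<psi>) \<longrightarrow>
       sat U (concat (map I as)) \<psi>"
    using ex_picture_of_array[OF sat cA A(2) U, of b n, OF b] by (elim exE conjE)
  have lenI: "length (I a) = n" if "a \<in> univ A" for a using I that by (simp add: tuples_def)
  have lenb: "length (b i j) = n" for i j using b[of i j] by (simp add: tuples_def)
  have wf': "wf_fm L (m + n + length []) \<phi>" using wf by simp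
  have wf_j: "wf_fm L (l * n) (joint m n l \<phi>)" for l using wf_joint[of L m n 0 \<phi> l] wf by simp
  have sat_j: "sat U (concat (map f as)) (joint m n (length as) \<phi>) \<longleftrightarrow>
      (\<exists>x\<in>tuples U m. \<forall>a\<in>set as. sat U (x @ f a) \<phi>)"
    if "\<forall>a\<in>set as. length (f a) = n" for f :: "'a \<Rightarrow> 'u list" and as
    using sat_joint[OF wf', of "map f as" U] that by simp
  have sol_path: "\<exists>x\<in>tuples U m. \<forall>a\<in>set as. sat U (x @ I a) \<phi>"
    if as: "set as \<subseteq> univ A" "\<forall>a\<in>set as. \<forall>a'\<in>set as. eqv A a a' \<longrightarrow> a = a'" for as
  proof -
    have "sat U (concat (map I as)) (joint m n (length as) \<phi>)"
    proof (rule I_sat[rule_format], intro conjI allI impI)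
      fix R J :: "'a \<Rightarrow> nat" assume sep: "separates A (set as) R J"
      have inj: "a = a'" if "a \<in> set as" "a' \<in> set as" "R a = R a'" for a a'
        using sep as(2) that unfolding separates_def by blast
      \<comment> \<open>In row \<open>i\<close> the path takes the column of the unique point of
        \<open>as\<close> placed there; in other rows the column is arbitrary.\<close>
      define f where "f i = J (SOME a. a \<in> set as \<and> R a = i)" for i
      have f: "f (R a) = J a" if "a \<in> set as" for a
      proof -
        have "(SOME a'. a' \<in> set as \<and> R a' = R a) = a"
          using that inj by (intro some_equality) auto
        then show ?thesis by (simp add: f_def)
      qed
      obtain x where "x \<in> tuples U m" "\<forall>i\<in>R ` set as. sat U (x @ b i (f i)) \<phi>"
        using path[of f, unfolded consistent_sequence, rule_format, of "R ` set as"] by auto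
      then have "\<exists>x\<in>tuples U m. \<forall>a\<in>set as. sat U (x @ b (R a) (J a)) \<phi>" using f by auto
      then show "sat U (concat (map (\<lambda>a. b (R a) (J a)) as)) (joint m n (length as) \<phi>)"
        using sat_j[of as "\<lambda>a. b (R a) (J a)"] lenb by simp
    qed (use as(1) wf_j in auto)
    then show ?thesis using sat_j[of as I] lenI as(1) by auto
  qed
  have nsol_row: "\<not> (\<exists>x\<in>tuples U m. \<forall>a\<in>set as. sat U (x @ I a) \<phi>)"
    if as: "set as \<subseteq> univ A" "\<forall>a\<in>set as. \<forall>a'\<in>set as. eqv A a a'" "distinct as" "length as = k" for as
  proof -
    have "sat U (concat (map I as)) (FNeg (joint m n (length as) \<phi>))"
    proof (rule I_sat[rule_format], intro conjI allI impI)
      fix R J :: "'a \<Rightarrow> nat" assume sep: "separates A (set as) R J"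
      have ne: "as \<noteq> []" using as(4) k by auto
      have sepD: "R a = R a' \<longleftrightarrow> eqv A a a'" "J a = J a' \<longleftrightarrow> a = a'" if "a \<in> set as" "a' \<in> set as" for a a'
        using sep that by (simp_all add: separates_def)
      \<comment> \<open>Equivalent points are placed in one row, and distinct ones in different
        columns, so k-inconsistency of that row applies.\<close>
      have R: "R a = R (hd as)" if "a \<in> set as" for a
        using sepD(1)[OF that hd_in_set[OF ne]] as(2) that ne by simp
      have "inj_on J (set as)" by (rule inj_onI) (simp add: sepD(2))
      then have "card (J ` set as) = k" using as(3,4) by (simp add: card_image distinct_card)
      then have "\<not> consistent U m {(\<phi>, b (R (hd as)) j) | j. j \<in> J ` set as}" using row by simp
      then have "\<not> (\<exists>x\<in>tuples U m. \<forall>j\<in>J ` set as. sat U (x @ b (R (hd as)) j) \<phi>)"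
        by (simp only: consistent_finite_family finite_imageI List.finite_set not_False_eq_True)
      then have "\<not> (\<exists>x\<in>tuples U m. \<forall>a\<in>set as. sat U (x @ b (R a) (J a)) \<phi>)" using R by simp
      then show "sat U (concat (map (\<lambda>a. b (R a) (J a)) as)) (FNeg (joint m n (length as) \<phi>))"
        using sat_j[of as "\<lambda>a. b (R a) (J a)"] lenb by simp
    qed (use as(1) wf_j in auto)
    then show ?thesis using sat_j[of as I] lenI as(1) by auto
  qed
  have nsol_seq: "\<not> (\<exists>x\<in>tuples U m. \<forall>i<k. sat U (x @ I (s i)) \<phi>)"
    if s: "range s \<subseteq> univ A" "\<forall>i j. i < j \<longrightarrow> lss A (s i) (s j) \<and> eqv A (s i) (s j)" for s :: "nat \<Rightarrow> 'a"
  proof -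
    have sU: "s i \<in> univ A" for i using s(1) by blast
    have "eqv A (s i) (s j)" for i j
      using s(2) ceq_refl[OF cA sU] ceq_sym[OF cA sU sU] by (metis nat_neq_iff)
    moreover have "inj s"
      using s(2) ceq_irrefl[OF cA sU] by (metis injI nat_neq_iff)
    ultimately have "\<not> (\<exists>x\<in>tuples U m. \<forall>a\<in>set (map s [0..<k]). sat U (x @ I a) \<phi>)"
      using sU by (intro nsol_row) (auto simp: distinct_map intro: inj_on_subset)
    then show ?thesis by fastforce
  qed
  have I_eq: "I a' = I b'"
    if ab: "increasing A e [a, b]" "increasing A e [a', b']" "I a = I b" for a b a' b' e
  proof -
    have U: "a \<in> univ A" "b \<in> univ A" "a' \<in> univ A" "b' \<in> univ A" using ab(1,2) by (simp_all add: increasing_pair)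
    have "piso A A (set (zip [a, b] [a', b']))" using piso_increasing[OF cA ab(1,2)] by simp
    then have "same_type L U {} (I a @ I b) (I a' @ I b')"
      using I_same[rule_format, of "[a, b]" "[a', b']"] U by simp
    then show ?thesis by (rule same_type_block_eq) (use lenI U ab(3) in auto)
  qed
  \<comment> \<open>If two equivalent points had the same image, so would all terms of an increasing
    sequence starting at \<open>a\<close> in its class, since all such pairs have the same type. The
    instances along it would be one formula, solvable by \<open>sol_path\<close> and unsolvable by
    \<open>nsol_seq\<close>.\<close>
  have ne_class: "I a \<noteq> I b" if ab: "increasing A True [a, b]" for a b
  proof
    assume eq: "I a = I b"
    have aU: "a \<in> univ A" using ab by (simp add: increasing_pair)
    obtain s :: "nat \<Rightarrow> 'a" where s: "s 0 = a" "range s \<subseteq> univ A"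
      "\<forall>i j. i < j \<longrightarrow> lss A (s i) (s j) \<and> eqv A (s i) (s j)"
      using rich_row[OF A(1) aU] by (elim exE conjE)
    have Is: "I (s i) = I a" for i
    proof (cases "i = 0")
      case False
      then have "increasing A True [s 0, s i]" using s(2,3) by (auto simp: increasing_pair)
      then show ?thesis using I_eq[OF ab _ eq] s(1) by metis
    qed (simp add: s(1))
    have "\<exists>x\<in>tuples U m. \<forall>a'\<in>set [a]. sat U (x @ I a') \<phi>" using aU by (intro sol_path) auto
    then show False using nsol_seq[OF s(2,3)] Is by auto
  qed
  have ne: "I a \<noteq> I b" if U: "a \<in> univ A" "b \<in> univ A" and ab: "lss A a b" for a b
  proof (cases "eqv A a b")
    case True
    then show ?thesis using ne_class U ab by (simp add: increasing_pair)
  next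
    case False
    \<comment> \<open>The pairs (a, b) and (a, b') have the same quantifier-free type, so
      \<open>I a = I b\<close> would force \<open>I b = I b'\<close>, a collision inside one
      class.\<close>
    obtain b' where b': "b' \<in> univ A" "lss A b b'" "eqv A b b'" using A(1) U(2) unfolding rich_def by blast
    have lt: "lss A a b'" using ceq_lss_trans[OF cA U(1) U(2) b'(1) ab b'(2)] .
    have "\<not> eqv A a b'" using False ceq_convex1[OF cA U(1) U(2) b'(1) ab b'(2)] by blast
    then have "increasing A False [a, b]" "increasing A False [a, b']"
      using U b'(1) ab lt False by (simp_all add: increasing_pair)
    then have "I a = I b \<Longrightarrow> I a = I b'" using I_eq by blast
    moreover have "I b \<noteq> I b'" using ne_class U(2) b' by (simp add: increasing_pair)
    ultimately show ?thesis by auto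
  qed
  have "inj_on I (univ A)"
    using ne ceq_trichotomy[OF cA] by (intro inj_onI) metis
  have "indiscernible_picture L U {} n A I"
    unfolding indiscernible_picture_def
  proof (intro conjI allI impI; (elim conjE)?)
    show "inj_on I (univ A)" by fact
    show "I ` univ A \<subseteq> tuples U n" using I by blast
    fix as bs assume U: "set as \<subseteq> univ A" "set bs \<subseteq> univ A" and q: "same_qf_type L_ceq A as bs"
    then have "length as = length bs" by (simp add: same_qf_type_def)
    moreover from this have "piso A A (set (zip as bs))" using q same_qf_type_iff[OF A(1) U] by simp
    ultimately show "same_type L U {} (concat (map I as)) (concat (map I bs))"
      using I_same[rule_format, of as bs] U by simp
  qed
  moreover have "\<not> divides_vertically_across A U I m \<phi> []"
  proof
    assume "divides_vertically_across A U I m \<phi> []"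
    then obtain a where a: "indiscernible_sequence L_ceq A a" "\<not> eqv A (a 0) (a 1)"
      and "\<not> consistent U m {(\<phi>, I (a i) @ []) | i. True}"
      unfolding divides_vertically_across_def by blast
    then obtain F where F: "finite F" "\<not> (\<exists>x\<in>tuples U m. \<forall>i\<in>F. sat U (x @ I (a i) @ []) \<phi>)"
      unfolding consistent_sequence by blast
    have aU: "a i \<in> univ A" for i using a(1) unfolding indiscernible_sequence_def by blast
    have "i = j" if "eqv A (a i) (a j)" for i j
      using indiscernible_pair(1)[OF a(1), of i j] indiscernible_pair(1)[OF a(1), of j i] a(2) that
        ceq_sym[OF cA aU aU, of i j] by (metis nat_neq_iff)
    then have "\<exists>x\<in>tuples U m. \<forall>b\<in>set (map a (sorted_list_of_set F)). sat U (x @ I b) \<phi>"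
      using aU by (intro sol_path) auto
    then show False using F by simp
  qed
  moreover have "divides_across A U I m \<phi> []"
  proof -
    obtain x where x: "x \<in> univ A" using ceq_nonempty[OF cA] by blast
    obtain s :: "nat \<Rightarrow> 'a" where s: "range s \<subseteq> univ A"
      "\<forall>i j. i < j \<longrightarrow> lss A (s i) (s j) \<and> eqv A (s i) (s j)"
      using rich_row[OF A(1) x] by (elim exE conjE)
    have "indiscernible_sequence L_ceq A s"
      by (rule indiscernible_increasing[OF A(1) s(1), where e = True]) (use s(2) in simp)
    moreover have "\<not> (\<exists>x\<in>tuples U m. \<forall>i\<in>{..<k}. sat U (x @ I (s i) @ []) \<phi>)"
      using nsol_seq[OF s] by fastforce
    then have "\<not> consistent U m {(\<phi>, I (s i) @ []) | i. True}"
      unfolding consistent_sequence by blast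
    ultimately show ?thesis unfolding divides_across_def by blast
  qed
  ultimately show ?thesis by blast
qed

theorem theorem5p8:
  fixes L :: "('f, 'r) language" and T :: "('f, 'r) fm set"
    and \<kappa> :: "'k rel" and U :: "('f, 'r, 'u) struct"
  assumes "complete_theory L T"
    and "monster_model L T \<kappa> U"
    and "infinite (UNIV :: 'a set)"
  shows "NTP2 L U \<longleftrightarrow>
    (\<forall>(A :: (unit, ceq_rel, 'a) struct) m n \<phi> c I.
       models L_ceq A T_ceq_star \<and> countable (univ A) \<and>
       wf_fm L (m + n + length c) \<phi> \<and> set c \<subseteq> univ U \<and>
       indiscernible_picture L U (set c) n A I \<longrightarrow>
       \<not> divides_vertically_across A U I m \<phi> c \<longrightarrow>
       \<not> divides_across A U I m \<phi> c)"
    (is "_ \<longleftrightarrow> ?horizontal")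
proof
  assume "NTP2 L U"
  then show ?horizontal
    unfolding models_T_ceq_star by (intro allI impI; elim conjE) (rule NTP2_imp_not_divides_across)
next
  assume R: ?horizontal
  \<comment> \<open>A single model on the given infinite type suffices as a test, with the empty
    list of parameters.\<close>
  obtain A :: "(unit, ceq_rel, 'a) struct" where A: "rich A" "countable (univ A)"
    using ex_rich_countable[OF assms(3)] by blast
  have U: "saturated L \<kappa> U" "Card_order \<kappa>" "(card_of {\<phi> :: ('f, 'r) fm. \<exists>n. wf_fm L n \<phi>}, \<kappa>) \<in> ordLess"
    "univ U \<noteq> {}"
    using assms(2) by (simp_all add: monster_model_def models_def is_structure_def)
  show "NTP2 L U"
    unfolding NTP2_def
  proof (rule notI, elim exE conjE)
    fix k m n \<phi> assume "2 \<le> k" and wf: "wf_fm L (m + n) \<phi>" and "has_kTP2 L U k m n \<phi>"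
    then obtain I where I: "indiscernible_picture L U {} n A I" "\<not> divides_vertically_across A U I m \<phi> []"
      "divides_across A U I m \<phi> []"
      using kTP2_imp_divides_only_horizontally[OF U _ _ _ A] by blast
    have "models L_ceq A T_ceq_star" using A(1) by (simp add: models_T_ceq_star)
    then have "\<not> divides_across A U I m \<phi> []"
      using R[rule_format, of A m n "[]" \<phi> I] A(2) wf I(1,2) by simp
    then show False using I(3) by simp
  qed
qed

end
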